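(* Let $K$ and $L$ be two Sylow-conjugate number fields with common Galois closure $M/\mathbb{Q}$ and Galois group $G=\mathrm{Gal}(M/\mathbb{Q})$. Assume that either $[K:\mathbb{Q}]=[L:\mathbb{Q}]\leq 6$ or $|G|<48$. Then $K$ and $L$ are isomorphic.
   Context: Fix an algebraic closure $\overline{\mathbb{Q}}$ of $\mathbb{Q}$. A number field is a finite extension of $\mathbb{Q}$ contained in $\overline{\mathbb{Q}}$, and $\mathrm{Gal}(K)=\mathrm{Gal}(\overline{\mathbb{Q}}/K)$. Two number fields $K$ and $L$ are called Sylow-conjugate if for every prime $p$, the $p$-Sylow subgroups of $\mathrm{Gal}(K)$ and $\mathrm{Gal}(L)$ are conjugate in $\mathrm{Gal}(\mathbb{Q})$. Two Sylow-conjugate number fields have the same degree and the same Galois closure over $\mathbb{Q}$, the latter called their common Galois closure. *)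

theory Defs
  imports "HOL-Algebra.Algebra" "HOL-Analysis.Analysis" "HOL-Algebra.Algebraic_Closure_Type"
begin

section \<open>Number fields in a fixed algebraic closure of the rationals\<close>

type_synonym qbar = "rat alg_closure"

text \<open>A subset of \<open>qbar\<close> as a ring in the sense of HOL-Algebra.\<close>

definition qbar_ring :: "qbar set \<Rightarrow> qbar ring"
  where "qbar_ring E = ring_of_type_algebra \<lparr>carrier := E\<rparr>"

abbreviation subfield_qbar :: "qbar set \<Rightarrow> bool"
  where "subfield_qbar E \<equiv> subfield E (qbar_ring UNIV)"

text \<open>For subfields \<open>F \<subseteq> E\<close>. The number \<open>field_degree F E\<close> is meaningful
  only if the extension is finite.\<close>

definition finite_ext :: "qbar set \<Rightarrow> qbar set \<Rightarrow> bool"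
  where "finite_ext F E \<longleftrightarrow> ring.finite_dimension (qbar_ring UNIV) F E"

definition field_degree :: "qbar set \<Rightarrow> qbar set \<Rightarrow> nat"
  where "field_degree F E = ring.dim (qbar_ring UNIV) F E"

definition number_field :: "qbar set \<Rightarrow> bool"
  where "number_field K \<longleftrightarrow> subfield_qbar K \<and> finite_ext \<rat> K"


section \<open>Galois groups and Galois closures\<close>

text \<open>\<open>Gal E F\<close> is \<open>Gal(E/F)\<close>, with composition of maps as multiplication. As in
  \<^const>\<open>BijGroup\<close>, its elements are extensional functions, so that distinct elements
  are distinct as maps on \<open>E\<close>.\<close>

definition Gal :: "qbar set \<Rightarrow> qbar set \<Rightarrow> (qbar \<Rightarrow> qbar) monoid"
  where "Gal E F = BijGroup E
    \<lparr>carrier := {\<sigma> \<in> Bij E. \<sigma> \<in> ring_hom (qbar_ring E) (qbar_ring E) \<and> (\<forall>x\<in>F. \<sigma> x = x)}\<rparr>"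

abbreviation abs_Gal :: "qbar set \<Rightarrow> (qbar \<Rightarrow> qbar) monoid"
  where "abs_Gal F \<equiv> Gal UNIV F"

text \<open>All extensions inside \<open>qbar\<close> are algebraic, so being Galois means that the
  field fixed by the automorphisms is the base field.\<close>

definition is_galois :: "qbar set \<Rightarrow> qbar set \<Rightarrow> bool"
  where "is_galois E F \<longleftrightarrow> {x \<in> E. \<forall>\<sigma>\<in>carrier (Gal E F). \<sigma> x = x} = F"

text \<open>The smallest subfield that contains \<open>K\<close> and is Galois over the rationals.\<close>

definition galois_closure :: "qbar set \<Rightarrow> qbar set"
  where "galois_closure K = \<Inter>{M. subfield_qbar M \<and> is_galois M \<rat> \<and> K \<subseteq> M}"

text \<open>The Krull topology on \<open>Gal(F)\<close>. The generating sets, the left cosets of the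
  subgroups \<open>Gal(E)\<close> with \<open>E/F\<close> finite, in fact form a basis.\<close>

definition krull_topology :: "qbar set \<Rightarrow> (qbar \<Rightarrow> qbar) topology"
  where "krull_topology F = topology_generated_by
    {\<sigma> <#\<^bsub>abs_Gal F\<^esub> carrier (abs_Gal E) | \<sigma> E.
       \<sigma> \<in> carrier (abs_Gal F) \<and> subfield_qbar E \<and> F \<subseteq> E \<and> finite_ext F E}"


section \<open>Sylow subgroups of profinite groups\<close>

text \<open>In the next two definitions \<open>G\<close> is meant to be a profinite group with topology \<open>T\<close>,
  so that open subgroups have finite index.\<close>

definition pro_p_group :: "nat \<Rightarrow> ('a, 'b) monoid_scheme \<Rightarrow> 'a topology \<Rightarrow> bool"
  where "pro_p_group p G T \<longleftrightarrow>
    (\<forall>N. N \<lhd> G \<and> openin T N \<longrightarrow> (\<exists>n. Coset.order (G Mod N) = p ^ n))"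

text \<open>A \<open>p\<close>-Sylow subgroup is a closed pro-\<open>p\<close> subgroup whose index, a supernatural number,
  is prime to \<open>p\<close>. That index is the least common multiple of the indices of the
  open subgroups containing \<open>P\<close>, which gives the last conjunct.\<close>

definition pro_sylow :: "nat \<Rightarrow> ('a, 'b) monoid_scheme \<Rightarrow> 'a topology \<Rightarrow> 'a set \<Rightarrow> bool"
  where "pro_sylow p G T P \<longleftrightarrow>
    subgroup P G \<and> closedin T P \<and>
    pro_p_group p (G \<lparr>carrier := P\<rparr>) (subtopology T P) \<and>
    (\<forall>U. subgroup U G \<and> openin T U \<and> P \<subseteq> U \<longrightarrow> \<not> p dvd card (rcosets\<^bsub>G\<^esub> U))"

definition conjugate_in :: "('a, 'b) monoid_scheme \<Rightarrow> 'a set \<Rightarrow> 'a set \<Rightarrow> bool"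
  where "conjugate_in G P Q \<longleftrightarrow>
    (\<exists>g\<in>carrier G. Q = g <#\<^bsub>G\<^esub> (P #>\<^bsub>G\<^esub> inv\<^bsub>G\<^esub> g))"

definition sylow_conjugate :: "qbar set \<Rightarrow> qbar set \<Rightarrow> bool"
  where "sylow_conjugate K L \<longleftrightarrow>
    (\<forall>p P Q. Factorial_Ring.prime p
       \<and> pro_sylow p (abs_Gal K) (krull_topology K) P
       \<and> pro_sylow p (abs_Gal L) (krull_topology L) Q
       \<longrightarrow> conjugate_in (abs_Gal \<rat>) P Q)"

end

theory Submission
  imports Defs
begin

text \<open>
Write \<open>\<Omega>\<close> for the set of conjugates of a primitive element \<open>\<theta>\<close> of \<open>K\<close>. It has
\<open>n = [K:\<rat>]\<close> elements, \<open>Gal(\<rat>)\<close> acts on it transitively, and the group of permutations that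
\<open>Gal(\<rat>)\<close> induces on it is \<open>Gal(M/\<rat>)\<close>. If \<open>Gal(L)\<close> fixes a point \<open>g \<theta>\<close> of \<open>\<Omega>\<close>, then it is
contained in the stabilizer of that point, which has the same index in \<open>Gal(\<rat>)\<close>; so the two are
equal, and \<open>g\<close> maps \<open>K\<close> onto \<open>L\<close>. The theorem therefore says that \<open>Gal(L)\<close> has a fixed point on
\<open>\<Omega>\<close>.

What Sylow conjugacy says about the action is the following. For a prime \<open>p\<close> let \<open>P\<close> be a Sylow
subgroup of \<open>Gal(K)\<close>. It fixes \<open>\<theta>\<close>, so a conjugate of it is a Sylow subgroup of \<open>Gal(L)\<close> that
fixes a conjugate of \<open>\<theta>\<close>. Hence \<open>Gal(L)\<close> has, for every \<open>p\<close>, an orbit on \<open>\<Omega>\<close> of size prime to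
\<open>p\<close>. Moreover \<open>Gal(K)\<close> and \<open>Gal(L)\<close> induce groups of the same order on every finite invariant set,
because the \<open>p\<close>-part of that order is the order of the group that the Sylow subgroups induce. So
\<open>[L:\<rat>] = n\<close>, and \<open>Gal(L)\<close> induces on \<open>\<Omega>\<close> a group of order \<open>h\<close> with \<open>n h = |Gal(M/\<rat>)|\<close>.

Suppose that \<open>Gal(L)\<close> has no fixed point. There is an orbit of odd size \<open>s \<ge> 3\<close>, and, for a prime
factor \<open>q\<close> of \<open>s\<close>, another orbit of size \<open>t \<ge> 2\<close> prime to \<open>q\<close>; both sizes divide \<open>h\<close>. If \<open>n \<le> 6\<close>
or \<open>n h < 48\<close>, elementary arithmetic leaves only \<open>n = 5\<close> or \<open>n = 7\<close>, with \<open>t = 2\<close>. So the heart of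
the matter is a statement on transitive groups of prime degree
(\<open>prime_degree_orbit_of_size_two\<close>): a subgroup of index \<open>n\<close> with an orbit \<open>{a, a'}\<close> of size two
induces a group of order at most two. Indeed the images of \<open>{a, a'}\<close> are the edges of a graph on
\<open>\<Omega>\<close> in which every vertex has at most two neighbours, by counting indices, and which is connected,
as \<open>n\<close> is prime. An automorphism of such a graph that fixes both ends of an edge is trivial.
This contradicts \<open>s | h\<close>.

Two further things have to be proved. Sylow conjugacy is a condition on all pairs of Sylow
subgroups, so it is of use only because profinite groups have Sylow subgroups. As the field of
algebraic numbers is countable, a Sylow subgroup is obtained as the intersection of a descending
sequence of preimages of Sylow subgroups of finite quotients (\<open>pro_sylow_exists\<close>). The Galois theory that is needed rests on one fact, that the automorphisms of the field
of algebraic numbers fix only the rationals (\<open>rat_if_fixed\<close>), which follows from extending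
homomorphisms by Zorn's lemma. From it, Lagrange interpolation over the conjugates of a primitive
element gives that a number field is the fixed field of its Galois group, and the descriptions of the
Krull topology as the topology of pointwise convergence and of the Galois closure.
\<close>

section \<open>Indices of subgroups of possibly infinite groups\<close>

lemma card_image_eq_if_same_kernel:
  assumes "\<And>x y. x \<in> A \<Longrightarrow> y \<in> A \<Longrightarrow> f x = f y \<longleftrightarrow> g x = g y"
  shows "finite (f ` A) \<longleftrightarrow> finite (g ` A)" and "card (f ` A) = card (g ` A)"
proof -
  have "bij_betw (\<lambda>c. g (inv_into A f c)) (f ` A) (g ` A)"
  proof (rule bij_betw_imageI)
    show "inj_on (\<lambda>c. g (inv_into A f c)) (f ` A)"
    proof (rule inj_onI)
      fix c d assume cd: "c \<in> f ` A" "d \<in> f ` A" and eq: "g (inv_into A f c) = g (inv_into A f d)"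
      then have "f (inv_into A f c) = f (inv_into A f d)"
        using assms inv_into_into[OF cd(1)] inv_into_into[OF cd(2)] by blast
      then show "c = d" using cd by (simp add: f_inv_into_f)
    qed
    have "g (inv_into A f (f a)) = g a" if "a \<in> A" for a
    proof -
      have "f (inv_into A f (f a)) = f a" "inv_into A f (f a) \<in> A"
        using that by (auto simp: f_inv_into_f inv_into_into)
      then show ?thesis using assms that by blast
    qed
    then show "(\<lambda>c. g (inv_into A f c)) ` f ` A = g ` A"
      by (auto simp: image_image)
  qed
  then show "finite (f ` A) \<longleftrightarrow> finite (g ` A)" and "card (f ` A) = card (g ` A)"
    by (auto dest: bij_betw_finite bij_betw_same_card)
qed

text \<open>This is the counting behind the multiplicativity of indices: \<open>g\<close> refines \<open>f\<close>, and takes the same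
number of values on each fibre of \<open>f\<close>.\<close>

lemma card_image_equal_fibres:
  assumes fin: "finite (f ` A)"
    and fib: "\<And>a. a \<in> A \<Longrightarrow> card (g ` {b \<in> A. f b = f a}) = k"
    and refine: "\<And>a b. a \<in> A \<Longrightarrow> b \<in> A \<Longrightarrow> g a = g b \<Longrightarrow> f a = f b"
    and fing: "finite (g ` A)"
  shows "card (g ` A) = card (f ` A) * k"
proof -
  have eq: "g ` A = (\<Union>c\<in>f ` A. g ` {b \<in> A. f b = c})" by auto
  have "card (g ` A) = (\<Sum>c\<in>f ` A. card (g ` {b \<in> A. f b = c}))"
    unfolding eq
  proof (rule card_UN_disjoint[OF fin])
    show "\<forall>c\<in>f ` A. finite (g ` {b \<in> A. f b = c})"
      using fing by (auto intro: finite_subset[of _ "g ` A"])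
    show "\<forall>c\<in>f ` A. \<forall>d\<in>f ` A. c \<noteq> d \<longrightarrow>
        g ` {b \<in> A. f b = c} \<inter> g ` {b \<in> A. f b = d} = {}"
      using refine by blast
  qed
  also have "\<dots> = (\<Sum>c\<in>f ` A. k)" by (intro sum.cong) (auto simp: fib)
  finally show ?thesis by simp
qed

text \<open>The index \<open>[V:U]\<close>, and 0 if that index is infinite.\<close>

definition rel_index :: "('a, 'b) monoid_scheme \<Rightarrow> 'a set \<Rightarrow> 'a set \<Rightarrow> nat"
  where "rel_index G V U = card (rcosets\<^bsub>G\<lparr>carrier := V\<rparr>\<^esub> U)"

lemma rcosets_restrict: "rcosets\<^bsub>G\<lparr>carrier := V\<rparr>\<^esub> U = (\<lambda>x. U #>\<^bsub>G\<^esub> x) ` V"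
  by (auto simp: RCOSETS_def r_coset_def)

context group
begin

lemma rcos_eq_iff:
  assumes "subgroup U G" "x \<in> carrier G" "y \<in> carrier G"
  shows "U #> x = U #> y \<longleftrightarrow> x \<otimes> inv y \<in> U"
proof
  assume "U #> x = U #> y"
  then have "x \<in> U #> y" using rcos_self[OF assms(2,1)] by simp
  then show "x \<otimes> inv y \<in> U" by (rule subgroup.rcos_module_imp[OF assms(1) is_group assms(3)])
next
  assume "x \<otimes> inv y \<in> U"
  then have "x \<in> U #> y" by (rule subgroup.rcos_module_rev[OF assms(1) is_group assms(3,2)])
  then show "U #> x = U #> y" using repr_independence assms by metis
qed

lemma rel_index_mult:
  assumes U: "subgroup U G" and V: "subgroup V G" and Z: "subgroup Z G"
    and UV: "U \<subseteq> V" and VZ: "V \<subseteq> Z" and fin: "finite (rcosets\<^bsub>G\<lparr>carrier := Z\<rparr>\<^esub> U)"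
  shows "rel_index G Z U = rel_index G Z V * rel_index G V U"
proof -
  have Zc: "z \<in> carrier G" if "z \<in> Z" for z using Z that by (simp add: subgroup.mem_carrier)
  have Vc: "z \<in> carrier G" if "z \<in> V" for z using V that by (simp add: subgroup.mem_carrier)
  have refine: "V #> a = V #> b" if "a \<in> Z" "b \<in> Z" "U #> a = U #> b" for a b
    using that rcos_eq_iff[OF U] rcos_eq_iff[OF V] Zc UV by blast
  have finV: "finite ((\<lambda>x. V #> x) ` Z)"
  proof -
    have "(\<lambda>x. V #> x) ` Z = (\<lambda>c. V #> (SOME z. z \<in> Z \<and> U #> z = c)) ` (\<lambda>x. U #> x) ` Z"
      unfolding image_image
    proof (rule image_cong[OF refl])
      fix z assume "z \<in> Z"
      then have "\<exists>y. y \<in> Z \<and> U #> y = U #> z" by blast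
      from someI_ex[OF this] show "V #> z = V #> (SOME y. y \<in> Z \<and> U #> y = U #> z)"
        using refine \<open>z \<in> Z\<close> by metis
    qed
    then show ?thesis using fin unfolding rcosets_restrict by simp
  qed
  have "card ((\<lambda>x. U #> x) ` {b \<in> Z. V #> b = V #> a}) = rel_index G V U" if a: "a \<in> Z" for a
  proof -
    have "{b \<in> Z. V #> b = V #> a} = (\<lambda>v. v \<otimes> a) ` V"
    proof (intro equalityI subsetI)
      fix b assume "b \<in> {b \<in> Z. V #> b = V #> a}"
      then have "b \<otimes> inv a \<in> V" "b \<in> Z" using rcos_eq_iff[OF V] Zc a by auto
      moreover have "b = (b \<otimes> inv a) \<otimes> a" using Zc a \<open>b \<in> Z\<close> by (simp add: m_assoc)
      ultimately show "b \<in> (\<lambda>v. v \<otimes> a) ` V" by blast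
    next
      fix b assume "b \<in> (\<lambda>v. v \<otimes> a) ` V"
      then obtain v where v: "v \<in> V" "b = v \<otimes> a" by auto
      then have "b \<in> Z" using VZ Z a by (auto intro: subgroup.m_closed)
      moreover have "b \<otimes> inv a = v" using v Zc[OF a] Vc by (simp add: m_assoc)
      ultimately show "b \<in> {b \<in> Z. V #> b = V #> a}"
        using rcos_eq_iff[OF V] Zc a v by auto
    qed
    then have "card ((\<lambda>x. U #> x) ` {b \<in> Z. V #> b = V #> a}) = card ((\<lambda>v. U #> (v \<otimes> a)) ` V)"
      by (simp add: image_image)
    also have "\<dots> = card ((\<lambda>v. U #> v) ` V)"
    proof (rule card_image_eq_if_same_kernel(2))
      fix v w assume vw: "v \<in> V" "w \<in> V"
      then have "(v \<otimes> a) \<otimes> inv (w \<otimes> a) = v \<otimes> inv w"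
      proof -
        have "(v \<otimes> a) \<otimes> inv (w \<otimes> a) = v \<otimes> (a \<otimes> (inv a \<otimes> inv w))"
          using Vc[OF vw(1)] Vc[OF vw(2)] Zc[OF a] by (simp add: inv_mult_group m_assoc)
        also have "a \<otimes> (inv a \<otimes> inv w) = inv w"
          using Vc[OF vw(2)] Zc[OF a] by (simp add: m_assoc[symmetric])
        finally show ?thesis .
      qed
      then show "U #> (v \<otimes> a) = U #> (w \<otimes> a) \<longleftrightarrow> U #> v = U #> w"
        using rcos_eq_iff[OF U] Vc vw Zc[OF a] by simp
    qed
    finally show ?thesis by (simp add: rel_index_def rcosets_restrict)
  qed
  then have "card ((\<lambda>x. U #> x) ` Z) = card ((\<lambda>x. V #> x) ` Z) * rel_index G V U"
    using card_image_equal_fibres[OF finV, of "\<lambda>x. U #> x"] refine fin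
    unfolding rcosets_restrict by blast
  then show ?thesis by (simp add: rel_index_def rcosets_restrict)
qed

lemma finite_rcosets_supergroup:
  assumes "subgroup U G" "subgroup V G" "U \<subseteq> V" "Z \<subseteq> carrier G"
    and fin: "finite (rcosets\<^bsub>G\<lparr>carrier := Z\<rparr>\<^esub> U)"
  shows "finite (rcosets\<^bsub>G\<lparr>carrier := Z\<rparr>\<^esub> V)"
proof -
  have "(\<lambda>x. V #> x) ` Z \<subseteq> (\<lambda>C. V <#> C) ` (\<lambda>x. U #> x) ` Z"
  proof -
    have "V <#> (U #> x) = V #> x" if "x \<in> Z" for x
    proof -
      have x: "x \<in> carrier G" using that assms by blast
      have "V <#> U = V"
      proof
        show "V <#> U \<subseteq> V" using assms(2,3) by (auto simp: set_mult_def subgroup.m_closed)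
        show "V \<subseteq> V <#> U"
          using subgroup.one_closed[OF assms(1)] subgroup.mem_carrier[OF assms(2)]
          by (force simp: set_mult_def)
      qed
      then show ?thesis
        using x assms(1,2) by (metis setmult_rcos_assoc subgroup.subset)
    qed
    then show ?thesis by (auto simp: image_image)
  qed
  then show ?thesis using fin unfolding rcosets_restrict by (meson finite_imageI finite_subset)
qed

text \<open>A coset \<open>U z\<close> is determined by the coset \<open>V z\<close> and, once a representative \<open>r\<close> of \<open>V z\<close> is chosen, by
the coset of \<open>U\<close> in \<open>V\<close> that contains \<open>z r\<^sup>-\<^sup>1\<close>.\<close>

lemma finite_rcosets_trans:
  assumes U: "subgroup U G" and V: "subgroup V G" and Z: "subgroup Z G"
    and UV: "U \<subseteq> V" and VZ: "V \<subseteq> Z"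
    and fin: "finite (rcosets\<^bsub>G\<lparr>carrier := Z\<rparr>\<^esub> V)" "finite (rcosets\<^bsub>G\<lparr>carrier := V\<rparr>\<^esub> U)"
  shows "finite (rcosets\<^bsub>G\<lparr>carrier := Z\<rparr>\<^esub> U)"
proof -
  have Zc: "z \<in> carrier G" if "z \<in> Z" for z using Z that by (simp add: subgroup.mem_carrier)
  have Vc: "z \<in> carrier G" if "z \<in> V" for z using V that by (simp add: subgroup.mem_carrier)
  obtain r where r: "\<And>z. z \<in> Z \<Longrightarrow> r (V #> z) \<in> Z \<and> V #> r (V #> z) = V #> z"
  proof
    show "inv_into Z (\<lambda>z. V #> z) (V #> z) \<in> Z \<and> V #> inv_into Z (\<lambda>z. V #> z) (V #> z) = V #> z"
      if "z \<in> Z" for z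
      using that inv_into_into[of "V #> z" "\<lambda>z. V #> z" Z] f_inv_into_f[of "V #> z" "\<lambda>z. V #> z" Z]
      by simp
  qed
  have "(\<lambda>z. U #> z) ` Z \<subseteq> (\<lambda>(C, D). D #> r C) ` ((\<lambda>z. V #> z) ` Z \<times> (\<lambda>v. U #> v) ` V)"
  proof
    fix C assume "C \<in> (\<lambda>z. U #> z) ` Z"
    then obtain z where z: "z \<in> Z" "C = U #> z" by blast
    let ?r = "r (V #> z)"
    have rz: "?r \<in> carrier G" "z \<in> carrier G" and v: "z \<otimes> inv ?r \<in> V"
      using r[OF z(1)] rcos_eq_iff[OF V, of z ?r] Zc z(1) by auto
    have "U #> (z \<otimes> inv ?r) #> ?r = U #> z"
      using rz Vc[OF v] subgroup.subset[OF U] by (simp add: coset_mult_assoc m_assoc)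
    then show "C \<in> (\<lambda>(C, D). D #> r C) ` ((\<lambda>z. V #> z) ` Z \<times> (\<lambda>v. U #> v) ` V)"
      using z v by (intro image_eqI[of _ _ "(V #> z, U #> (z \<otimes> inv ?r))"]) auto
  qed
  then show ?thesis using fin unfolding rcosets_restrict by (meson finite_SigmaI finite_imageI finite_subset)
qed

lemma subgroup_eq_if_rel_index_1:
  assumes U: "subgroup U G" and V: "subgroup V G" and UV: "U \<subseteq> V" and one: "rel_index G V U = 1"
  shows "U = V"
proof -
  obtain c where c: "(\<lambda>x. U #> x) ` V = {c}"
    using one unfolding rel_index_def rcosets_restrict by (auto simp: card_1_singleton_iff)
  have "x \<in> U" if "x \<in> V" for x
  proof -
    have "U #> x = U #> \<one>"
      using c that subgroup.one_closed[OF V] by (metis imageI singletonD)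
    then show ?thesis
      using rcos_eq_iff[OF U] subgroup.mem_carrier[OF V that] by simp
  qed
  with UV show ?thesis by blast
qed

text \<open>The group \<open>G\<close> may be infinite; \<open>S\<close> is the preimage of a Sylow subgroup of the finite group \<open>G Mod W\<close>.\<close>

lemma sylow_above_normal:
  assumes p: "Factorial_Ring.prime p" and W: "W \<lhd> G" and fin: "finite (rcosets W)"
  obtains S k where "subgroup S G" "W \<subseteq> S" "\<not> p dvd rel_index G (carrier G) S"
    "rel_index G S W = p ^ k"
proof -
  interpret W: normal W G by (rule W)
  let ?Q = "G Mod W"
  have Q: "group ?Q" by (rule W.factorgroup_is_group)
  have Wsub: "subgroup W G" by (rule W.is_subgroup)
  have finQ: "finite (carrier ?Q)" using fin by (simp add: FactGroup_def)
  have carQ: "carrier ?Q = (\<lambda>x. W #> x) ` carrier G" by (auto simp: FactGroup_def RCOSETS_def)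
  have "Coset.order ?Q \<noteq> 0"
    using finQ Q by (simp add: Coset.order_def carQ) blast
  then obtain m where m: "Coset.order ?Q = p ^ multiplicity p (Coset.order ?Q) * m" "\<not> p dvd m"
    using multiplicity_decompose'[of "Coset.order ?Q" p] p by (metis not_prime_unit)
  define k where "k = multiplicity p (Coset.order ?Q)"
  obtain H where H: "subgroup H ?Q" "card H = p ^ k"
    using sylow_thm[OF p Q _ finQ, of k m] m unfolding k_def by blast
  define S where "S = {x \<in> carrier G. W #> x \<in> H}"
  have hom: "(\<lambda>x. W #> x) \<in> hom G ?Q" by (rule W.r_coset_hom_Mod)
  interpret h: group_hom G ?Q "\<lambda>x. W #> x"
    by (intro group_hom.intro group_hom_axioms.intro hom Q is_group)
  have S: "subgroup S G"
  proof (rule subgroupI)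
    show "S \<noteq> {}"
      using subgroup.one_closed[OF H(1)] Wsub unfolding S_def
      by (metis (mono_tags, lifting) empty_Collect_eq h.hom_one one_closed)
    show "inv a \<in> S" if "a \<in> S" for a
      using that subgroup.m_inv_closed[OF H(1)] by (auto simp: S_def)
    show "a \<otimes> b \<in> S" if "a \<in> S" "b \<in> S" for a b
      using that subgroup.m_closed[OF H(1)] by (auto simp: S_def)
  qed (auto simp: S_def)
  have WS: "W \<subseteq> S"
  proof
    fix w assume w: "w \<in> W"
    then have "W #> w = W" by (rule W.rcos_const[OF is_group])
    then show "w \<in> S"
      using w W.mem_carrier subgroup.one_closed[OF H(1)] by (simp add: S_def FactGroup_def)
  qed
  have "(\<lambda>x. W #> x) ` S = H"
    using subgroup.subset[OF H(1)] by (auto simp: S_def carQ)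
  then have SW: "rel_index G S W = p ^ k" by (simp add: rel_index_def rcosets_restrict H)
  have "p ^ k * m = rel_index G (carrier G) S * p ^ k"
    using rel_index_mult[OF Wsub S subgroup_self WS subgroup.subset[OF S]] fin m[folded k_def] SW prime_gt_0_nat[OF p]
    unfolding k_def[symmetric] by (simp add: rel_index_def Coset.order_def FactGroup_def)
  then have "rel_index G (carrier G) S = m"
    using prime_gt_0_nat[OF p] by simp
  with m(2) S WS SW show ?thesis using that by blast
qed

end

section \<open>Groups of permutations\<close>

definition fixator :: "('a \<Rightarrow> 'a) set \<Rightarrow> 'a set \<Rightarrow> ('a \<Rightarrow> 'a) set"
  where "fixator V Y = {\<sigma> \<in> V. \<forall>x\<in>Y. \<sigma> x = x}"

definition orbit_of :: "('a \<Rightarrow> 'a) set \<Rightarrow> 'a \<Rightarrow> 'a set"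
  where "orbit_of V x = (\<lambda>\<sigma>. \<sigma> x) ` V"

definition invariant :: "('a \<Rightarrow> 'a) set \<Rightarrow> 'a set \<Rightarrow> bool"
  where "invariant V Y \<longleftrightarrow> (\<forall>\<sigma>\<in>V. \<forall>x\<in>Y. \<sigma> x \<in> Y)"

text \<open>The order of the group of permutations that \<open>V\<close> induces on \<open>Y\<close>, when \<open>Y\<close> is invariant. Indices of
open subgroups are computed in these finite groups.\<close>

definition induced_order :: "('a \<Rightarrow> 'a) set \<Rightarrow> 'a set \<Rightarrow> nat"
  where "induced_order V Y = card ((\<lambda>\<sigma>. restrict \<sigma> Y) ` V)"

text \<open>For an invariant set \<open>Y\<close> this is the product of \<open>P\<close> with the pointwise stabilizer of \<open>Y\<close> in \<open>V\<close>,
that is, the preimage in \<open>V\<close> of what \<open>P\<close> induces on \<open>Y\<close>.\<close>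

definition saturation :: "('a \<Rightarrow> 'a) set \<Rightarrow> ('a \<Rightarrow> 'a) set \<Rightarrow> 'a set \<Rightarrow> ('a \<Rightarrow> 'a) set"
  where "saturation V P Y = {\<sigma> \<in> V. \<exists>\<pi>\<in>P. \<forall>x\<in>Y. \<sigma> x = \<pi> x}"

lemma restrict_eq_iff: "restrict f Y = restrict g Y \<longleftrightarrow> (\<forall>x\<in>Y. f x = g x)"
  by (auto simp: restrict_def fun_eq_iff)

text \<open>The group acts through its own elements, as an absolute Galois group does.\<close>

locale perm_group = group G for G :: "('a \<Rightarrow> 'a) monoid" (structure) +
  assumes mult_eq: "\<sigma> \<in> carrier G \<Longrightarrow> \<tau> \<in> carrier G \<Longrightarrow> \<sigma> \<otimes> \<tau> = \<sigma> \<circ> \<tau>"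
    and one_eq: "\<one> = id"
begin

lemma inv_apply [simp]: "\<sigma> \<in> carrier G \<Longrightarrow> (inv \<sigma>) (\<sigma> x) = x"
  and apply_inv [simp]: "\<sigma> \<in> carrier G \<Longrightarrow> \<sigma> ((inv \<sigma>) x) = x"
  using mult_eq[of "inv \<sigma>" \<sigma>] mult_eq[of \<sigma> "inv \<sigma>"] one_eq
  by (auto simp: fun_eq_iff)

lemma apply_eq_iff [simp]: "\<sigma> \<in> carrier G \<Longrightarrow> \<sigma> x = \<sigma> y \<longleftrightarrow> x = y"
  by (metis inv_apply)

lemma inv_apply_eq_iff: "\<sigma> \<in> carrier G \<Longrightarrow> (inv \<sigma>) x = y \<longleftrightarrow> x = \<sigma> y"
  by (metis inv_apply apply_inv)

lemma subgroupI_perm: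
  assumes "V \<subseteq> carrier G" "id \<in> V" "\<And>\<sigma> \<tau>. \<sigma> \<in> V \<Longrightarrow> \<tau> \<in> V \<Longrightarrow> \<sigma> \<circ> \<tau> \<in> V"
    "\<And>\<sigma>. \<sigma> \<in> V \<Longrightarrow> inv \<sigma> \<in> V"
  shows "subgroup V G"
proof (rule subgroupI)
  show "\<sigma> \<otimes> \<tau> \<in> V" if "\<sigma> \<in> V" "\<tau> \<in> V" for \<sigma> \<tau>
    using assms(3)[OF that] mult_eq[of \<sigma> \<tau>] that subsetD[OF assms(1)] by simp
  show "V \<subseteq> carrier G" "V \<noteq> {}" using assms(1,2) by auto
  show "inv \<sigma> \<in> V" if "\<sigma> \<in> V" for \<sigma> using assms(4)[OF that] .
qed

lemma subgroup_comp: "subgroup V G \<Longrightarrow> \<sigma> \<in> V \<Longrightarrow> \<tau> \<in> V \<Longrightarrow> \<sigma> \<circ> \<tau> \<in> V"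
  using mult_eq[of \<sigma> \<tau>] subgroup.m_closed[of V G \<sigma> \<tau>] subgroup.mem_carrier[of V G] by simp

lemma subgroup_id: "subgroup V G \<Longrightarrow> id \<in> V"
  using subgroup.one_closed[of V G] one_eq by simp

lemma fixator_subgroup: "subgroup V G \<Longrightarrow> subgroup (fixator V Y) G"
  by (rule subgroupI_perm)
    (auto simp: fixator_def subgroup_id subgroup_comp subgroup.m_inv_closed
      subgroup.mem_carrier inv_apply_eq_iff)

lemma invariant_image_eq:
  assumes "subgroup V G" "invariant V Y" "\<sigma> \<in> V"
  shows "\<sigma> ` Y = Y"
proof -
  have "inv \<sigma> \<in> V" "\<sigma> \<in> carrier G"
    using assms by (auto intro: subgroup.m_inv_closed subgroup.mem_carrier)
  then have "x \<in> \<sigma> ` Y" if "x \<in> Y" for x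
    using assms(2) that by (intro image_eqI[of _ _ "(inv \<sigma>) x"]) (auto simp: invariant_def)
  then show ?thesis using assms(2,3) by (auto simp: invariant_def)
qed

lemma fixator_normal:
  assumes V: "subgroup V G" and Y: "invariant V Y"
  shows "fixator V Y \<lhd> G\<lparr>carrier := V\<rparr>"
proof -
  interpret V: group "G\<lparr>carrier := V\<rparr>" by (rule subgroup_imp_group[OF V])
  have inv: "inv\<^bsub>G\<lparr>carrier := V\<rparr>\<^esub> \<sigma> = inv \<sigma>" if "\<sigma> \<in> V" for \<sigma>
    using m_inv_consistent[OF V that] .
  show ?thesis unfolding V.normal_inv_iff
  proof (intro conjI ballI)
    show "subgroup (fixator V Y) (G\<lparr>carrier := V\<rparr>)"
      by (rule subgroup_incl[OF fixator_subgroup[OF V] V]) (auto simp: fixator_def)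
    fix \<sigma> \<tau> assume "\<sigma> \<in> carrier (G\<lparr>carrier := V\<rparr>)" and t: "\<tau> \<in> fixator V Y"
    then have s: "\<sigma> \<in> V" and si: "inv \<sigma> \<in> V" and tV: "\<tau> \<in> V"
      using V by (auto simp: fixator_def intro: subgroup.m_inv_closed)
    have c: "\<sigma> \<in> carrier G" "\<tau> \<in> carrier G" using s tV V by (auto intro: subgroup.mem_carrier)
    have "\<sigma> \<otimes> \<tau> \<otimes> inv \<sigma> = \<sigma> \<circ> \<tau> \<circ> inv \<sigma>" using c mult_eq[of \<sigma> \<tau>] mult_eq[of "\<sigma> \<otimes> \<tau>" "inv \<sigma>"] m_closed[OF c]
      by simp
    moreover have "\<sigma> \<otimes> \<tau> \<otimes> inv \<sigma> \<in> V" using V s si tV by (auto intro: subgroup.m_closed)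
    moreover have "(inv \<sigma>) x \<in> Y" if "x \<in> Y" for x using Y si that by (auto simp: invariant_def)
    ultimately show "\<sigma> \<otimes>\<^bsub>G\<lparr>carrier := V\<rparr>\<^esub> \<tau> \<otimes>\<^bsub>G\<lparr>carrier := V\<rparr>\<^esub> inv\<^bsub>G\<lparr>carrier := V\<rparr>\<^esub> \<sigma> \<in> fixator V Y"
      using t c by (auto simp: inv[OF s] fixator_def)
  qed
qed

text \<open>Right cosets are the classes of elements whose inverses agree on \<open>Y\<close>. As inversion permutes a
subgroup, there are as many of them as restrictions of elements to \<open>Y\<close>.\<close>

lemma rcos_fixator_eq_iff:
  assumes V: "subgroup V G" and s: "\<sigma> \<in> V" and t: "\<tau> \<in> V"
  shows "fixator V Y #> \<sigma> = fixator V Y #> \<tau> \<longleftrightarrow> (\<forall>x\<in>Y. (inv \<sigma>) x = (inv \<tau>) x)"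
proof -
  have c: "\<sigma> \<in> carrier G" "\<tau> \<in> carrier G" "inv \<tau> \<in> V"
    using s t V by (auto intro: subgroup.mem_carrier subgroup.m_inv_closed)
  then have "\<sigma> \<otimes> inv \<tau> \<in> fixator V Y \<longleftrightarrow> (\<forall>x\<in>Y. \<sigma> ((inv \<tau>) x) = x)"
    using subgroup.m_closed[OF V s c(3)] by (auto simp: fixator_def mult_eq)
  also have "\<dots> \<longleftrightarrow> (\<forall>x\<in>Y. (inv \<sigma>) x = (inv \<tau>) x)"
    using c by (metis inv_apply_eq_iff)
  finally show ?thesis using rcos_eq_iff[OF fixator_subgroup[OF V]] c by simp
qed

lemma inv_image_subgroup: "subgroup V G \<Longrightarrow> (\<lambda>\<sigma>. inv \<sigma>) ` V = V"
proof (intro equalityI subsetI)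
  fix \<sigma> assume V: "subgroup V G" and s: "\<sigma> \<in> V"
  then have "inv \<sigma> \<in> V" "inv (inv \<sigma>) = \<sigma>"
    by (auto intro: subgroup.m_inv_closed dest: subgroup.mem_carrier)
  then show "\<sigma> \<in> (\<lambda>\<sigma>. inv \<sigma>) ` V" by (metis image_eqI)
qed (auto intro: subgroup.m_inv_closed)

text \<open>For a singleton \<open>Y\<close> this is the orbit-stabilizer theorem.\<close>

lemma rel_index_fixator:
  assumes V: "subgroup V G"
  shows "rel_index G V (fixator V Y) = induced_order V Y"
    and "finite ((\<lambda>\<sigma>. restrict \<sigma> Y) ` V) \<Longrightarrow> finite (rcosets\<^bsub>G\<lparr>carrier := V\<rparr>\<^esub> (fixator V Y))"
proof -
  have *: "(\<lambda>\<sigma>. restrict \<sigma> Y) ` V = (\<lambda>\<sigma>. restrict (inv \<sigma>) Y) ` V"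
    by (subst (1) inv_image_subgroup[OF V, symmetric]) (simp only: image_image)
  show "rel_index G V (fixator V Y) = induced_order V Y"
    unfolding rel_index_def rcosets_restrict induced_order_def *
    by (rule card_image_eq_if_same_kernel(2)) (simp add: rcos_fixator_eq_iff[OF V] restrict_eq_iff)
  have "finite ((\<lambda>\<sigma>. fixator V Y #> \<sigma>) ` V) \<longleftrightarrow> finite ((\<lambda>\<sigma>. restrict (inv \<sigma>) Y) ` V)"
    by (rule card_image_eq_if_same_kernel(1)) (simp add: rcos_fixator_eq_iff[OF V] restrict_eq_iff)
  then show "finite (rcosets\<^bsub>G\<lparr>carrier := V\<rparr>\<^esub> (fixator V Y))"
    if "finite ((\<lambda>\<sigma>. restrict \<sigma> Y) ` V)"
    unfolding rcosets_restrict using that * by simp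
qed

lemma induced_order_singleton: "induced_order V {x} = card (orbit_of V x)"
  unfolding induced_order_def orbit_of_def
  by (rule card_image_eq_if_same_kernel(2)) (simp add: restrict_eq_iff)

lemma orbit_stabilizer:
  "subgroup V G \<Longrightarrow> rel_index G V (fixator V {x}) = card (orbit_of V x)"
  by (simp add: rel_index_fixator induced_order_singleton)

lemma orbit_invariant:
  assumes V: "subgroup V G" shows "invariant V (orbit_of V x)"
proof -
  have "\<sigma> (\<tau> x) \<in> (\<lambda>\<sigma>. \<sigma> x) ` V" if "\<sigma> \<in> V" "\<tau> \<in> V" for \<sigma> \<tau>
    using subgroup_comp[OF V that] by (metis comp_apply image_eqI)
  then show ?thesis by (auto simp: invariant_def orbit_of_def)
qed

lemma orbit_self: "subgroup V G \<Longrightarrow> x \<in> orbit_of V x"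
  using subgroup_id[of V] unfolding orbit_of_def by (metis id_apply image_eqI)

lemma orbit_eq:
  assumes V: "subgroup V G" and "y \<in> orbit_of V x" shows "orbit_of V y = orbit_of V x"
proof -
  obtain \<sigma> where s: "\<sigma> \<in> V" "y = \<sigma> x" using assms by (auto simp: orbit_of_def)
  then have c: "\<sigma> \<in> carrier G" "inv \<sigma> \<in> V"
    using V by (auto intro: subgroup.mem_carrier subgroup.m_inv_closed)
  have "\<tau> y \<in> orbit_of V x" if "\<tau> \<in> V" for \<tau>
    using subgroup_comp[OF V that s(1)] unfolding s(2) orbit_of_def
    by (intro image_eqI[of _ _ "\<tau> \<circ> \<sigma>"]) auto
  moreover have "\<tau> x \<in> orbit_of V y" if "\<tau> \<in> V" for \<tau>
    using subgroup_comp[OF V that c(2)] s c unfolding orbit_of_def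
    by (intro image_eqI[of _ _ "\<tau> \<circ> inv \<sigma>"]) auto
  ultimately show ?thesis by (auto simp: orbit_of_def)
qed

lemma induced_order_mult:
  assumes U: "subgroup U G" and V: "subgroup V G" and "U \<subseteq> V" and fx: "fixator V Y \<subseteq> U"
    and fin: "finite ((\<lambda>\<sigma>. restrict \<sigma> Y) ` V)"
  shows "induced_order V Y = rel_index G V U * induced_order U Y"
proof -
  have "fixator U Y = fixator V Y" using assms by (auto simp: fixator_def)
  then show ?thesis
    using rel_index_mult[OF fixator_subgroup[OF V] U V fx \<open>U \<subseteq> V\<close> rel_index_fixator(2)[OF V fin]]
    by (metis rel_index_fixator(1) U V)
qed

lemma saturation_subgroup:
  assumes V: "subgroup V G" and P: "subgroup P G" and PV: "P \<subseteq> V" and Y: "invariant V Y"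
  shows "subgroup (saturation V P Y) G"
proof (rule subgroupI_perm)
  show "saturation V P Y \<subseteq> carrier G" using subgroup.subset[OF V] by (auto simp: saturation_def)
  show "id \<in> saturation V P Y" using subgroup_id[OF V] subgroup_id[OF P]
    by (auto simp: saturation_def intro!: bexI[of _ id])
next
  fix \<sigma> \<tau> assume "\<sigma> \<in> saturation V P Y" "\<tau> \<in> saturation V P Y"
  then obtain \<pi> \<rho> where *: "\<sigma> \<in> V" "\<tau> \<in> V" "\<pi> \<in> P" "\<rho> \<in> P"
      "\<And>x. x \<in> Y \<Longrightarrow> \<sigma> x = \<pi> x" "\<And>x. x \<in> Y \<Longrightarrow> \<tau> x = \<rho> x"
    unfolding saturation_def by blast
  moreover have "\<rho> x \<in> Y" if "x \<in> Y" for x using Y * PV that by (auto simp: invariant_def)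
  ultimately show "\<sigma> \<circ> \<tau> \<in> saturation V P Y"
    using subgroup_comp[OF V, of \<sigma> \<tau>] subgroup_comp[OF P, of \<pi> \<rho>] unfolding saturation_def
    by (auto intro!: bexI[of _ "\<pi> \<circ> \<rho>"])
next
  fix \<sigma> assume "\<sigma> \<in> saturation V P Y"
  then obtain \<pi> where *: "\<sigma> \<in> V" "\<pi> \<in> P" "\<And>x. x \<in> Y \<Longrightarrow> \<sigma> x = \<pi> x"
    unfolding saturation_def by blast
  have i: "inv \<sigma> \<in> V" "inv \<pi> \<in> P" "\<sigma> \<in> carrier G" "\<pi> \<in> carrier G"
    using V P * by (auto intro: subgroup.m_inv_closed subgroup.mem_carrier)
  have "(inv \<sigma>) x = (inv \<pi>) x" if "x \<in> Y" for x
  proof -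
    have "(inv \<pi>) x \<in> Y" using Y i PV that by (auto simp: invariant_def)
    then show ?thesis using * i by (simp add: inv_apply_eq_iff)
  qed
  with i show "inv \<sigma> \<in> saturation V P Y" by (auto simp: saturation_def)
qed

lemma subset_saturation: "P \<subseteq> V \<Longrightarrow> P \<subseteq> saturation V P Y"
  by (auto simp: saturation_def)

lemma fixator_subset_saturation: "subgroup P G \<Longrightarrow> fixator V Y \<subseteq> saturation V P Y"
  using subgroup_id[of P] by (auto simp: saturation_def fixator_def intro!: bexI[of _ id])

lemma induced_order_saturation:
  assumes "P \<subseteq> V" shows "induced_order (saturation V P Y) Y = induced_order P Y"
proof -
  have "(\<lambda>\<sigma>. restrict \<sigma> Y) ` saturation V P Y = (\<lambda>\<sigma>. restrict \<sigma> Y) ` P"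
    using assms unfolding saturation_def by (force simp: image_iff restrict_eq_iff)
  then show ?thesis by (simp add: induced_order_def)
qed

end

section \<open>Sylow subgroups of profinite permutation groups\<close>

text \<open>Closed groups of permutations of a countable set with finite orbits, in the topology of pointwise
convergence. All of them are profinite, with the pointwise stabilizers of finite sets as a basis of
neighbourhoods of the identity.\<close>

locale profinite_perm_group = perm_group +
  fixes T :: "('a \<Rightarrow> 'a) topology"
  assumes finite_orbit: "finite (orbit_of (carrier G) x)"
    and closed_pointwise:
      "(\<And>Y. finite Y \<Longrightarrow> \<exists>\<tau>\<in>carrier G. \<forall>x\<in>Y. \<tau> x = \<sigma> x) \<Longrightarrow> \<sigma> \<in> carrier G"
    and countable_points: "countable (UNIV :: 'a set)"
    and openin_iff: "openin T V \<longleftrightarrow> V \<subseteq> carrier G \<and>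
      (\<forall>\<sigma>\<in>V. \<exists>Y. finite Y \<and> {\<tau> \<in> carrier G. \<forall>x\<in>Y. \<tau> x = \<sigma> x} \<subseteq> V)"
begin

abbreviation "A \<equiv> carrier G"

lemma topspace_eq: "topspace T = A"
proof
  show "topspace T \<subseteq> A" using openin_topspace[of T] openin_iff by blast
  have "openin T A" unfolding openin_iff by (auto intro: exI[of _ "{}"])
  then show "A \<subseteq> topspace T" by (rule openin_subset)
qed

lemma finite_restrictions:
  assumes "finite Y" "V \<subseteq> A" shows "finite ((\<lambda>\<sigma>. restrict \<sigma> Y) ` V)"
proof (rule finite_subset)
  show "(\<lambda>\<sigma>. restrict \<sigma> Y) ` V \<subseteq> (\<Pi>\<^sub>E x\<in>Y. orbit_of A x)"
    using assms(2) by (auto simp: orbit_of_def)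
  show "finite (\<Pi>\<^sub>E x\<in>Y. orbit_of A x)" by (intro finite_PiE assms finite_orbit)
qed

lemma openin_fixator: assumes "finite Y" shows "openin T (fixator A Y)"
  unfolding openin_iff
proof (intro conjI ballI)
  fix \<sigma> assume "\<sigma> \<in> fixator A Y"
  then show "\<exists>Z. finite Z \<and> {\<tau> \<in> A. \<forall>x\<in>Z. \<tau> x = \<sigma> x} \<subseteq> fixator A Y"
    using assms by (intro exI[of _ Y]) (auto simp: fixator_def)
qed (auto simp: fixator_def)

lemma openin_if_fixator_subset:
  assumes V: "subgroup V G" and Y: "finite Y" "fixator A Y \<subseteq> V"
  shows "openin T V"
  unfolding openin_iff
proof (intro conjI ballI)
  show "V \<subseteq> A" by (rule subgroup.subset[OF V])
  fix \<sigma> assume s: "\<sigma> \<in> V"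
  then have si: "inv \<sigma> \<in> V" "inv \<sigma> \<in> A" "\<sigma> \<in> A"
    using V by (auto intro: subgroup.m_inv_closed subgroup.mem_carrier)
  have "\<tau> \<in> V" if t: "\<tau> \<in> A" "\<forall>x\<in>Y. \<tau> x = \<sigma> x" for \<tau>
  proof -
    have "inv \<sigma> \<circ> \<tau> \<in> A" by (rule subgroup_comp[OF subgroup_self si(2) t(1)])
    then have "inv \<sigma> \<circ> \<tau> \<in> fixator A Y" using t si by (auto simp: fixator_def)
    then have "\<sigma> \<circ> (inv \<sigma> \<circ> \<tau>) \<in> V" using Y subgroup_comp[OF V s] by blast
    moreover have "\<sigma> \<circ> (inv \<sigma> \<circ> \<tau>) = \<tau>" using si by (auto simp: fun_eq_iff)
    ultimately show ?thesis by simp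
  qed
  then show "\<exists>Z. finite Z \<and> {\<tau> \<in> A. \<forall>x\<in>Z. \<tau> x = \<sigma> x} \<subseteq> V"
    using Y by (intro exI[of _ Y]) auto
qed

lemma ex_fixator_subset:
  assumes "openin T V" "id \<in> V"
  obtains Y where "finite Y" "fixator A Y \<subseteq> V"
proof -
  obtain Y where "finite Y" "{\<tau> \<in> A. \<forall>x\<in>Y. \<tau> x = id x} \<subseteq> V"
    using assms unfolding openin_iff by blast
  then show ?thesis using that[of Y] by (auto simp: fixator_def)
qed

subsection \<open>Existence\<close>

text \<open>An exhaustion of the set by finite invariant subsets; the group is the inverse limit of the finite
groups that it induces on them.\<close>

definition stage :: "nat \<Rightarrow> 'a set"
  where "stage n = (\<Union>i<n. orbit_of A (from_nat_into UNIV i))"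

lemma finite_stage: "finite (stage n)"
  by (simp add: stage_def finite_orbit)

lemma invariant_stage: "invariant A (stage n)"
  using orbit_invariant[OF subgroup_self] unfolding stage_def invariant_def by blast

lemma stage_mono: "m \<le> n \<Longrightarrow> stage m \<subseteq> stage n"
  unfolding stage_def by (intro UN_mono) auto

lemma mem_stage: obtains n where "x \<in> stage n"
proof -
  obtain i where "from_nat_into UNIV i = x"
    using from_nat_into_surj[OF countable_points, of x] by auto
  then have "x \<in> stage (Suc i)" using orbit_self[OF subgroup_self, of x] by (auto simp: stage_def)
  then show ?thesis using that by blast
qed

lemma finite_subset_stage:
  assumes "finite Y" obtains n where "Y \<subseteq> stage n"
proof -
  have "\<exists>n. Y \<subseteq> stage n" using assms
  proof (induction Y)
    case (insert x Y)
    then obtain n where "Y \<subseteq> stage n" by blast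
    moreover obtain m where "x \<in> stage m" by (rule mem_stage)
    ultimately have "insert x Y \<subseteq> stage (max m n)"
      using stage_mono[of m "max m n"] stage_mono[of n "max m n"] by auto
    then show ?case ..
  qed simp
  then show ?thesis using that by blast
qed

text \<open>Passing to a Sylow subgroup inside \<open>S\<close>, rather than inside the whole group, is what makes the
successive choices compatible.\<close>

lemma sylow_chain_step:
  assumes p: "Factorial_Ring.prime p" and S: "subgroup S G" and W: "fixator A Y \<subseteq> S"
    and Y: "finite Y" "invariant A Y"
  obtains S' k where "subgroup S' G" "fixator A Y \<subseteq> S'" "S' \<subseteq> S" "\<not> p dvd rel_index G S S'"
    "rel_index G S' (fixator A Y) = p ^ k"
proof -
  interpret S: group "G\<lparr>carrier := S\<rparr>" by (rule subgroup_imp_group[OF S])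
  have SA: "S \<subseteq> A" by (rule subgroup.subset[OF S])
  have eq: "fixator S Y = fixator A Y" using W SA by (auto simp: fixator_def)
  have "invariant S Y" using Y SA by (auto simp: invariant_def)
  then have "fixator A Y \<lhd> G\<lparr>carrier := S\<rparr>" using fixator_normal[OF S] eq by metis
  moreover have "finite (rcosets\<^bsub>G\<lparr>carrier := S\<rparr>\<^esub> fixator A Y)"
    using rel_index_fixator(2)[OF S finite_restrictions[OF Y(1) SA]] eq by simp
  ultimately obtain S' k where S': "subgroup S' (G\<lparr>carrier := S\<rparr>)" "fixator A Y \<subseteq> S'"
      "\<not> p dvd rel_index (G\<lparr>carrier := S\<rparr>) (carrier (G\<lparr>carrier := S\<rparr>)) S'"
      "rel_index (G\<lparr>carrier := S\<rparr>) S' (fixator A Y) = p ^ k"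
    using S.sylow_above_normal[OF p] by metis
  have "subgroup S' G" by (rule incl_subgroup[OF S S'(1)])
  moreover have "S' \<subseteq> S" using subgroup.subset[OF S'(1)] by simp
  ultimately show ?thesis using that[of S' k] S'(2-) by (simp add: rel_index_def)
qed

text \<open>The \<open>n\<close>-th term is the preimage of a Sylow subgroup of the finite group induced on the \<open>n\<close>-th
stage.\<close>

lemma sylow_chain:
  assumes p: "Factorial_Ring.prime p"
  obtains P k where "\<And>n. subgroup (P n) G" "\<And>n. fixator A (stage n) \<subseteq> P n"
    "\<And>n. \<not> p dvd rel_index G A (P n)" "\<And>n. rel_index G (P n) (fixator A (stage n)) = p ^ k n"
    "\<And>n. P (Suc n) \<subseteq> P n" "\<And>n. \<not> p dvd rel_index G (P n) (P (Suc n))"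
proof -
  define good where "good n S \<longleftrightarrow> subgroup S G \<and> fixator A (stage n) \<subseteq> S \<and>
    \<not> p dvd rel_index G A S \<and> (\<exists>k. rel_index G S (fixator A (stage n)) = p ^ k)" for n S
  have p1: "\<not> p dvd 1" using p by (metis not_prime_unit)
  have "\<exists>P. \<forall>n. good n (P n) \<and> P (Suc n) \<subseteq> P n \<and> \<not> p dvd rel_index G (P n) (P (Suc n))"
  proof (rule dependent_nat_choice)
    have "rel_index G A A = 1"
    proof -
      have "fixator A {} = A" by (auto simp: fixator_def)
      moreover have "(\<lambda>\<sigma>. restrict \<sigma> {}) ` A = {\<lambda>x. undefined}" by (auto simp: restrict_def)
      ultimately show ?thesis
        using rel_index_fixator(1)[OF subgroup_self, of "{}"] by (simp add: induced_order_def)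
    qed
    then show "\<exists>S. good 0 S"
      using p1 by (intro exI[of _ A] ) (auto simp: good_def subgroup_self stage_def fixator_def intro!: exI[of _ 0])
  next
    fix S n assume S: "good n S"
    have sub: "fixator A (stage (Suc n)) \<subseteq> fixator A (stage n)"
      using stage_mono[of n "Suc n"] by (auto simp: fixator_def)
    then have WS: "fixator A (stage (Suc n)) \<subseteq> S" and Sg: "subgroup S G" using S by (auto simp: good_def)
    obtain S' k where S': "subgroup S' G" "fixator A (stage (Suc n)) \<subseteq> S'" "S' \<subseteq> S"
        "\<not> p dvd rel_index G S S'" "rel_index G S' (fixator A (stage (Suc n))) = p ^ k"
      using sylow_chain_step[OF p Sg WS finite_stage invariant_stage] by metis
    have "finite (rcosets fixator A (stage (Suc n)))"
      using rel_index_fixator(2)[OF subgroup_self finite_restrictions[OF finite_stage order.refl]] by simp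
    then have "finite (rcosets S')"
      using finite_rcosets_supergroup[OF fixator_subgroup[OF subgroup_self] S'(1,2) order.refl] by simp
    then have "rel_index G A S' = rel_index G A S * rel_index G S S'"
      using rel_index_mult[OF S'(1) Sg subgroup_self S'(3) subgroup.subset[OF Sg]] by simp
    then have "\<not> p dvd rel_index G A S'"
      using S S'(4) p by (simp add: good_def prime_dvd_mult_iff)
    then show "\<exists>S'. good (Suc n) S' \<and> S' \<subseteq> S \<and> \<not> p dvd rel_index G S S'"
      using S' by (auto simp: good_def)
  qed
  then obtain P where "\<And>n. good n (P n)" "\<And>n. P (Suc n) \<subseteq> P n" "\<And>n. \<not> p dvd rel_index G (P n) (P (Suc n))"
    by blast
  moreover from this(1) have "\<exists>k. \<forall>n. rel_index G (P n) (fixator A (stage n)) = p ^ k n"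
    unfolding good_def by metis
  ultimately show ?thesis using that unfolding good_def by blast
qed

text \<open>This is where the group has to be closed: the terms of the sequence stabilize at every point, so a
limit exists as a function, and it is approximated by group elements on every finite set.\<close>

lemma coherent_limit:
  assumes f: "\<And>j. f j \<in> A" and coh: "\<And>j x. x \<in> stage (n + j) \<Longrightarrow> f (Suc j) x = f j x"
  obtains \<pi> where "\<pi> \<in> A" "\<And>j x. x \<in> stage (n + j) \<Longrightarrow> \<pi> x = f j x"
proof -
  have coh': "f (j + i) x = f j x" if "x \<in> stage (n + j)" for i j x
  proof (induction i)
    case (Suc i)
    have "x \<in> stage (n + (j + i))" using stage_mono[of "n + j" "n + (j + i)"] that by auto
    then show ?case using coh[of x "j + i"] Suc by simp
  qed simp
  have ex: "\<exists>j. x \<in> stage (n + j)" for x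
    using mem_stage[of x] stage_mono by (metis le_add2 subsetD)
  define \<pi> where "\<pi> x = f (LEAST j. x \<in> stage (n + j)) x" for x
  have eq: "\<pi> x = f j x" if "x \<in> stage (n + j)" for j x
  proof -
    let ?l = "LEAST j. x \<in> stage (n + j)"
    have "x \<in> stage (n + ?l)" by (rule LeastI[of "\<lambda>j. x \<in> stage (n + j)", OF that])
    moreover have "?l \<le> j" by (rule Least_le[of "\<lambda>j. x \<in> stage (n + j)", OF that])
    ultimately show ?thesis using coh'[of x ?l "j - ?l"] by (simp add: \<pi>_def)
  qed
  have "\<pi> \<in> A"
  proof (rule closed_pointwise)
    fix Y :: "'a set" assume "finite Y"
    then obtain m where m: "Y \<subseteq> stage m" by (rule finite_subset_stage)
    have "Y \<subseteq> stage (n + m)" using m stage_mono[of m "n + m"] by auto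
    then show "\<exists>\<tau>\<in>A. \<forall>x\<in>Y. \<tau> x = \<pi> x" using f eq by (intro bexI[of _ "f m"]) auto
  qed
  then show ?thesis using eq that by blast
qed

text \<open>The Sylow subgroup is the intersection \<open>Q\<close> of the chain. The point is that \<open>Q\<close> induces on each stage
the same group as the term \<open>P n\<close> of the chain. For this, an element of \<open>P n\<close> is changed step by
step, without changing it on the stages treated before, into elements of the later terms, and the
limit lies in \<open>Q\<close>. A single step is possible because \<open>P (Suc n)\<close> and \<open>P n\<close> induce the same group on
the \<open>n\<close>-th stage: the index of the first of these induced groups in the second is both a power of \<open>p\<close> and prime to \<open>p\<close>.\<close>

theorem pro_sylow_exists:
  assumes p: "Factorial_Ring.prime p"
  obtains P where "pro_sylow p G T P"
proof -
  obtain P k where P: "\<And>n. subgroup (P n) G" and WP: "\<And>n. fixator A (stage n) \<subseteq> P n"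
    and np: "\<And>n. \<not> p dvd rel_index G A (P n)"
    and pk: "\<And>n. rel_index G (P n) (fixator A (stage n)) = p ^ k n"
    and dec: "\<And>n. P (Suc n) \<subseteq> P n" and npS: "\<And>n. \<not> p dvd rel_index G (P n) (P (Suc n))"
    using sylow_chain[OF p] by metis
  have PA: "P n \<subseteq> A" for n by (rule subgroup.subset[OF P])
  have mono: "P n \<subseteq> P m" if "m \<le> n" for m n
    using lift_Suc_antimono_le[of P, OF dec that] .
  have fixP: "fixator (P n) (stage n) = fixator A (stage n)" for n
    using WP[of n] PA[of n] by (auto simp: fixator_def)
  have invP: "invariant (P n) (stage m)" for m n
    using invariant_stage[of m] PA[of n] by (auto simp: invariant_def)
  have finP: "finite (rcosets\<^bsub>G\<lparr>carrier := P n\<rparr>\<^esub> fixator A (stage m))" if "n \<le> m" for n m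
  proof -
    have "fixator (P n) (stage m) = fixator A (stage m)"
      using WP[of m] mono[OF that] PA[of n] by (auto simp: fixator_def)
    then show ?thesis
      using rel_index_fixator(2)[OF P finite_restrictions[OF finite_stage PA]] by metis
  qed
  \<comment> \<open>\<open>P (Suc n)\<close> and \<open>P n\<close> induce the same group on the \<open>n\<close>-th stage\<close>
  have step: "\<exists>\<pi>\<in>P (Suc n). \<forall>x\<in>stage n. \<pi> x = \<sigma> x" if "\<sigma> \<in> P n" for n \<sigma>
  proof -
    define R where "R = saturation (P n) (P (Suc n)) (stage n)"
    have R: "subgroup R G" unfolding R_def by (rule saturation_subgroup[OF P P dec invP])
    have sub: "P (Suc n) \<subseteq> R" "R \<subseteq> P n" "fixator A (stage n) \<subseteq> R"
    proof -
      show "P (Suc n) \<subseteq> R" unfolding R_def by (rule subset_saturation[OF dec])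
      show "R \<subseteq> P n" by (auto simp: R_def saturation_def)
      show "fixator A (stage n) \<subseteq> R"
        unfolding R_def fixP[symmetric] by (rule fixator_subset_saturation[OF P])
    qed
    have "finite (rcosets\<^bsub>G\<lparr>carrier := P n\<rparr>\<^esub> P (Suc n))"
      by (rule finite_rcosets_supergroup[OF fixator_subgroup[OF subgroup_self] P WP PA finP]) simp
    then have "rel_index G (P n) R dvd rel_index G (P n) (P (Suc n))"
      using rel_index_mult[OF P R P sub(1,2)] by simp
    then have "\<not> p dvd rel_index G (P n) R" using npS dvd_trans by blast
    moreover have "rel_index G (P n) R dvd p ^ k n"
      using rel_index_mult[OF fixator_subgroup[OF subgroup_self] R P sub(3,2) finP] pk
      by (metis dvd_triv_left order.refl)
    ultimately have "rel_index G (P n) R = 1"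
      using divides_primepow_nat[OF p] by (metis dvd_power gr0I power_0)
    then have "R = P n" by (rule subgroup_eq_if_rel_index_1[OF R P sub(2)])
    then have "\<sigma> \<in> saturation (P n) (P (Suc n)) (stage n)" using that by (simp add: R_def)
    then obtain \<pi> where "\<pi> \<in> P (Suc n)" "\<forall>x\<in>stage n. \<sigma> x = \<pi> x"
      unfolding saturation_def by blast
    then show ?thesis by auto
  qed
  define Q where "Q = (\<Inter>n. P n)"
  have Q: "subgroup Q G" unfolding Q_def by (rule subgroups_Inter) (use P in auto)
  have QA: "Q \<subseteq> A" by (rule subgroup.subset[OF Q])
  have QP: "Q \<subseteq> P n" for n by (auto simp: Q_def)
  \<comment> \<open>so \<open>Q\<close> and \<open>P n\<close> do, by passing to the limit\<close>
  have lift: "\<exists>\<pi>\<in>Q. \<forall>x\<in>stage n. \<pi> x = \<sigma> x" if s: "\<sigma> \<in> P n" for n \<sigma>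
  proof -
    have "\<exists>f. \<forall>j. (f j \<in> P (n + j) \<and> (j = 0 \<longrightarrow> f j = \<sigma>)) \<and> (\<forall>x\<in>stage (n + j). f (Suc j) x = f j x)"
    proof (rule dependent_nat_choice)
      fix \<tau> j assume "\<tau> \<in> P (n + j) \<and> (j = 0 \<longrightarrow> \<tau> = \<sigma>)"
      then show "\<exists>\<tau>'. (\<tau>' \<in> P (n + Suc j) \<and> (Suc j = 0 \<longrightarrow> \<tau>' = \<sigma>)) \<and> (\<forall>x\<in>stage (n + j). \<tau>' x = \<tau> x)"
        using step[of \<tau> "n + j"] by auto
    qed (use s in auto)
    then obtain f where "\<forall>j. (f j \<in> P (n + j) \<and> (j = 0 \<longrightarrow> f j = \<sigma>)) \<and>
        (\<forall>x\<in>stage (n + j). f (Suc j) x = f j x)" ..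
    then have f: "\<And>j. f j \<in> P (n + j)" "f 0 = \<sigma>"
        "\<And>j x. x \<in> stage (n + j) \<Longrightarrow> f (Suc j) x = f j x"
      by blast+
    then have fA: "f j \<in> A" for j using PA by blast
    obtain \<pi> where pi: "\<pi> \<in> A" "\<And>j x. x \<in> stage (n + j) \<Longrightarrow> \<pi> x = f j x"
      using coherent_limit[of f n, OF fA f(3)] by blast
    have "\<pi> \<in> P (n + j)" for j
    proof -
      have i: "inv (f j) \<in> A" using fA by simp
      have "inv (f j) \<circ> \<pi> \<in> fixator A (stage (n + j))"
        using subgroup_comp[OF subgroup_self i pi(1)] pi(2)[of _ j] fA by (auto simp: fixator_def)
      then have "f j \<circ> (inv (f j) \<circ> \<pi>) \<in> P (n + j)"
        using WP subgroup_comp[OF P f(1)] by blast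
      moreover have "f j \<circ> (inv (f j) \<circ> \<pi>) = \<pi>" using fA by (auto simp: fun_eq_iff)
      ultimately show ?thesis by simp
    qed
    then have "\<pi> \<in> P m" for m using mono[of m "n + m"] by auto
    then show ?thesis using pi(2)[of _ 0] f(2) by (auto simp: Q_def)
  qed
  have ordQ: "induced_order Q (stage n) = p ^ k n" for n
  proof -
    have "(\<lambda>\<sigma>. restrict \<sigma> (stage n)) ` Q = (\<lambda>\<sigma>. restrict \<sigma> (stage n)) ` P n"
    proof
      show "(\<lambda>\<sigma>. restrict \<sigma> (stage n)) ` P n \<subseteq> (\<lambda>\<sigma>. restrict \<sigma> (stage n)) ` Q"
      proof
        fix g assume "g \<in> (\<lambda>\<sigma>. restrict \<sigma> (stage n)) ` P n"
        then obtain \<sigma> where s: "\<sigma> \<in> P n" "g = restrict \<sigma> (stage n)" by blast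
        obtain \<pi> where "\<pi> \<in> Q" "\<forall>x\<in>stage n. \<pi> x = \<sigma> x" using lift[OF s(1)] by blast
        then have "restrict \<pi> (stage n) = g" unfolding s(2) restrict_eq_iff by blast
        then show "g \<in> (\<lambda>\<sigma>. restrict \<sigma> (stage n)) ` Q" using \<open>\<pi> \<in> Q\<close> by blast
      qed
    qed (use QP in blast)
    then show ?thesis
      using rel_index_fixator(1)[OF P, of n "stage n"] fixP pk by (simp add: induced_order_def)
  qed
  have "pro_sylow p G T Q"
    unfolding pro_sylow_def
  proof (intro conjI allI impI)
    show "subgroup Q G" by (rule Q)
  next
    have "openin T (A - Q)"
      unfolding openin_iff
    proof (intro conjI ballI)
      fix \<sigma> assume s: "\<sigma> \<in> A - Q"
      then obtain n where n: "\<sigma> \<notin> P n" by (auto simp: Q_def)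
      have "\<tau> \<notin> P n" if t: "\<tau> \<in> A" "\<forall>x\<in>stage n. \<tau> x = \<sigma> x" for \<tau>
      proof
        assume tP: "\<tau> \<in> P n"
        have i: "inv \<tau> \<in> A" using t by simp
        have "inv \<tau> \<circ> \<sigma> \<in> fixator A (stage n)"
          using subgroup_comp[OF subgroup_self i, of \<sigma>] s t
          by (auto simp: fixator_def inv_apply_eq_iff)
        then have "\<tau> \<circ> (inv \<tau> \<circ> \<sigma>) \<in> P n" using WP subgroup_comp[OF P tP] by blast
        moreover have "\<tau> \<circ> (inv \<tau> \<circ> \<sigma>) = \<sigma>" using t by (auto simp: fun_eq_iff)
        ultimately show False using n by simp
      qed
      then show "\<exists>Y. finite Y \<and> {\<tau> \<in> A. \<forall>x\<in>Y. \<tau> x = \<sigma> x} \<subseteq> A - Q"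
        using QP finite_stage by (intro exI[of _ "stage n"]) blast
    qed auto
    then show "closedin T Q" using QA by (simp add: closedin_def topspace_eq)
  next
    show "pro_p_group p (G\<lparr>carrier := Q\<rparr>) (subtopology T Q)"
      unfolding pro_p_group_def
    proof (intro allI impI, elim conjE)
      fix N assume N: "N \<lhd> G\<lparr>carrier := Q\<rparr>" and o: "openin (subtopology T Q) N"
      have Ns: "subgroup N (G\<lparr>carrier := Q\<rparr>)" using N by (rule normal_imp_subgroup)
      have NG: "subgroup N G" by (rule incl_subgroup[OF Q Ns])
      have NQ: "N \<subseteq> Q" using subgroup.subset[OF Ns] by simp
      obtain V where V: "openin T V" "N = V \<inter> Q" using o by (auto simp: openin_subtopology)
      then have "id \<in> V" using subgroup_id[OF NG] by auto
      then obtain Y where Y: "finite Y" "fixator A Y \<subseteq> V" using ex_fixator_subset V(1) by blast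
      obtain n where n: "Y \<subseteq> stage n" by (rule finite_subset_stage[OF Y(1)])
      have sub: "fixator Q (stage n) \<subseteq> N" using Y(2) n V(2) QA by (auto simp: fixator_def)
      have "p ^ k n = rel_index G Q N * rel_index G N (fixator Q (stage n))"
        using rel_index_mult[OF fixator_subgroup[OF Q] NG Q sub NQ
            rel_index_fixator(2)[OF Q finite_restrictions[OF finite_stage QA]]]
          rel_index_fixator(1)[OF Q] ordQ by simp
      then have "rel_index G Q N dvd p ^ k n" by simp
      then obtain i where "rel_index G Q N = p ^ i" using divides_primepow_nat[OF p] by blast
      then show "\<exists>i. Coset.order (G\<lparr>carrier := Q\<rparr> Mod N) = p ^ i"
        by (auto simp: Coset.order_def FactGroup_def rel_index_def)
    qed
  next
    fix U assume U: "subgroup U G \<and> openin T U \<and> Q \<subseteq> U"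
    then obtain Y where Y: "finite Y" "fixator A Y \<subseteq> U"
      using ex_fixator_subset[of U] subgroup_id by blast
    obtain n where n: "Y \<subseteq> stage n" by (rule finite_subset_stage[OF Y(1)])
    have W: "fixator A (stage n) \<subseteq> U" using Y(2) n by (auto simp: fixator_def)
    have "\<sigma> \<in> U" if s: "\<sigma> \<in> P n" for \<sigma>
    proof -
      obtain \<pi> where pi: "\<pi> \<in> Q" "\<forall>x\<in>stage n. \<pi> x = \<sigma> x" using lift[OF s] by blast
      have c: "inv \<pi> \<in> A" "\<sigma> \<in> A" "\<pi> \<in> A" using pi(1) QA PA s by auto
      then have "inv \<pi> \<circ> \<sigma> \<in> fixator A (stage n)"
        using subgroup_comp[OF subgroup_self c(1,2)] pi by (auto simp: fixator_def inv_apply_eq_iff)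
      then have "\<pi> \<circ> (inv \<pi> \<circ> \<sigma>) \<in> U" using subgroup_comp[of U \<pi>] U W pi(1) by blast
      moreover have "\<pi> \<circ> (inv \<pi> \<circ> \<sigma>) = \<sigma>" using c by (auto simp: fun_eq_iff)
      ultimately show ?thesis by simp
    qed
    \<comment> \<open>an open subgroup that contains \<open>Q\<close> contains a term of the chain\<close>
    then have PU: "P n \<subseteq> U" by blast
    have "finite (rcosets fixator A (stage n))"
      using rel_index_fixator(2)[OF subgroup_self finite_restrictions[OF finite_stage order.refl]] by simp
    then have "finite (rcosets P n)"
      using finite_rcosets_supergroup[OF fixator_subgroup[OF subgroup_self] P WP order.refl] by simp
    then have "rel_index G A U dvd rel_index G A (P n)"
      using rel_index_mult[OF P _ subgroup_self PU] U subgroup.subset by fastforce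
    then show "\<not> p dvd card (rcosets U)"
      using np[of n] dvd_trans by (auto simp: rel_index_def)
  qed
  then show ?thesis using that by blast
qed

subsection \<open>The induced groups on finite invariant sets\<close>

text \<open>A Sylow subgroup of a profinite group induces a Sylow subgroup on every finite invariant set. The
definition gives the order of the image from the pro-\<open>p\<close> property and its index from the open
subgroup that is the saturation of \<open>P\<close>.\<close>

lemma pro_sylow_induced_order:
  assumes p: "Factorial_Ring.prime p" and P: "pro_sylow p G T P" and Y: "finite Y" "invariant A Y"
  obtains k m where "induced_order P Y = p ^ k" "induced_order A Y = m * p ^ k" "\<not> p dvd m"
proof -
  have Ps: "subgroup P G" and pro: "pro_p_group p (G\<lparr>carrier := P\<rparr>) (subtopology T P)"
    and index: "\<And>U. subgroup U G \<Longrightarrow> openin T U \<Longrightarrow> P \<subseteq> U \<Longrightarrow> \<not> p dvd card (rcosets U)"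
    using P by (auto simp: pro_sylow_def)
  have PA: "P \<subseteq> A" by (rule subgroup.subset[OF Ps])
  have "invariant P Y" using Y PA by (auto simp: invariant_def)
  then have "fixator P Y \<lhd> G\<lparr>carrier := P\<rparr>" by (rule fixator_normal[OF Ps])
  moreover have "fixator P Y = fixator A Y \<inter> P" using PA by (auto simp: fixator_def)
  then have "openin (subtopology T P) (fixator P Y)"
    using openin_fixator[OF Y(1)] by (auto simp: openin_subtopology)
  ultimately obtain k where k: "Coset.order (G\<lparr>carrier := P\<rparr> Mod fixator P Y) = p ^ k"
    using pro by (auto simp: pro_p_group_def)
  then have ordP: "induced_order P Y = p ^ k"
    using rel_index_fixator(1)[OF Ps, of Y] by (simp add: Coset.order_def FactGroup_def rel_index_def)
  define U where "U = saturation A P Y"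
  have U: "subgroup U G" unfolding U_def by (rule saturation_subgroup[OF subgroup_self Ps PA Y(2)])
  have W: "fixator A Y \<subseteq> U" unfolding U_def by (rule fixator_subset_saturation[OF Ps])
  have "\<not> p dvd rel_index G A U"
    using index[OF U openin_if_fixator_subset[OF U Y(1) W]] subset_saturation[OF PA]
    by (simp add: U_def rel_index_def)
  moreover have "induced_order A Y = rel_index G A U * induced_order U Y"
    by (rule induced_order_mult[OF U subgroup_self subgroup.subset[OF U] W
          finite_restrictions[OF Y(1) order.refl]])
  moreover have "induced_order U Y = p ^ k"
    unfolding U_def using induced_order_saturation[OF PA] ordP by simp
  ultimately show ?thesis using that[OF ordP] by metis
qed

lemma pro_sylow_orbit:
  assumes P: "pro_sylow p G T P" and x: "\<And>\<sigma>. \<sigma> \<in> P \<Longrightarrow> \<sigma> x = x"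
  shows "\<not> p dvd card (orbit_of A x)"
proof -
  have "subgroup (fixator A {x}) G" "openin T (fixator A {x})"
    by (auto intro: fixator_subgroup subgroup_self openin_fixator)
  moreover have "P \<subseteq> fixator A {x}"
    using P x subgroup.subset[of P G] by (auto simp: pro_sylow_def fixator_def)
  ultimately have "\<not> p dvd card (rcosets (fixator A {x}))"
    using P by (auto simp: pro_sylow_def)
  then show ?thesis
    using orbit_stabilizer[OF subgroup_self, of x] by (simp add: rel_index_def)
qed

end

section \<open>Transitive actions of prime degree\<close>

context perm_group
begin

lemma orbit_pair_edges:
  assumes "finite (orbit_of (carrier G) a)" "finite (orbit_of (carrier G) a')"
  defines "E \<equiv> (\<lambda>\<sigma>. (\<sigma> a, \<sigma> a')) ` carrier G"
  shows "finite E" "card E = rel_index G (carrier G) (fixator (carrier G) {a, a'})"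
    and "finite (rcosets fixator (carrier G) {a, a'})"
proof -
  have "E \<subseteq> orbit_of (carrier G) a \<times> orbit_of (carrier G) a'" by (auto simp: E_def orbit_of_def)
  then show fin: "finite E" using assms(1,2) by (meson finite_SigmaI finite_subset)
  have "card E = induced_order (carrier G) {a, a'}" unfolding E_def induced_order_def
    by (rule card_image_eq_if_same_kernel(2)) (auto simp: restrict_eq_iff)
  then show "card E = rel_index G (carrier G) (fixator (carrier G) {a, a'})"
    using rel_index_fixator(1)[OF subgroup_self] by simp
  have "finite E \<longleftrightarrow> finite ((\<lambda>\<sigma>. restrict \<sigma> {a, a'}) ` carrier G)" unfolding E_def
    by (rule card_image_eq_if_same_kernel(1)) (auto simp: restrict_eq_iff)
  then show "finite (rcosets fixator (carrier G) {a, a'})"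
    using rel_index_fixator(2)[OF subgroup_self, of "{a, a'}"] fin by simp
qed

text \<open>A transitive group of prime degree is primitive: the classes in \<open>\<Omega>\<close> of an invariant equivalence relation are permuted transitively, so they have the
same size, which divides the prime \<open>|\<Omega>|\<close>.\<close>

lemma invariant_equivalence_prime_degree:
  assumes prime: "Factorial_Ring.prime (card \<Omega>)" and \<Omega>: "\<Omega> = orbit_of (carrier G) a"
    and sym: "sym R" and trans: "trans R" and refl: "refl R"
    and inv: "\<And>\<sigma> x y. \<sigma> \<in> carrier G \<Longrightarrow> (x, y) \<in> R \<Longrightarrow> (\<sigma> x, \<sigma> y) \<in> R"
    and sub: "\<And>x y. (x, y) \<in> R \<Longrightarrow> x \<in> \<Omega> \<Longrightarrow> y \<in> \<Omega>"
    and a': "(a, a') \<in> R" "a \<noteq> a'"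
  shows "R `` {a} = \<Omega>"
proof -
  have fin: "finite \<Omega>" using prime_gt_0_nat[OF prime] by (rule card_ge_0_finite)
  have a: "a \<in> \<Omega>" unfolding \<Omega> by (rule orbit_self[OF subgroup_self])
  have cls: "R `` {x} \<subseteq> \<Omega>" if "x \<in> \<Omega>" for x using sub that by blast
  have fib: "{y \<in> \<Omega>. R `` {y} = R `` {x}} = R `` {x}" if "x \<in> \<Omega>" for x
  proof -
    have "R `` {y} = R `` {x}" if "(x, y) \<in> R" for y
      using that symD[OF sym] transD[OF trans] by blast
    moreover have "y \<in> R `` {y}" for y using refl by (auto simp: refl_on_def)
    ultimately show ?thesis using cls[OF that] by blast
  qed
  have card_le: "card (R `` {x}) \<le> card (R `` {\<sigma> x})" if s: "\<sigma> \<in> carrier G" and x: "\<sigma> x \<in> \<Omega>" for \<sigma> x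
  proof (rule card_inj_on_le[of \<sigma>])
    show "inj_on \<sigma> (R `` {x})" using s by (auto intro: inj_onI)
    show "\<sigma> ` R `` {x} \<subseteq> R `` {\<sigma> x}" using inv[OF s] by auto
    show "finite (R `` {\<sigma> x})" using cls[OF x] fin by (rule finite_subset)
  qed
  have card_eq: "card (R `` {x}) = card (R `` {a})" if x: "x \<in> \<Omega>" for x
  proof -
    obtain \<sigma> where s: "\<sigma> \<in> carrier G" "x = \<sigma> a" using x unfolding \<Omega> orbit_of_def by blast
    have i: "(inv \<sigma>) x = a" "inv \<sigma> \<in> carrier G" using s by auto
    show ?thesis using card_le[OF s(1), of a] card_le[OF i(2), of x] s(2) i(1) x a by auto
  qed
  have "card ((\<lambda>x. x) ` \<Omega>) = card ((\<lambda>x. R `` {x}) ` \<Omega>) * card (R `` {a})"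
    by (rule card_image_equal_fibres) (use fin fib card_eq in auto)
  then have "card (R `` {a}) dvd card \<Omega>" by simp
  moreover have "card (R `` {a}) \<noteq> 1"
  proof
    assume "card (R `` {a}) = 1"
    moreover have "a \<in> R `` {a}" "a' \<in> R `` {a}" using a' refl by (auto simp: refl_on_def)
    ultimately show False using a'(2) by (metis card_1_singletonE singletonD)
  qed
  ultimately have "card (R `` {a}) = card \<Omega>" using prime by (metis prime_nat_iff)
  then show ?thesis using card_subset_eq[OF fin cls[OF a]] by blast
qed

text \<open>The images of \<open>(a, a')\<close> form an invariant graph \<open>E\<close> on \<open>\<Omega>\<close>. It is undirected because some element of
\<open>B\<close> interchanges \<open>a\<close> and \<open>a'\<close>. The stabilizer of \<open>a\<close> in \<open>B\<close> fixes \<open>a'\<close> and has index \<open>2 |\<Omega>|\<close> in \<open>G\<close>,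
so \<open>|E|\<close> divides \<open>2 |\<Omega>|\<close>, and every vertex has at most two neighbours. The graph is connected since
\<open>|\<Omega>|\<close> is prime. A permutation in the stabilizer fixes \<open>a\<close> and its neighbour \<open>a'\<close>; if it fixes a
vertex and one neighbour of it, it fixes the other neighbour too, and so it fixes everything.\<close>

lemma prime_degree_orbit_of_size_two:
  assumes prime: "Factorial_Ring.prime (card \<Omega>)" and \<Omega>: "\<Omega> = orbit_of (carrier G) a"
    and B: "subgroup B G" and index: "rel_index G (carrier G) B = card \<Omega>"
    and orb: "orbit_of B a = {a, a'}" and neq: "a \<noteq> a'"
  shows "fixator B {a} \<subseteq> fixator B \<Omega>"
proof -
  let ?A = "carrier G"
  define E where "E = (\<lambda>\<sigma>. (\<sigma> a, \<sigma> a')) ` ?A"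
  define N where "N u = {v. (u, v) \<in> E}" for u
  have BA: "B \<subseteq> ?A" by (rule subgroup.subset[OF B])
  have fin: "finite \<Omega>" and pos: "card \<Omega> > 0"
  proof -
    show "card \<Omega> > 0" using prime by (rule prime_gt_0_nat)
    then show "finite \<Omega>" by (rule card_ge_0_finite)
  qed
  obtain \<beta> where b: "\<beta> \<in> B" "\<beta> a = a'" 
  proof -
    have "a' \<in> (\<lambda>\<sigma>. \<sigma> a) ` B" using orb unfolding orbit_of_def by simp
    then show ?thesis using that by blast
  qed
  have bA: "\<beta> \<in> ?A" using b BA by blast
  have "\<beta> a' \<in> {a, a'}"
    using orbit_invariant[OF B, of a] b(1) unfolding orb by (auto simp: invariant_def)
  moreover have "\<beta> a' \<noteq> a'" using b neq bA apply_eq_iff[of \<beta> a' a] by auto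
  ultimately have ba': "\<beta> a' = a" by simp
  have fix_a': "\<sigma> a' = a'" if "\<sigma> \<in> B" "\<sigma> a = a" for \<sigma>
  proof -
    have "\<sigma> a' \<in> {a, a'}"
      using orbit_invariant[OF B, of a] that(1) unfolding orb by (auto simp: invariant_def)
    moreover have "\<sigma> a' \<noteq> a" using that neq BA apply_eq_iff[of \<sigma> a' a] by auto
    ultimately show ?thesis by simp
  qed
  have a': "a' \<in> \<Omega>" unfolding \<Omega> orbit_of_def using bA b by blast
  have inv\<Omega>: "\<sigma> x \<in> \<Omega>" if "\<sigma> \<in> ?A" "x \<in> \<Omega>" for \<sigma> x
    using orbit_invariant[OF subgroup_self, of a] that by (auto simp: invariant_def \<Omega>)
  have E_act: "(\<sigma> u, \<sigma> v) \<in> E" if s: "\<sigma> \<in> ?A" and uv: "(u, v) \<in> E" for \<sigma> u v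
  proof -
    obtain \<tau> where t: "\<tau> \<in> ?A" "u = \<tau> a" "v = \<tau> a'" using uv by (auto simp: E_def)
    show ?thesis using subgroup_comp[OF subgroup_self s t(1)] unfolding E_def t(2,3)
      by (intro image_eqI[of _ _ "\<sigma> \<circ> \<tau>"]) auto
  qed
  have E_sym: "(v, u) \<in> E" if uv: "(u, v) \<in> E" for u v
  proof -
    obtain \<tau> where t: "\<tau> \<in> ?A" "u = \<tau> a" "v = \<tau> a'" using uv by (auto simp: E_def)
    show ?thesis using subgroup_comp[OF subgroup_self t(1) bA] b ba' unfolding E_def t(2,3)
      by (intro image_eqI[of _ _ "\<tau> \<circ> \<beta>"]) auto
  qed
  have E_sub: "E \<subseteq> \<Omega> \<times> \<Omega>" using inv\<Omega> a' orbit_self[OF subgroup_self, of a]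
    by (auto simp: E_def \<Omega>)
  have aE: "(a, a') \<in> E" using subgroup_id[OF subgroup_self] unfolding E_def
    by (intro image_eqI[of _ _ id]) auto
  have finN: "finite (N u)" for u
    using E_sub fin by (intro finite_subset[of "N u" \<Omega>]) (auto simp: N_def)
  have N_card: "card (N u) = card (N a)" if u: "u \<in> \<Omega>" for u
  proof -
    obtain \<sigma> where s: "\<sigma> \<in> ?A" "u = \<sigma> a" using u unfolding \<Omega> orbit_of_def by blast
    have "\<sigma> ` N a = N u"
    proof
      show "N u \<subseteq> \<sigma> ` N a"
      proof
        fix v assume "v \<in> N u"
        then have "((inv \<sigma>) u, (inv \<sigma>) v) \<in> E" using E_act[of "inv \<sigma>"] s(1) by (simp add: N_def)
        then have "(inv \<sigma>) v \<in> N a" unfolding s(2) N_def using s(1) by simp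
        then show "v \<in> \<sigma> ` N a" using s by (intro image_eqI[of _ _ "(inv \<sigma>) v"]) auto
      qed
    qed (use E_act s in \<open>auto simp: N_def\<close>)
    moreover have "inj_on \<sigma> (N a)" using s by (auto intro: inj_onI)
    ultimately show ?thesis by (metis card_image)
  qed
  \<comment> \<open>\<open>|\<Omega>| |N a| = |E|\<close>, and \<open>|E|\<close> divides \<open>2 |\<Omega>|\<close>\<close>
  have deg: "card (N u) \<le> 2" if u: "u \<in> \<Omega>" for u
  proof -
    have "E = (SIGMA u:\<Omega>. N u)" using E_sub by (auto simp: N_def)
    then have "card E = (\<Sum>u\<in>\<Omega>. card (N u))" using fin finN by simp
    then have cE: "card E = card \<Omega> * card (N a)" using N_card by simp
    have fo: "finite (orbit_of ?A a)" "finite (orbit_of ?A a')"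
      using fin orbit_eq[OF subgroup_self, of a' a] a' \<Omega> by auto
    let ?F = "fixator ?A {a, a'}" and ?S = "fixator B {a}"
    have S: "subgroup ?S G" and F: "subgroup ?F G"
      using fixator_subgroup B subgroup_self by auto
    have SF: "?S \<subseteq> ?F" using fix_a' BA by (auto simp: fixator_def)
    have finB: "finite (rcosets B)"
      using index pos card_ge_0_finite[of "rcosets B"] by (simp add: rel_index_def)
    have iBS: "rel_index G B ?S = 2" using orbit_stabilizer[OF B, of a] orb neq by simp
    have finS: "finite (rcosets ?S)"
      using finite_rcosets_trans[OF S B subgroup_self _ BA] finB
        card_ge_0_finite[of "rcosets\<^bsub>G\<lparr>carrier := B\<rparr>\<^esub> ?S"] iBS
      by (auto simp: fixator_def rel_index_def)
    have "rel_index G ?A ?S = card \<Omega> * 2"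
      using rel_index_mult[OF S B subgroup_self _ BA] finS index iBS by (auto simp: fixator_def)
    moreover have "rel_index G ?A ?S = card E * rel_index G ?F ?S"
      using rel_index_mult[OF S F subgroup_self SF] finS orbit_pair_edges(2)[OF fo]
      by (auto simp: fixator_def E_def)
    ultimately have "card \<Omega> * card (N a) * rel_index G ?F ?S = card \<Omega> * 2" using cE by simp
    then have "card (N a) * rel_index G ?F ?S = 2" using pos by simp
    then have "card (N a) dvd 2" by (metis dvd_triv_left)
    then show ?thesis using N_card[OF u] by (auto dest: dvd_imp_le)
  qed
  have conn: "E\<^sup>* `` {a} = \<Omega>"
  proof (rule invariant_equivalence_prime_degree[OF prime \<Omega>])
    show "sym (E\<^sup>*)" using E_sym by (intro sym_rtrancl symI)
    show "(\<sigma> x, \<sigma> y) \<in> E\<^sup>*" if "\<sigma> \<in> ?A" "(x, y) \<in> E\<^sup>*" for \<sigma> x y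
      using that(2) by induction (auto intro: rtrancl.rtrancl_into_rtrancl E_act[OF that(1)])
    show "y \<in> \<Omega>" if "(x, y) \<in> E\<^sup>*" "x \<in> \<Omega>" for x y
      using that by (induction) (use E_sub in auto)
  qed (use aE neq in \<open>auto intro: trans_rtrancl refl_rtrancl\<close>)
  have fixed: "\<tau> v = v \<and> (\<exists>w\<in>N v. \<tau> w = w)" if t: "\<tau> \<in> B" "\<tau> a = a" and av: "(a, v) \<in> E\<^sup>*" for \<tau> v
    using av
  proof induction
    case base
    show ?case using t fix_a'[OF t] aE by (auto simp: N_def)
  next
    case (step v w)
    then obtain w0 where w0: "w0 \<in> N v" "\<tau> w0 = w0" and v: "\<tau> v = v" by blast
    have tA: "\<tau> \<in> ?A" using t BA by blast
    have w: "w \<in> N v" using step by (simp add: N_def)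
    have tw: "\<tau> w \<in> N v" using E_act[OF tA step(2)] v by (simp add: N_def)
    have "\<tau> w = w"
    proof (rule ccontr)
      assume ne: "\<tau> w \<noteq> w"
      then have "w \<noteq> w0" using w0 by auto
      moreover have "\<tau> w \<noteq> w0" using w0 \<open>w \<noteq> w0\<close> apply_eq_iff[OF tA, of w w0] by auto
      ultimately have "card {w0, w, \<tau> w} = 3" using ne by simp
      moreover have "card {w0, w, \<tau> w} \<le> card (N v)"
        by (rule card_mono[OF finN]) (use w0 w tw in auto)
      moreover have "v \<in> \<Omega>" using step(2) E_sub by auto
      ultimately show False using deg[of v] by simp
    qed
    moreover have "v \<in> N w" using E_sym step(2) by (simp add: N_def)
    ultimately show ?case using v by blast
  qed
  show ?thesis using fixed conn by (auto simp: fixator_def)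
qed

section \<open>Small degree or small order\<close>

text \<open>Without a fixed point there are orbits of \<open>B\<close> of sizes \<open>s\<close> and \<open>t\<close>, with \<open>s\<close> odd and \<open>t\<close> not divisible
by some prime factor of \<open>s\<close>. If \<open>n = |\<Omega>| \<le> 6\<close>, then \<open>s = 3\<close> and \<open>t = 2\<close>, and \<open>n = 6\<close> is impossible
as the remaining point would be fixed. If \<open>n \<ge> 7\<close> and \<open>n h < 48\<close>, then \<open>h \<le> 6\<close> has the divisors \<open>s\<close>
and \<open>t\<close>, which forces \<open>h = 6\<close>, \<open>n = 7\<close>, and again \<open>t = 2\<close>. In both cases \<open>n\<close> is prime, so
\<open>h = 2\<close> by the preceding lemma, while \<open>s\<close> divides \<open>h\<close>.\<close>

theorem ex_fixed_point_if_orbits_coprime: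
  assumes \<Omega>: "\<Omega> = orbit_of (carrier G) x" and fin: "finite \<Omega>"
    and B: "subgroup B G" and index: "rel_index G (carrier G) B = card \<Omega>"
    and order: "induced_order (carrier G) \<Omega> = card \<Omega> * induced_order B \<Omega>"
    and coprime: "\<And>p::nat. Factorial_Ring.prime p \<Longrightarrow> \<exists>y\<in>\<Omega>. \<not> p dvd card (orbit_of B y)"
    and small: "card \<Omega> \<le> 6 \<or> induced_order (carrier G) \<Omega> < 48"
  shows "\<exists>y\<in>\<Omega>. \<forall>\<sigma>\<in>B. \<sigma> y = y"
proof (rule ccontr)
  assume nofix: "\<not> (\<exists>y\<in>\<Omega>. \<forall>\<sigma>\<in>B. \<sigma> y = y)"
  let ?n = "card \<Omega>" and ?h = "induced_order B \<Omega>" and ?o = "\<lambda>y. card (orbit_of B y)"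
  have BA: "B \<subseteq> carrier G" by (rule subgroup.subset[OF B])
  have inv\<Omega>: "invariant (carrier G) \<Omega>" unfolding \<Omega> by (rule orbit_invariant[OF subgroup_self])
  have sub: "orbit_of B y \<subseteq> \<Omega>" if "y \<in> \<Omega>" for y
    using inv\<Omega> BA that by (auto simp: orbit_of_def invariant_def)
  have fino: "finite (orbit_of B y)" if "y \<in> \<Omega>" for y
    by (rule finite_subset[OF sub[OF that] fin])
  have two: "?o y \<ge> 2" if y: "y \<in> \<Omega>" for y
  proof -
    obtain \<sigma> where "\<sigma> \<in> B" "\<sigma> y \<noteq> y" using nofix y by blast
    then have "card {y, \<sigma> y} = 2" "{y, \<sigma> y} \<subseteq> orbit_of B y"
      using orbit_self[OF B, of y] by (auto simp: orbit_of_def)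
    then show ?thesis using card_mono[OF fino[OF y]] by metis
  qed
  have restr: "finite ((\<lambda>\<sigma>. restrict \<sigma> \<Omega>) ` B)"
  proof (rule finite_subset)
    show "(\<lambda>\<sigma>. restrict \<sigma> \<Omega>) ` B \<subseteq> \<Omega> \<rightarrow>\<^sub>E \<Omega>" using inv\<Omega> BA by (auto simp: invariant_def)
  qed (simp add: finite_PiE fin)
  have h_stab: "?h = ?o y * induced_order (fixator B {y}) \<Omega>" if "y \<in> \<Omega>" for y
    using induced_order_mult[OF fixator_subgroup[OF B] B _ _ restr, of "{y}"]
      orbit_stabilizer[OF B] that by (auto simp: fixator_def)
  have dvd_h: "?o y dvd ?h" if "y \<in> \<Omega>" for y using h_stab[OF that] by simp
  have h_pos: "?h > 0"
    using restr subgroup_id[OF B] by (auto simp: induced_order_def card_gt_0_iff)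
  have disj: "orbit_of B y \<inter> orbit_of B z = {}" if "orbit_of B y \<noteq> orbit_of B z" for y z
    using that orbit_eq[OF B] by blast
  \<comment> \<open>an orbit of odd size, and a second one that avoids a prime factor of that size\<close>
  obtain y where y: "y \<in> \<Omega>" "\<not> 2 dvd ?o y" using coprime[OF two_is_prime_nat] by blast
  define s where "s = ?o y"
  have s: "s \<ge> 3" "odd s" using two[OF y(1)] y(2) unfolding s_def by (auto simp: le_less)
  then obtain q where q: "Factorial_Ring.prime q" "q dvd s" using prime_factor_nat[of s] by auto
  obtain z where z: "z \<in> \<Omega>" "\<not> q dvd ?o z" using coprime[OF q(1)] by blast
  define t where "t = ?o z"
  have t: "t \<ge> 2" "\<not> q dvd t" using two[OF z(1)] z(2) by (auto simp: t_def)
  have yz: "orbit_of B y \<inter> orbit_of B z = {}"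
    by (rule disj) (use q t in \<open>auto simp: s_def t_def\<close>)
  have st: "s + t \<le> ?n"
    using card_mono[OF fin, of "orbit_of B y \<union> orbit_of B z"] sub[OF y(1)] sub[OF z(1)]
      card_Un_disjoint[OF fino[OF y(1)] fino[OF z(1)] yz] by (simp add: s_def t_def)
  have not1: "?n \<noteq> s + t + 1"
  proof
    assume n: "?n = s + t + 1"
    let ?U = "orbit_of B y \<union> orbit_of B z"
    have cU: "card ?U = s + t" using card_Un_disjoint[OF fino[OF y(1)] fino[OF z(1)] yz]
      by (simp add: s_def t_def)
    then have "\<Omega> \<noteq> ?U" using n by auto
    then obtain w where w: "w \<in> \<Omega>" "w \<notin> ?U" using sub[OF y(1)] sub[OF z(1)] by blast
    have "orbit_of B w \<inter> ?U = {}"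
      using disj[of w y] disj[of w z] w(2) orbit_self[OF B, of w] by blast
    then have "card (orbit_of B w \<union> ?U) = ?o w + (s + t)"
      using card_Un_disjoint[of "orbit_of B w" ?U] fino w(1) y(1) z(1) cU by simp
    moreover have "card (orbit_of B w \<union> ?U) \<le> ?n"
      by (rule card_mono[OF fin]) (use sub w(1) y(1) z(1) in blast)
    ultimately show False using n two[OF w(1)] by simp
  qed
  have s_dvd: "s dvd ?h" and t_dvd: "t dvd ?h" using dvd_h y z by (auto simp: s_def t_def)
  have no2: "t \<noteq> 2" if prime: "Factorial_Ring.prime ?n"
  proof
    assume "t = 2"
    then obtain u v where "orbit_of B z = {u, v}" "u \<noteq> v" unfolding t_def card_2_iff by blast
    then obtain z' where z': "orbit_of B z = {z, z'}" "z \<noteq> z'"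
      using orbit_self[OF B, of z] by (metis empty_iff insert_commute insert_iff)
    have "\<Omega> = orbit_of (carrier G) z" using orbit_eq[OF subgroup_self] z(1) \<Omega> by blast
    from prime_degree_orbit_of_size_two[OF prime this B index z']
    have "fixator B {z} = fixator B \<Omega>" using z(1) by (auto simp: fixator_def)
    then have "?h = 2"
      using rel_index_fixator(1)[OF B, of \<Omega>] orbit_stabilizer[OF B, of z] \<open>t = 2\<close> by (simp add: t_def)
    then show False using s_dvd s by (auto dest: dvd_imp_le)
  qed
  have q3: "q = 3" if "s = 3"
    using primes_dvd_imp_eq[of q 3] q that by simp
  show False
  proof (cases "?n \<le> 6")
    case True
    then consider "s = 3" "t = 2" | "s = 3" "t = 3" | "s = 4" using st s t by linarith
    then show False
    proof cases
      case 1
      then have "?n = 5" using st not1 True by simp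
      then show False using no2 1 by simp
    qed (use q3 t s in auto)
  next
    case False
    then have n7: "?n \<ge> 7" and nh: "?n * ?h < 48" using small order by auto
    have "7 * ?h \<le> ?n * ?h" using n7 by simp
    then have h6: "?h \<le> 6" using nh by linarith
    have "s \<le> ?h" "t \<le> ?h" using s_dvd t_dvd h_pos by (auto dest: dvd_imp_le)
    then consider "s = 3" | "s = 4" | "s = 5" | "s = 6" using s h6 by linarith
    then show False
    proof cases
      case 1
      have t3: "\<not> 3 dvd t" using t(2) q3[OF 1] by simp
      have "?h = 6 \<and> t = 2"
      proof -
        have "?h = 3 \<or> ?h = 4 \<or> ?h = 5 \<or> ?h = 6" using \<open>s \<le> ?h\<close> h6 1 by linarith
        then have h: "?h = 3 \<or> ?h = 6" using s_dvd 1 by (elim disjE) auto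
        have "t = 2 \<or> t = 3 \<or> t = 4 \<or> t = 5 \<or> t = 6" using \<open>t \<le> ?h\<close> h6 t(1) by linarith
        then show ?thesis using t3 t_dvd h by (elim disjE) auto
      qed
      moreover from this have "?n = 7" using nh n7 by simp
      ultimately show False using no2 by simp
    next
      case 3
      have "?h = 5 \<or> ?h = 6" using \<open>s \<le> ?h\<close> h6 3 by linarith
      then have h: "?h = 5" using s_dvd 3 by (elim disjE) auto
      have "t = 2 \<or> t = 3 \<or> t = 4 \<or> t = 5" using \<open>t \<le> ?h\<close> h t(1) by linarith
      then have "t = 5" using t_dvd h by (elim disjE) auto
      then show False using 3 q t by simp
    qed (use s in auto)
  qed
qed

end

section \<open>Polynomials over the rationals and their roots\<close>

definition rat_poly :: "qbar poly \<Rightarrow> bool"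
  where "rat_poly p \<longleftrightarrow> (\<forall>i. poly.coeff p i \<in> \<rat>)"

lemma to_ac_eq_of_rat: "to_ac r = (of_rat r :: qbar)"
proof -
  obtain a b where "quotient_of r = (a, b)" by (cases "quotient_of r")
  then have r: "r = of_int a / of_int b" by (rule quotient_of_div)
  show ?thesis unfolding r by (simp add: of_rat_divide)
qed

lemma ex_rat_poly_root: "\<exists>p. rat_poly p \<and> p \<noteq> 0 \<and> poly p x = 0"
proof -
  obtain p :: "rat poly" where "p \<noteq> 0" "poly (map_poly to_ac p) x = 0"
    by (rule alg_closure_algebraic)
  then show ?thesis
    by (intro exI[of _ "map_poly to_ac p"])
      (auto simp: rat_poly_def coeff_map_poly to_ac_eq_of_rat poly_eq_iff)
qed

lemma countable_qbar: "countable (UNIV :: qbar set)"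
proof -
  have c: "countable (UNIV :: rat poly set)"
  proof (rule countableI[of "to_nat \<circ> coeffs"])
    show "inj_on (to_nat \<circ> coeffs) (UNIV :: rat poly set)"
      by (intro inj_onI) (simp add: coeffs_eq_iff)
  qed
  have "(UNIV :: qbar set) = (\<Union>p\<in>{p :: rat poly. p \<noteq> 0}. {x. poly (map_poly to_ac p) x = 0})"
  proof -
    have "\<exists>p :: rat poly. p \<noteq> 0 \<and> poly (map_poly to_ac p) x = 0" for x :: qbar
      by (rule alg_closure_algebraic) blast
    then show ?thesis by auto
  qed
  moreover have "countable {x :: qbar. poly (map_poly to_ac p) x = 0}" if "p \<noteq> 0" for p :: "rat poly"
  proof -
    have "map_poly to_ac p \<noteq> 0" using that by (auto simp: poly_eq_iff coeff_map_poly)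
    then show ?thesis by (intro countable_finite poly_roots_finite)
  qed
  ultimately show ?thesis
    by (subst (1) \<open>UNIV = _\<close>) (intro countable_UN countable_subset[OF subset_UNIV c], simp)
qed

section \<open>Extending homomorphisms\<close>

text \<open>The graph of a ring homomorphism on a subring that contains the rationals. In this form Zorn's lemma
applies to unions of chains. Differences of elements of \<open>\<Gamma>\<close> are in \<open>\<Gamma>\<close>, as -1 is rational, so the
last condition says that the relation is single-valued.\<close>

definition partial_hom :: "(qbar \<times> qbar) set \<Rightarrow> bool"
  where "partial_hom \<Gamma> \<longleftrightarrow> (\<forall>r\<in>\<rat>. (r, r) \<in> \<Gamma>) \<and>
    (\<forall>a b c d. (a, b) \<in> \<Gamma> \<longrightarrow> (c, d) \<in> \<Gamma> \<longrightarrow> (a + c, b + d) \<in> \<Gamma> \<and> (a * c, b * d) \<in> \<Gamma>) \<and>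
    (\<forall>b. (0, b) \<in> \<Gamma> \<longrightarrow> b = 0)"

text \<open>The second polynomial arises from the first by applying the homomorphism \<open>\<Gamma>\<close> to the coefficients.\<close>

definition rel_poly :: "(qbar \<times> qbar) set \<Rightarrow> qbar poly \<Rightarrow> qbar poly \<Rightarrow> bool"
  where "rel_poly \<Gamma> p q \<longleftrightarrow> (\<forall>i. (poly.coeff p i, poly.coeff q i) \<in> \<Gamma>)"

lemma partial_hom_rat: "partial_hom \<Gamma> \<Longrightarrow> r \<in> \<rat> \<Longrightarrow> (r, r) \<in> \<Gamma>"
  by (simp add: partial_hom_def)

lemma partial_hom_0: "partial_hom \<Gamma> \<Longrightarrow> (0, 0) \<in> \<Gamma>"
  by (simp add: partial_hom_def)

lemma partial_hom_add: "partial_hom \<Gamma> \<Longrightarrow> (a, b) \<in> \<Gamma> \<Longrightarrow> (c, d) \<in> \<Gamma> \<Longrightarrow> (a + c, b + d) \<in> \<Gamma>"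
  by (simp add: partial_hom_def)

lemma partial_hom_mult: "partial_hom \<Gamma> \<Longrightarrow> (a, b) \<in> \<Gamma> \<Longrightarrow> (c, d) \<in> \<Gamma> \<Longrightarrow> (a * c, b * d) \<in> \<Gamma>"
  by (simp add: partial_hom_def)

lemma partial_hom_diff:
  assumes "partial_hom \<Gamma>" "(a, b) \<in> \<Gamma>" "(c, d) \<in> \<Gamma>" shows "(a - c, b - d) \<in> \<Gamma>"
  using partial_hom_add[OF assms(1,2) partial_hom_mult[OF assms(1) partial_hom_rat[OF assms(1), of "-1"] assms(3)]]
  by simp

lemma partial_hom_unique:
  assumes "partial_hom \<Gamma>" "(a, b) \<in> \<Gamma>" "(a, c) \<in> \<Gamma>" shows "b = c"
  using partial_hom_diff[OF assms] assms(1) by (auto simp: partial_hom_def)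

lemma partial_hom_poly:
  assumes \<Gamma>: "partial_hom \<Gamma>" and ab: "(a, b) \<in> \<Gamma>" and "rel_poly \<Gamma> p q"
  shows "(poly p a, poly q b) \<in> \<Gamma>"
  using assms(3)
proof (induction p arbitrary: q)
  case 0
  then have "poly.coeff q i = 0" for i using \<Gamma> by (simp add: rel_poly_def partial_hom_def)
  then have "q = 0" by (simp add: poly_eq_iff)
  then show ?case using partial_hom_0[OF \<Gamma>] by simp
next
  case (pCons c p)
  obtain d q' where q: "q = pCons d q'" by (cases q)
  have *: "(poly.coeff (pCons c p) i, poly.coeff (pCons d q') i) \<in> \<Gamma>" for i
    using pCons(3) by (simp add: rel_poly_def q)
  have "(c, d) \<in> \<Gamma>" using *[of 0] by simp
  moreover have "rel_poly \<Gamma> p q'" unfolding rel_poly_def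
  proof
    fix i show "(poly.coeff p i, poly.coeff q' i) \<in> \<Gamma>" using *[of "Suc i"] by simp
  qed
  then have "(poly p a, poly q' b) \<in> \<Gamma>" by (rule pCons(2))
  ultimately show ?case
    unfolding q poly_pCons by (intro partial_hom_add[OF \<Gamma>] partial_hom_mult[OF \<Gamma>] ab)
qed

lemma rel_poly_refl: "partial_hom \<Gamma> \<Longrightarrow> rat_poly p \<Longrightarrow> rel_poly \<Gamma> p p"
  by (simp add: rel_poly_def rat_poly_def partial_hom_rat)

lemma rel_poly_pCons: "(c, d) \<in> \<Gamma> \<Longrightarrow> rel_poly \<Gamma> p q \<Longrightarrow> rel_poly \<Gamma> (pCons c p) (pCons d q)"
  by (auto simp: rel_poly_def coeff_pCons split: nat.splits)

lemma rel_poly_0: "partial_hom \<Gamma> \<Longrightarrow> rel_poly \<Gamma> 0 0"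
  by (simp add: rel_poly_def partial_hom_0)

lemma rel_poly_add:
  "partial_hom \<Gamma> \<Longrightarrow> rel_poly \<Gamma> p q \<Longrightarrow> rel_poly \<Gamma> p' q' \<Longrightarrow> rel_poly \<Gamma> (p + p') (q + q')"
  by (simp add: rel_poly_def partial_hom_add)

lemma rel_poly_diff:
  "partial_hom \<Gamma> \<Longrightarrow> rel_poly \<Gamma> p q \<Longrightarrow> rel_poly \<Gamma> p' q' \<Longrightarrow> rel_poly \<Gamma> (p - p') (q - q')"
  by (simp add: rel_poly_def partial_hom_diff)

lemma rel_poly_smult:
  "partial_hom \<Gamma> \<Longrightarrow> (c, d) \<in> \<Gamma> \<Longrightarrow> rel_poly \<Gamma> p q \<Longrightarrow>
    rel_poly \<Gamma> (Polynomial.smult c p) (Polynomial.smult d q)"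
  by (simp add: rel_poly_def partial_hom_mult)

lemma rel_poly_mult:
  assumes \<Gamma>: "partial_hom \<Gamma>" and "rel_poly \<Gamma> p q" and pq': "rel_poly \<Gamma> p' q'"
  shows "rel_poly \<Gamma> (p * p') (q * q')"
proof -
  have sum: "((\<Sum>i\<in>I. f i), (\<Sum>i\<in>I. g i)) \<in> \<Gamma>" if "\<And>i. i \<in> I \<Longrightarrow> (f i, g i) \<in> \<Gamma>" for I and f g :: "nat \<Rightarrow> qbar"
    using that
    by (induction I rule: infinite_finite_induct) (auto intro: partial_hom_0 partial_hom_add \<Gamma>)
  show ?thesis
    unfolding rel_poly_def coeff_mult
    by (intro allI sum partial_hom_mult[OF \<Gamma>]) (use assms in \<open>auto simp: rel_poly_def\<close>)
qed

text \<open>A nonzero \<open>a\<close> is algebraic, so its inverse is a rational polynomial in \<open>a\<close>; this makes the domain a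
field.\<close>

lemma partial_hom_inverse:
  assumes \<Gamma>: "partial_hom \<Gamma>" and ab: "(a, b) \<in> \<Gamma>"
  shows "(inverse a, inverse b) \<in> \<Gamma>"
proof (cases "a = 0")
  case True
  then have "b = 0" using \<Gamma> ab by (simp add: partial_hom_def)
  then show ?thesis using True partial_hom_0[OF \<Gamma>] by simp
next
  case a: False
  have "\<exists>r. rat_poly r \<and> a * poly r a = 1" if "rat_poly p" "p \<noteq> 0" "poly p a = 0" for p
    using that
  proof (induction p)
    case (pCons c p)
    have p: "rat_poly p" and c: "c \<in> \<rat>"
    proof -
      show "rat_poly p" unfolding rat_poly_def
      proof
        fix i show "poly.coeff p i \<in> \<rat>"
          using pCons(3) unfolding rat_poly_def by (metis coeff_pCons_Suc)
      qed
      show "c \<in> \<rat>" using pCons(3) unfolding rat_poly_def by (metis coeff_pCons_0)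
    qed
    show ?case
    proof (cases "c = 0")
      case True
      then show ?thesis using pCons p a by auto
    next
      case False
      have "a * poly (Polynomial.smult (- inverse c) p) a = 1"
      proof -
        have "a * poly p a = - c" using pCons(5) by (simp add: add_eq_0_iff)
        then show ?thesis using False by (simp add: field_simps)
      qed
      moreover have "rat_poly (Polynomial.smult (- inverse c) p)" using p c by (simp add: rat_poly_def)
      ultimately show ?thesis by blast
    qed
  qed simp
  then obtain r where r: "rat_poly r" "a * poly r a = 1" using ex_rat_poly_root by metis
  have rr: "(poly r a, poly r b) \<in> \<Gamma>" by (rule partial_hom_poly[OF \<Gamma> ab rel_poly_refl[OF \<Gamma> r(1)]])
  have "(1, b * poly r b) \<in> \<Gamma>" using partial_hom_mult[OF \<Gamma> ab rr] r(2) by simp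
  then have "b * poly r b = 1" using partial_hom_unique[OF \<Gamma> partial_hom_rat[OF \<Gamma>, of 1]] by auto
  then have "inverse a = poly r a" "inverse b = poly r b" using r(2) by (auto intro: inverse_unique)
  then show ?thesis using rr by simp
qed

text \<open>The minimal polynomial of \<open>z\<close> over the domain of \<open>\<Gamma>\<close>, with its image under \<open>\<Gamma>\<close>.\<close>

lemma minimal_rel_poly:
  assumes \<Gamma>: "partial_hom \<Gamma>"
  obtains m m' where "rel_poly \<Gamma> m m'" "poly.coeff m (Polynomial.degree m) = 1" "poly m z = 0"
    "\<And>p q. rel_poly \<Gamma> p q \<Longrightarrow> poly p z = 0 \<Longrightarrow> p \<noteq> 0 \<Longrightarrow> Polynomial.degree m \<le> Polynomial.degree p"
proof -
  let ?C = "\<lambda>p. (\<exists>q. rel_poly \<Gamma> p q) \<and> poly p z = 0 \<and> p \<noteq> 0"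
  obtain p0 where "rat_poly p0" "p0 \<noteq> 0" "poly p0 z = 0" using ex_rat_poly_root by metis
  then have "?C p0" using rel_poly_refl[OF \<Gamma>] by blast
  then obtain p where p: "?C p" "\<And>r. ?C r \<Longrightarrow> Polynomial.degree p \<le> Polynomial.degree r"
    using ex_has_least_nat[of ?C p0 Polynomial.degree] by blast
  then obtain q where q: "rel_poly \<Gamma> p q" by blast
  let ?n = "Polynomial.degree p"
  let ?c = "inverse (poly.coeff p ?n)" and ?d = "inverse (poly.coeff q ?n)"
  have cd: "(?c, ?d) \<in> \<Gamma>" using q by (intro partial_hom_inverse[OF \<Gamma>]) (simp add: rel_poly_def)
  have c: "?c \<noteq> 0" using p(1) by simp
  show ?thesis
  proof (rule that)
    show "rel_poly \<Gamma> (Polynomial.smult ?c p) (Polynomial.smult ?d q)" by (rule rel_poly_smult[OF \<Gamma> cd q])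
  qed (use p c in auto)
qed

text \<open>Division by the minimal polynomial \<open>m\<close> can be carried out in parallel on both sides of the
homomorphism. So each polynomial that vanishes at \<open>z\<close> has an image that vanishes at the root \<open>w\<close> of
the image of \<open>m\<close>, and \<open>z \<mapsto> w\<close> is consistent.\<close>

lemma rel_poly_vanish:
  assumes \<Gamma>: "partial_hom \<Gamma>" and m: "rel_poly \<Gamma> m m'" "poly.coeff m (Polynomial.degree m) = 1" "poly m z = 0"
    and min: "\<And>p q. rel_poly \<Gamma> p q \<Longrightarrow> poly p z = 0 \<Longrightarrow> p \<noteq> 0 \<Longrightarrow> Polynomial.degree m \<le> Polynomial.degree p"
    and w: "poly m' w = 0"
    and pq: "rel_poly \<Gamma> p q" "poly p z = 0"
  shows "poly q w = 0"
  using pq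
proof (induction "Polynomial.degree p" arbitrary: p q rule: less_induct)
  case less
  show ?case
  proof (cases "p = 0")
    case True
    then have "poly.coeff q i = 0" for i using \<Gamma> less(2) by (simp add: rel_poly_def partial_hom_def)
    then have "q = 0" by (simp add: poly_eq_iff)
    then show ?thesis by simp
  next
    case False
    let ?n = "Polynomial.degree p" and ?k = "Polynomial.degree p - Polynomial.degree m"
    let ?c = "poly.coeff p ?n" and ?d = "poly.coeff q ?n"
    let ?x = "Polynomial.monom (1 :: qbar) ?k"
    let ?p = "p - Polynomial.smult ?c (?x * m)" and ?q = "q - Polynomial.smult ?d (?x * m')"
    have deg: "Polynomial.degree m \<le> ?n" by (rule min[OF less(2,3) False])
    have x: "rel_poly \<Gamma> ?x ?x" using \<Gamma> by (intro rel_poly_refl) (auto simp: rat_poly_def)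
    have rel: "rel_poly \<Gamma> ?p ?q"
      using less(2) by (intro rel_poly_diff rel_poly_smult rel_poly_mult \<Gamma> x m) (simp_all add: rel_poly_def)
    have z: "poly ?p z = 0" using less(3) m(3) by simp
    have "m \<noteq> 0" using m(2) by auto
    have "Polynomial.degree ?p \<le> ?n"
    proof (rule Polynomial.degree_diff_le[OF order.refl])
      show "Polynomial.degree (Polynomial.smult ?c (?x * m)) \<le> ?n"
        using deg \<open>m \<noteq> 0\<close> by (intro order.trans[OF degree_smult_le]) (simp add: degree_mult_eq degree_monom_eq)
    qed
    moreover have "poly.coeff ?p ?n = 0" using deg m(2) by (simp add: coeff_monom_mult)
    ultimately consider "?p = 0" | "Polynomial.degree ?p < ?n" using eq_zero_or_degree_less by blast
    then have "poly ?q w = 0"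
    proof cases
      case 1
      then have "poly.coeff ?q i = 0" for i using \<Gamma> rel by (simp only: rel_poly_def partial_hom_def coeff_0)
      then have "?q = 0" by (simp only: poly_eq_iff coeff_0) simp
      then show ?thesis by (simp only: poly_0)
    qed (use less(1)[OF _ rel z] in blast)
    then show ?thesis using w by simp
  qed
qed

lemma partial_hom_adjoin:
  assumes \<Gamma>: "partial_hom \<Gamma>"
    and van: "\<And>p q. rel_poly \<Gamma> p q \<Longrightarrow> poly p z = 0 \<Longrightarrow> poly q w = 0"
  obtains \<Gamma>' where "partial_hom \<Gamma>'" "\<Gamma> \<subseteq> \<Gamma>'" "(z, w) \<in> \<Gamma>'"
proof -
  define \<Gamma>' where "\<Gamma>' = {(poly p z, poly q w) | p q. rel_poly \<Gamma> p q}"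
  have const: "(a, b) \<in> \<Gamma>'" if "(a, b) \<in> \<Gamma>" for a b
  proof -
    have "rel_poly \<Gamma> [:a:] [:b:]" by (intro rel_poly_pCons rel_poly_0 \<Gamma> that)
    moreover have "poly [:a:] z = a" "poly [:b:] w = b" by simp_all
    ultimately show ?thesis unfolding \<Gamma>'_def by (metis (mono_tags, lifting) mem_Collect_eq)
  qed
  have "partial_hom \<Gamma>'"
    unfolding partial_hom_def
  proof (intro conjI ballI allI impI)
    show "(r, r) \<in> \<Gamma>'" if "r \<in> \<rat>" for r using const partial_hom_rat[OF \<Gamma> that] by blast
  next
    fix a b c d assume "(a, b) \<in> \<Gamma>'" "(c, d) \<in> \<Gamma>'"
    then obtain p q p' q' where *: "rel_poly \<Gamma> p q" "rel_poly \<Gamma> p' q'"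
        "a = poly p z" "b = poly q w" "c = poly p' z" "d = poly q' w"
      unfolding \<Gamma>'_def by blast
    have "a + c = poly (p + p') z" "b + d = poly (q + q') w"
      "a * c = poly (p * p') z" "b * d = poly (q * q') w" using * by simp_all
    then show "(a + c, b + d) \<in> \<Gamma>'" "(a * c, b * d) \<in> \<Gamma>'"
      unfolding \<Gamma>'_def using rel_poly_add[OF \<Gamma> *(1,2)] rel_poly_mult[OF \<Gamma> *(1,2)] by blast+
  next
    fix b assume "(0, b) \<in> \<Gamma>'"
    then obtain p q where "rel_poly \<Gamma> p q" "poly p z = 0" "b = poly q w" unfolding \<Gamma>'_def by auto
    then show "b = 0" using van by blast
  qed
  moreover have "(z, w) \<in> \<Gamma>'"
  proof -
    have "rel_poly \<Gamma> [:0, 1:] [:0, 1:]"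
      by (intro rel_poly_pCons rel_poly_0 \<Gamma> partial_hom_rat) auto
    moreover have "poly [:0, 1:] z = z" "poly [:0, 1:] w = w" by simp_all
    ultimately show ?thesis unfolding \<Gamma>'_def by (metis (mono_tags, lifting) mem_Collect_eq)
  qed
  moreover have "\<Gamma> \<subseteq> \<Gamma>'" using const by (auto intro: subrelI)
  ultimately show ?thesis using that by blast
qed

definition field_aut :: "(qbar \<Rightarrow> qbar) \<Rightarrow> bool"
  where "field_aut \<sigma> \<longleftrightarrow> bij \<sigma> \<and> \<sigma> 1 = 1 \<and>
    (\<forall>x y. \<sigma> (x + y) = \<sigma> x + \<sigma> y) \<and> (\<forall>x y. \<sigma> (x * y) = \<sigma> x * \<sigma> y)"

lemma partial_hom_extend_total:
  assumes "partial_hom \<Gamma>0"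
  obtains \<Gamma> where "partial_hom \<Gamma>" "\<Gamma>0 \<subseteq> \<Gamma>" "\<And>z. \<exists>w. (z, w) \<in> \<Gamma>"
proof -
  let ?F = "{\<Gamma>. partial_hom \<Gamma> \<and> \<Gamma>0 \<subseteq> \<Gamma>}"
  have "\<exists>M\<in>?F. \<forall>\<Delta>\<in>?F. M \<subseteq> \<Delta> \<longrightarrow> \<Delta> = M"
  proof (rule subset_Zorn_nonempty)
    show "?F \<noteq> {}" using assms by blast
    fix C assume C: "C \<noteq> {}" "subset.chain ?F C"
    have C': "partial_hom \<Gamma>" "\<Gamma>0 \<subseteq> \<Gamma>" if "\<Gamma> \<in> C" for \<Gamma>
      using that C(2) unfolding subset.chain_def by blast+
    have "partial_hom (\<Union>C)"
      unfolding partial_hom_def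
    proof (intro conjI ballI allI impI)
      show "(r, r) \<in> \<Union>C" if "r \<in> \<rat>" for r using C(1) partial_hom_rat[OF C'(1) that] by blast
    next
      fix a b c d assume "(a, b) \<in> \<Union>C" "(c, d) \<in> \<Union>C"
      then obtain \<Gamma> \<Delta> where gd: "\<Gamma> \<in> C" "\<Delta> \<in> C" "(a, b) \<in> \<Gamma>" "(c, d) \<in> \<Delta>" by blast
      then have "\<Gamma> \<subseteq> \<Delta> \<or> \<Delta> \<subseteq> \<Gamma>" using C(2) unfolding subset_chain_def by blast
      then obtain \<Theta> where "\<Theta> \<in> C" "(a, b) \<in> \<Theta>" "(c, d) \<in> \<Theta>" using gd by blast
      then show "(a + c, b + d) \<in> \<Union>C" "(a * c, b * d) \<in> \<Union>C"
        using partial_hom_add[OF C'(1)] partial_hom_mult[OF C'(1)] by blast+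
    next
      show "b = 0" if "(0, b) \<in> \<Union>C" for b using that C'(1) by (auto simp: partial_hom_def)
    qed
    then show "\<Union>C \<in> ?F" using C(1) C'(2) by blast
  qed
  then obtain \<Gamma> where F: "\<Gamma> \<in> ?F" and max: "\<forall>\<Delta>\<in>?F. \<Gamma> \<subseteq> \<Delta> \<longrightarrow> \<Delta> = \<Gamma>" by (rule bexE)
  from F have \<Gamma>: "partial_hom \<Gamma>" "\<Gamma>0 \<subseteq> \<Gamma>" by simp_all
  have "\<exists>w. (z, w) \<in> \<Gamma>" for z
  proof -
    obtain m m' where m: "rel_poly \<Gamma> m m'" "poly.coeff m (Polynomial.degree m) = 1" "poly m z = 0"
        "\<And>p q. rel_poly \<Gamma> p q \<Longrightarrow> poly p z = 0 \<Longrightarrow> p \<noteq> 0 \<Longrightarrow> Polynomial.degree m \<le> Polynomial.degree p"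
      using minimal_rel_poly[OF \<Gamma>(1)] by metis
    have "poly.coeff m' (Polynomial.degree m) = 1"
      using m(1,2) partial_hom_unique[OF \<Gamma>(1) _ partial_hom_rat[OF \<Gamma>(1), of 1]]
      unfolding rel_poly_def by (metis Rats_1)
    moreover have "Polynomial.degree m > 0"
    proof (rule ccontr)
      assume "\<not> Polynomial.degree m > 0"
      then obtain c where "m = [:c:]" using degree_eq_zeroE by blast
      then show False using m(2,3) by simp
    qed
    ultimately have "Polynomial.degree m' > 0"
      using le_degree[of m' "Polynomial.degree m"] by auto
    then obtain w where w: "poly m' w = 0" using alg_closed_imp_poly_has_root by blast
    obtain \<Delta> where "partial_hom \<Delta>" "\<Gamma> \<subseteq> \<Delta>" "(z, w) \<in> \<Delta>"
      by (rule partial_hom_adjoin[OF \<Gamma>(1) rel_poly_vanish[OF \<Gamma>(1) m w]])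
    moreover from this have "\<Delta> = \<Gamma>" using max \<Gamma>(2) by simp
    ultimately show ?thesis by blast
  qed
  with \<Gamma>(1,2) that show ?thesis by blast
qed

lemma poly_hom_root:
  fixes \<sigma> :: "qbar \<Rightarrow> qbar"
  assumes add: "\<And>x y. \<sigma> (x + y) = \<sigma> x + \<sigma> y" and mult: "\<And>x y. \<sigma> (x * y) = \<sigma> x * \<sigma> y"
  shows "\<sigma> (poly p x) = poly (map_poly \<sigma> p) (\<sigma> x)"
proof -
  have "\<sigma> 0 = 0" using add[of 0 0] by simp
  then show ?thesis by (induction p) (simp_all add: map_poly_pCons add mult)
qed

text \<open>Surjectivity holds because an injective homomorphism permutes the finitely many roots of a rational
polynomial.\<close>

lemma partial_hom_extend:
  assumes "partial_hom \<Gamma>0"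
  obtains \<sigma> where "field_aut \<sigma>" "\<And>a b. (a, b) \<in> \<Gamma>0 \<Longrightarrow> \<sigma> a = b"
proof -
  obtain \<Gamma> where \<Gamma>: "partial_hom \<Gamma>" "\<Gamma>0 \<subseteq> \<Gamma>" "\<And>z. \<exists>w. (z, w) \<in> \<Gamma>"
    using partial_hom_extend_total[OF assms] by metis
  obtain \<sigma> where s: "\<And>z. (z, \<sigma> z) \<in> \<Gamma>" using \<Gamma>(3) by metis
  have eq: "\<sigma> a = b" if "(a, b) \<in> \<Gamma>" for a b using partial_hom_unique[OF \<Gamma>(1) s that] .
  have add: "\<sigma> (x + y) = \<sigma> x + \<sigma> y" and mult: "\<sigma> (x * y) = \<sigma> x * \<sigma> y" for x y
    by (rule eq, intro partial_hom_add partial_hom_mult \<Gamma> s)+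
  have rat: "\<sigma> r = r" if "r \<in> \<rat>" for r by (rule eq[OF partial_hom_rat[OF \<Gamma>(1) that]])
  have inj: "inj \<sigma>"
  proof (rule injI)
    fix x y assume e: "\<sigma> x = \<sigma> y"
    have i: "(inverse (x - y), inverse (\<sigma> x - \<sigma> y)) \<in> \<Gamma>"
      by (intro partial_hom_inverse partial_hom_diff \<Gamma> s)
    have "((x - y) * inverse (x - y), (\<sigma> x - \<sigma> y) * inverse (\<sigma> x - \<sigma> y)) \<in> \<Gamma>"
      by (intro partial_hom_mult partial_hom_diff \<Gamma> s i)
    then have *: "((x - y) * inverse (x - y), 0) \<in> \<Gamma>" using e by simp
    show "x = y"
    proof (rule ccontr)
      assume "x \<noteq> y"
      then have "(1, 0) \<in> \<Gamma>" using * by simp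
      from partial_hom_unique[OF \<Gamma>(1) this partial_hom_rat[OF \<Gamma>(1), of 1]] show False by simp
    qed
  qed
  have "\<exists>x. \<sigma> x = y" for y
  proof -
    obtain p where p: "rat_poly p" "p \<noteq> 0" "poly p y = 0" using ex_rat_poly_root by metis
    let ?R = "{x. poly p x = 0}"
    have "map_poly \<sigma> p = p" using p(1) rat[of 0] by (simp add: poly_eq_iff coeff_map_poly rat_poly_def rat)
    then have ev: "\<sigma> (poly p x) = poly p (\<sigma> x)" for x using poly_hom_root[of \<sigma> p x, OF add mult] by simp
    have "\<sigma> ` ?R \<subseteq> ?R"
    proof (intro image_subsetI CollectI)
      fix x assume "x \<in> ?R"
      then show "poly p (\<sigma> x) = 0" using ev[of x] rat[of 0] by simp
    qed
    moreover have "card (\<sigma> ` ?R) = card ?R" by (rule card_image) (rule inj_on_subset[OF inj subset_UNIV])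
    ultimately have "\<sigma> ` ?R = ?R" by (intro card_subset_eq poly_roots_finite[OF p(2)])
    then have "y \<in> \<sigma> ` ?R" using p(3) by simp
    then show ?thesis by blast
  qed
  then have "surj \<sigma>" unfolding surj_def by metis
  then have "field_aut \<sigma>" using inj add mult rat[of 1] by (simp add: field_aut_def bij_def)
  then show ?thesis using that eq \<Gamma>(2) by blast
qed

section \<open>Automorphisms of the field of algebraic numbers\<close>

text \<open>The minimal polynomial \<open>m = (X - x) g\<close> of an irrational \<open>x\<close> has a root \<open>w\<close> other than \<open>x\<close>: a root of \<open>g\<close>
will do, because \<open>g\<close> does not vanish at \<open>x\<close>, as otherwise the derivative of \<open>m\<close> would be a rational
polynomial of smaller degree with root \<open>x\<close>. Then \<open>x \<mapsto> w\<close> extends to an automorphism.\<close>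

lemma ex_field_aut_moving:
  assumes "x \<notin> \<rat>" obtains \<sigma> where "field_aut \<sigma>" "\<sigma> x \<noteq> x"
proof -
  define \<Gamma> where "\<Gamma> = (\<lambda>r. (r, r)) ` (\<rat> :: qbar set)"
  have \<Gamma>: "partial_hom \<Gamma>" by (auto simp: \<Gamma>_def partial_hom_def)
  have rel: "rel_poly \<Gamma> p q \<longleftrightarrow> rat_poly p \<and> p = q" for p q
    by (auto simp: rel_poly_def \<Gamma>_def rat_poly_def poly_eq_iff image_iff)
  obtain m where m: "rat_poly m" "poly.coeff m (Polynomial.degree m) = 1" "poly m x = 0"
      "\<And>p q. rel_poly \<Gamma> p q \<Longrightarrow> poly p x = 0 \<Longrightarrow> p \<noteq> 0 \<Longrightarrow> Polynomial.degree m \<le> Polynomial.degree p"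
    using minimal_rel_poly[OF \<Gamma>] rel by metis
  have m0: "m \<noteq> 0" using m(2) by auto
  obtain g where g: "m = [:-x, 1:] * g" using m(3) poly_eq_0_iff_dvd by (metis dvdE)
  have g0: "g \<noteq> 0" using g m0 by auto
  have deg: "Polynomial.degree m = Suc (Polynomial.degree g)"
    unfolding g using g0 by (subst degree_mult_eq) auto
  have "Polynomial.degree g > 0"
  proof (rule ccontr)
    assume "\<not> Polynomial.degree g > 0"
    then obtain c where "g = [:c:]" using degree_eq_zeroE by blast
    then have "m = [:-x * c, c:]" "c = 1" using g m(2) deg by simp_all
    then have "- x \<in> \<rat>" using m(1) unfolding rat_poly_def by (metis coeff_pCons_0 mult.right_neutral)
    then show False using assms by simp
  qed
  then obtain w where w: "poly g w = 0" using alg_closed_imp_poly_has_root by blast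
  have "w \<noteq> x"
  proof
    assume "w = x"
    then have "poly (Polynomial.pderiv m) x = 0"
      using w unfolding g pderiv_mult by (simp del: mult_pCons_left)
    moreover have "rat_poly (Polynomial.pderiv m)" using m(1) by (simp add: rat_poly_def coeff_pderiv)
    moreover have "Polynomial.pderiv m \<noteq> 0" using deg by (simp add: pderiv_eq_0_iff)
    ultimately have "Polynomial.degree m \<le> Polynomial.degree (Polynomial.pderiv m)" using m(4) rel by blast
    then show False using deg by (simp add: degree_pderiv)
  qed
  have mw: "poly m w = 0" using w by (simp add: g)
  have relm: "rel_poly \<Gamma> m m" using rel m(1) by blast
  obtain \<Gamma>' where "partial_hom \<Gamma>'" "(x, w) \<in> \<Gamma>'"
    by (rule partial_hom_adjoin[OF \<Gamma> rel_poly_vanish[OF \<Gamma> relm m(2,3,4) mw]])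
  then obtain \<sigma> where "field_aut \<sigma>" "\<sigma> x = w" using partial_hom_extend by blast
  then show ?thesis using that \<open>w \<noteq> x\<close> by metis
qed

section \<open>The absolute Galois group\<close>

lemma qbar_ring_simps [simp]:
  "carrier (qbar_ring E) = E" "monoid.mult (qbar_ring E) = (*)" "monoid.one (qbar_ring E) = 1"
  "ring.zero (qbar_ring E) = 0" "ring.add (qbar_ring E) = (+)"
  by (simp_all add: qbar_ring_def ring_of_type_algebra_def)

lemma qbar_ring_UNIV: "qbar_ring UNIV = ring_of_type_algebra"
  by (simp add: qbar_ring_def ring_of_type_algebra_def)

lemma field_qbar_ring: "field (qbar_ring UNIV)"
  unfolding qbar_ring_UNIV by (rule field_from_type_algebra)

lemma ring_qbar_ring: "ring (qbar_ring UNIV)"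
  unfolding qbar_ring_UNIV by (rule ring_from_type_algebra)

lemma field_autD:
  assumes "field_aut \<sigma>"
  shows "bij \<sigma>" "\<sigma> 1 = 1" "\<sigma> 0 = 0" "\<sigma> (x + y) = \<sigma> x + \<sigma> y" "\<sigma> (x * y) = \<sigma> x * \<sigma> y"
    "\<sigma> (- x) = - \<sigma> x" "\<sigma> (inverse x) = inverse (\<sigma> x)"
proof -
  show b: "bij \<sigma>" and 1: "\<sigma> 1 = 1" using assms by (auto simp: field_aut_def)
  have add: "\<sigma> (x + y) = \<sigma> x + \<sigma> y" and mult: "\<sigma> (x * y) = \<sigma> x * \<sigma> y" for x y
    using assms by (auto simp: field_aut_def)
  show "\<sigma> (x + y) = \<sigma> x + \<sigma> y" "\<sigma> (x * y) = \<sigma> x * \<sigma> y" by (rule add mult)+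
  show 0: "\<sigma> 0 = 0" using add[of 0 0] by simp
  show "\<sigma> (- x) = - \<sigma> x" using add[of x "- x"] 0 by (simp add: eq_neg_iff_add_eq_0 add.commute)
  show "\<sigma> (inverse x) = inverse (\<sigma> x)"
  proof (cases "x = 0")
    case False
    then have "\<sigma> x * \<sigma> (inverse x) = 1" using mult[of x "inverse x"] 1 by simp
    then show ?thesis by (metis inverse_unique)
  qed (simp add: 0)
qed

lemma field_aut_rat:
  assumes s: "field_aut \<sigma>" and "r \<in> \<rat>" shows "\<sigma> r = r"
proof -
  have nat: "\<sigma> (of_nat n) = of_nat n" for n
    by (induction n) (simp_all add: field_autD[OF s])
  have int: "\<sigma> (of_int i) = of_int i" for i
    by (cases i) (simp_all add: field_autD[OF s] nat del: of_nat_Suc)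
  obtain a b where "r = of_int a / of_int b" using assms(2) by (auto elim: Rats_cases')
  then show ?thesis by (simp add: field_class.field_divide_inverse field_autD[OF s] int)
qed

lemma field_aut_poly:
  assumes "field_aut \<sigma>" shows "\<sigma> (poly p x) = poly (map_poly \<sigma> p) (\<sigma> x)"
  using field_autD(4,5)[OF assms] by (rule poly_hom_root)

lemma field_aut_rat_poly:
  assumes "field_aut \<sigma>" "rat_poly p" shows "\<sigma> (poly p x) = poly p (\<sigma> x)"
proof -
  have "map_poly \<sigma> p = p"
    using assms field_autD(3)[OF assms(1)] field_aut_rat[OF assms(1)]
    by (simp add: poly_eq_iff coeff_map_poly rat_poly_def)
  then show ?thesis using field_aut_poly[OF assms(1), of p x] by simp
qed

lemma carrier_abs_Gal: "carrier (abs_Gal F) = {\<sigma>. field_aut \<sigma> \<and> (\<forall>x\<in>F. \<sigma> x = x)}"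
  by (auto simp: Gal_def Bij_def ring_hom_def field_aut_def)

lemma mult_abs_Gal:
  assumes "\<sigma> \<in> carrier (abs_Gal F)" "\<tau> \<in> carrier (abs_Gal F)"
  shows "\<sigma> \<otimes>\<^bsub>abs_Gal F\<^esub> \<tau> = \<sigma> \<circ> \<tau>"
proof -
  have "\<sigma> \<in> Bij UNIV" "\<tau> \<in> Bij UNIV" using assms by (auto simp: Gal_def)
  then show ?thesis by (simp add: Gal_def BijGroup_def compose_def comp_def restrict_def)
qed

lemma one_abs_Gal: "\<one>\<^bsub>abs_Gal F\<^esub> = id"
  by (simp add: Gal_def BijGroup_def id_def restrict_def)

lemma perm_group_abs_Gal: "perm_group (abs_Gal F)"
proof (intro perm_group.intro perm_group_axioms.intro mult_abs_Gal one_abs_Gal)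
  show "group (abs_Gal F)"
  proof (rule groupI)
    show "\<sigma> \<otimes>\<^bsub>abs_Gal F\<^esub> \<tau> \<in> carrier (abs_Gal F)"
      if "\<sigma> \<in> carrier (abs_Gal F)" "\<tau> \<in> carrier (abs_Gal F)" for \<sigma> \<tau>
      using that unfolding mult_abs_Gal[OF that] by (auto simp: carrier_abs_Gal field_aut_def bij_comp)
    then show "\<sigma> \<otimes>\<^bsub>abs_Gal F\<^esub> \<tau> \<otimes>\<^bsub>abs_Gal F\<^esub> \<rho> = \<sigma> \<otimes>\<^bsub>abs_Gal F\<^esub> (\<tau> \<otimes>\<^bsub>abs_Gal F\<^esub> \<rho>)"
      if "\<sigma> \<in> carrier (abs_Gal F)" "\<tau> \<in> carrier (abs_Gal F)" "\<rho> \<in> carrier (abs_Gal F)" for \<sigma> \<tau> \<rho>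
      using that mult_abs_Gal[of _ F] by (simp add: comp_assoc)
    show one: "\<one>\<^bsub>abs_Gal F\<^esub> \<in> carrier (abs_Gal F)"
      by (auto simp: one_abs_Gal carrier_abs_Gal field_aut_def)
    show "\<one>\<^bsub>abs_Gal F\<^esub> \<otimes>\<^bsub>abs_Gal F\<^esub> \<sigma> = \<sigma>" if "\<sigma> \<in> carrier (abs_Gal F)" for \<sigma>
      using mult_abs_Gal[OF one that] by (simp add: one_abs_Gal)
    show "\<exists>\<tau>\<in>carrier (abs_Gal F). \<tau> \<otimes>\<^bsub>abs_Gal F\<^esub> \<sigma> = \<one>\<^bsub>abs_Gal F\<^esub>"
      if s: "\<sigma> \<in> carrier (abs_Gal F)" for \<sigma>
    proof
      have f: "field_aut \<sigma>" and fx: "\<forall>x\<in>F. \<sigma> x = x" using s by (auto simp: carrier_abs_Gal)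
      have b: "bij \<sigma>" using f by (rule field_autD)
      have iff: "Hilbert_Choice.inv \<sigma> x = y \<longleftrightarrow> x = \<sigma> y" for x y
        using b by (metis bij_inv_eq_iff)
      have si: "\<sigma> (Hilbert_Choice.inv \<sigma> x) = x" for x using b by (simp add: bij_is_surj surj_f_inv_f)
      show t: "Hilbert_Choice.inv \<sigma> \<in> carrier (abs_Gal F)"
        using fx b by (auto simp: carrier_abs_Gal field_aut_def iff bij_imp_bij_inv field_autD[OF f] si)
      show "Hilbert_Choice.inv \<sigma> \<otimes>\<^bsub>abs_Gal F\<^esub> \<sigma> = \<one>\<^bsub>abs_Gal F\<^esub>"
        using b by (simp add: mult_abs_Gal[OF t s] one_abs_Gal bij_is_inj)
    qed
  qed
qed

interpretation A: perm_group "abs_Gal \<rat>" by (rule perm_group_abs_Gal)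

abbreviation Aut :: "(qbar \<Rightarrow> qbar) set" where "Aut \<equiv> carrier (abs_Gal \<rat>)"

lemma Aut_iff: "\<sigma> \<in> Aut \<longleftrightarrow> field_aut \<sigma>"
  using field_aut_rat by (auto simp: carrier_abs_Gal)

lemma abs_Gal_fixator: "carrier (abs_Gal F) = fixator Aut F"
  by (auto simp: fixator_def Aut_iff) (auto simp: carrier_abs_Gal)

lemma subgroup_abs_Gal: "subgroup (carrier (abs_Gal F)) (abs_Gal \<rat>)"
  by (subst abs_Gal_fixator) (rule A.fixator_subgroup[OF A.subgroup_self])

lemma finite_orbit_Aut: "finite (orbit_of Aut x)"
proof -
  obtain p where p: "rat_poly p" "p \<noteq> 0" "poly p x = 0" using ex_rat_poly_root by metis
  have "orbit_of Aut x \<subseteq> {y. poly p y = 0}"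
    using field_aut_rat_poly[OF _ p(1), of _ x] p(3) field_autD(3)
    by (auto simp: orbit_of_def Aut_iff)
  then show ?thesis using poly_roots_finite[OF p(2)] by (rule finite_subset)
qed

lemma rat_if_fixed:
  assumes "\<And>\<sigma>. \<sigma> \<in> Aut \<Longrightarrow> \<sigma> x = x" shows "x \<in> \<rat>"
  using assms ex_field_aut_moving[of x] by (metis Aut_iff)

section \<open>Interpolation and primitive elements\<close>

lemma ex_interpolating_poly:
  fixes f :: "'a :: field \<Rightarrow> 'a"
  assumes "finite S" obtains p where "Polynomial.degree p \<le> card S - 1" "\<And>x. x \<in> S \<Longrightarrow> poly p x = f x"
proof -
  have "\<exists>p. Polynomial.degree p \<le> card S - 1 \<and> (\<forall>x\<in>S. poly p x = f x)" using assms
  proof (induction S)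
    case (insert y S)
    then obtain p where p: "Polynomial.degree p \<le> card S - 1" "\<forall>x\<in>S. poly p x = f x" by blast
    let ?\<Pi> = "\<Prod>x\<in>S. [:-x, 1:]"
    let ?p = "p + Polynomial.smult ((f y - poly p y) / poly ?\<Pi> y) ?\<Pi>"
    have "poly ?\<Pi> y \<noteq> 0" using insert by (auto simp: poly_prod)
    moreover have "poly ?\<Pi> x = 0" if "x \<in> S" for x using insert that by (auto simp: poly_prod)
    moreover have "Polynomial.degree ?\<Pi> = card S" by (subst degree_prod_sum_eq) auto
    then have "Polynomial.degree ?p \<le> card S"
      using p(1) by (intro degree_add_le order.trans[OF degree_smult_le]) auto
    ultimately show ?case using p(2) insert by (intro exI[of _ ?p]) auto
  qed (auto intro: exI[of _ 0])
  then show ?thesis using that by blast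
qed

text \<open>This says that \<open>x\<close> lies in \<open>\<rat>(\<psi>)\<close>. By hypothesis \<open>\<sigma> x\<close> depends only on \<open>\<sigma> \<psi>\<close>, so there is a
polynomial \<open>p\<close> of degree less than the number of conjugates of \<open>\<psi>\<close> with \<open>p (\<sigma> \<psi>) = \<sigma> x\<close> for all
\<open>\<sigma>\<close>. Applying an automorphism to its coefficients gives a polynomial with the same property, hence
\<open>p\<close> itself, so the coefficients are fixed by all automorphisms.\<close>

lemma fixed_imp_rat_poly:
  assumes stab: "\<And>\<sigma>. \<sigma> \<in> Aut \<Longrightarrow> \<sigma> \<psi> = \<psi> \<Longrightarrow> \<sigma> x = x"
  obtains p where "rat_poly p" "Polynomial.degree p < card (orbit_of Aut \<psi>)" "poly p \<psi> = x"
proof -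
  let ?O = "orbit_of Aut \<psi>"
  have O: "\<psi> \<in> ?O" "finite ?O" by (auto intro: A.orbit_self A.subgroup_self finite_orbit_Aut)
  then have cO: "card ?O > 0" by (auto simp: card_gt_0_iff)
  have wd: "\<sigma> x = \<tau> x" if "\<sigma> \<in> Aut" "\<tau> \<in> Aut" "\<sigma> \<psi> = \<tau> \<psi>" for \<sigma> \<tau>
  proof -
    have "inv\<^bsub>abs_Gal \<rat>\<^esub> \<sigma> \<circ> \<tau> \<in> Aut" using A.subgroup_comp[OF A.subgroup_self] that by simp
    moreover have "(inv\<^bsub>abs_Gal \<rat>\<^esub> \<sigma> \<circ> \<tau>) \<psi> = \<psi>" using that by (simp add: A.inv_apply_eq_iff)
    ultimately have "(inv\<^bsub>abs_Gal \<rat>\<^esub> \<sigma> \<circ> \<tau>) x = x" by (rule stab)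
    then show ?thesis using that by (simp add: A.inv_apply_eq_iff)
  qed
  \<comment> \<open>\<open>f\<close> maps \<open>\<sigma> \<psi>\<close> to \<open>\<sigma> x\<close>\<close>
  define f where "f y = (SOME \<sigma>. \<sigma> \<in> Aut \<and> \<sigma> \<psi> = y) x" for y
  have f: "f (\<sigma> \<psi>) = \<sigma> x" if "\<sigma> \<in> Aut" for \<sigma>
  proof -
    have "\<exists>\<tau>. \<tau> \<in> Aut \<and> \<tau> \<psi> = \<sigma> \<psi>" using that by blast
    from someI_ex[OF this] show ?thesis unfolding f_def using wd that by blast
  qed
  obtain p where p: "Polynomial.degree p \<le> card ?O - 1" "\<And>y. y \<in> ?O \<Longrightarrow> poly p y = f y"
    using ex_interpolating_poly[OF O(2)] by metis
  then have deg: "Polynomial.degree p < card ?O" using cO by linarith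
  have "map_poly \<tau> p = p" if t: "\<tau> \<in> Aut" for \<tau>
  proof (rule poly_eqI_degree[of ?O])
    have ta: "field_aut \<tau>" using t Aut_iff by blast
    fix y assume "y \<in> ?O"
    then have "(inv\<^bsub>abs_Gal \<rat>\<^esub> \<tau>) y \<in> ?O"
      using A.orbit_invariant[OF A.subgroup_self, of \<psi>] t by (auto simp: invariant_def)
    then obtain \<sigma> where s: "\<sigma> \<in> Aut" "(inv\<^bsub>abs_Gal \<rat>\<^esub> \<tau>) y = \<sigma> \<psi>" by (auto simp: orbit_of_def)
    then have y: "y = \<tau> (\<sigma> \<psi>)" using t by (simp add: A.inv_apply_eq_iff)
    have ts: "\<tau> \<circ> \<sigma> \<in> Aut" by (rule A.subgroup_comp[OF A.subgroup_self t s(1)])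
    have "poly (map_poly \<tau> p) y = \<tau> (poly p (\<sigma> \<psi>))" unfolding y by (rule field_aut_poly[OF ta, symmetric])
    also have "poly p (\<sigma> \<psi>) = \<sigma> x" using p(2)[of "\<sigma> \<psi>"] f[OF s(1)] s(1) by (auto simp: orbit_of_def)
    also have "\<tau> (\<sigma> x) = f y" using f[OF ts] y by simp
    also have "\<dots> = poly p y" using p(2) \<open>y \<in> ?O\<close> by simp
    finally show "poly (map_poly \<tau> p) y = poly p y" .
  next
    have "Polynomial.degree (map_poly \<tau> p) \<le> Polynomial.degree p"
      using t field_autD(3)[of \<tau>]
      by (intro degree_le) (auto simp: Aut_iff coeff_map_poly coeff_eq_0)
    then show "Polynomial.degree (map_poly \<tau> p) < card ?O" using deg by linarith
  qed (rule deg)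
  then have "\<tau> (poly.coeff p i) = poly.coeff p i" if "\<tau> \<in> Aut" for \<tau> i
    using that field_autD(3)[of \<tau>] Aut_iff coeff_map_poly[of \<tau> p i] by metis
  then have "rat_poly p" unfolding rat_poly_def using rat_if_fixed by blast
  moreover have "poly p \<psi> = x" using p(2)[OF O(1)] f[of id] A.subgroup_id[OF A.subgroup_self] by simp
  ultimately show ?thesis using that deg by blast
qed

lemma subfield_qbarD:
  assumes "subfield_qbar E"
  shows "0 \<in> E" "1 \<in> E" "x \<in> E \<Longrightarrow> y \<in> E \<Longrightarrow> x + y \<in> E" "x \<in> E \<Longrightarrow> y \<in> E \<Longrightarrow> x * y \<in> E"
    "x \<in> E \<Longrightarrow> - x \<in> E" "x \<in> E \<Longrightarrow> inverse x \<in> E" "\<rat> \<subseteq> E" "rat_poly p \<Longrightarrow> x \<in> E \<Longrightarrow> poly p x \<in> E"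
proof -
  interpret R: field "qbar_ring UNIV" by (rule field_qbar_ring)
  have sr: "subring E (qbar_ring UNIV)" 
    using subcring.axioms(1)[OF subdomain.axioms(1)[OF subfield.axioms(1)[OF assms]]] .
  show 0: "0 \<in> E" and 1: "1 \<in> E" and add: "\<And>x y. x \<in> E \<Longrightarrow> y \<in> E \<Longrightarrow> x + y \<in> E"
    and mult: "\<And>x y. x \<in> E \<Longrightarrow> y \<in> E \<Longrightarrow> x * y \<in> E"
    using subringE[OF sr] by auto
  have neg: "- x \<in> E" if "x \<in> E" for x
  proof -
    have "\<ominus>\<^bsub>qbar_ring UNIV\<^esub> x = - x" by (rule R.minus_equality) auto
    then show ?thesis using subringE(5)[OF sr that] by simp
  qed
  then show "x \<in> E \<Longrightarrow> - x \<in> E" .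
  have inv: "inverse x \<in> E" if "x \<in> E" for x
  proof (cases "x = 0")
    case False
    then have "inv\<^bsub>qbar_ring UNIV\<^esub> x = inverse x" by (intro R.comm_inv_char) auto
    moreover have "inv\<^bsub>qbar_ring UNIV\<^esub> x \<in> E" using R.subfield_m_inv(1)[OF assms] that False by auto
    ultimately show ?thesis by simp
  qed (simp add: 0)
  then show "x \<in> E \<Longrightarrow> inverse x \<in> E" .
  have nat: "of_nat n \<in> E" for n by (induction n) (auto intro: 0 1 add)
  have int: "of_int i \<in> E" for i by (cases i) (auto intro!: nat neg 1 add simp del: of_nat_Suc)
  have rat: "r \<in> E" if "r \<in> \<rat>" for r
    using that by (auto elim!: Rats_cases' simp: field_class.field_divide_inverse intro!: mult inv int)
  then show "\<rat> \<subseteq> E" by blast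
  show "poly p x \<in> E" if "rat_poly p" "x \<in> E"
    using that(1)
  proof (induction p)
    case (pCons c p)
    have "c \<in> \<rat>" "rat_poly p"
      using pCons(3) unfolding rat_poly_def by (metis coeff_pCons_0, metis coeff_pCons_Suc)
    then show ?case using pCons(2) by (simp add: add mult that(2) rat)
  qed (simp add: 0)
qed

lemma subfield_qbarI:
  assumes "1 \<in> E" "\<And>x y. x \<in> E \<Longrightarrow> y \<in> E \<Longrightarrow> x + y \<in> E" "\<And>x y. x \<in> E \<Longrightarrow> y \<in> E \<Longrightarrow> x * y \<in> E"
    "\<And>x. x \<in> E \<Longrightarrow> - x \<in> E" "\<And>x. x \<in> E \<Longrightarrow> inverse x \<in> E"
  shows "subfield_qbar E"
proof -
  interpret R: field "qbar_ring UNIV" by (rule field_qbar_ring)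
  show ?thesis
  proof (rule R.subfieldI'[OF R.subringI])
    show "\<ominus>\<^bsub>qbar_ring UNIV\<^esub> x \<in> E" if "x \<in> E" for x
    proof -
      have "\<ominus>\<^bsub>qbar_ring UNIV\<^esub> x = - x" by (rule R.minus_equality) auto
      then show ?thesis using assms(4)[OF that] by simp
    qed
    show "inv\<^bsub>qbar_ring UNIV\<^esub> x \<in> E" if "x \<in> E - {\<zero>\<^bsub>qbar_ring UNIV\<^esub>}" for x
    proof -
      have "inv\<^bsub>qbar_ring UNIV\<^esub> x = inverse x" using that by (intro R.comm_inv_char) auto
      then show ?thesis using assms(5) that by simp
    qed
  qed (use assms in auto)
qed

text \<open>A generic combination \<open>y + c \<psi>\<close> is fixed only by the automorphisms that fix both \<open>y\<close> and \<open>\<psi>\<close>: each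
other pair of conjugates excludes at most one value of \<open>c\<close>.\<close>

lemma ex_primitive_element:
  assumes "finite Y"
  obtains \<psi> where "\<And>E. subfield_qbar E \<Longrightarrow> Y \<subseteq> E \<Longrightarrow> \<psi> \<in> E"
    "fixator Aut {\<psi>} = fixator Aut Y"
proof -
  have "\<exists>\<psi>. (\<forall>E. subfield_qbar E \<longrightarrow> Y \<subseteq> E \<longrightarrow> \<psi> \<in> E) \<and> fixator Aut {\<psi>} = fixator Aut Y" using assms
  proof (induction Y)
    case empty
    then show ?case using subfield_qbarD(1) field_autD(3)
      by (intro exI[of _ 0]) (auto simp: fixator_def Aut_iff)
  next
    case (insert y Y)
    then obtain \<psi> where \<psi>: "\<And>E. subfield_qbar E \<Longrightarrow> Y \<subseteq> E \<Longrightarrow> \<psi> \<in> E"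
        "fixator Aut {\<psi>} = fixator Aut Y" by blast
    let ?bad = "(\<lambda>(a, b). (y - a) / (b - \<psi>)) ` (orbit_of Aut y \<times> orbit_of Aut \<psi>)"
    have "finite ?bad" by (intro finite_imageI finite_cartesian_product finite_orbit_Aut)
    moreover have "infinite (range (of_nat :: nat \<Rightarrow> qbar))" by (simp add: finite_image_iff inj_of_nat)
    ultimately obtain n :: nat where n: "of_nat n \<notin> ?bad" by (meson finite_subset image_subsetI)
    let ?c = "of_nat n :: qbar"
    let ?\<psi> = "y + ?c * \<psi>"
    have c: "?c \<in> \<rat>" by simp
    have "?\<psi> \<in> E" if "subfield_qbar E" "insert y Y \<subseteq> E" for E
      using that \<psi>(1) c subfield_qbarD(3,4,7)[OF that(1)] by (metis insert_subset subsetD)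
    moreover have "\<sigma> ?\<psi> = ?\<psi> \<longleftrightarrow> \<sigma> y = y \<and> \<sigma> \<psi> = \<psi>" if s: "\<sigma> \<in> Aut" for \<sigma>
    proof -
      have sa: "field_aut \<sigma>" using s Aut_iff by blast
      have eq: "\<sigma> ?\<psi> = \<sigma> y + ?c * \<sigma> \<psi>"
        using field_autD(4,5)[OF sa] field_aut_rat[OF sa c] by simp
      show ?thesis
      proof
        assume *: "\<sigma> ?\<psi> = ?\<psi>"
        have "\<sigma> \<psi> = \<psi>"
        proof (rule ccontr)
          assume ne: "\<sigma> \<psi> \<noteq> \<psi>"
          have "?c * (\<sigma> \<psi> - \<psi>) = y - \<sigma> y" using * eq by (simp add: algebra_simps)
          then have "?c = (y - \<sigma> y) / (\<sigma> \<psi> - \<psi>)" using ne by (simp add: nonzero_eq_divide_eq)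
          moreover have "(\<sigma> y, \<sigma> \<psi>) \<in> orbit_of Aut y \<times> orbit_of Aut \<psi>" using s by (auto simp: orbit_of_def)
          ultimately show False using n by (metis (mono_tags, lifting) case_prod_conv image_eqI)
        qed
        then show "\<sigma> y = y \<and> \<sigma> \<psi> = \<psi>" using * eq by simp
      qed (use eq in simp)
    qed
    then have "fixator Aut {?\<psi>} = fixator Aut {\<psi>} \<inter> fixator Aut {y}" by (auto simp: fixator_def)
    then have "fixator Aut {?\<psi>} = fixator Aut (insert y Y)" unfolding \<psi>(2) by (auto simp: fixator_def)
    ultimately show ?case by blast
  qed
  then show ?thesis using that by blast
qed

section \<open>Number fields\<close>

definition fixed_field :: "(qbar \<Rightarrow> qbar) set \<Rightarrow> qbar set"
  where "fixed_field V = {x. \<forall>\<sigma>\<in>V. \<sigma> x = x}"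

lemma subfield_fixed_field:
  assumes "V \<subseteq> Aut" shows "subfield_qbar (fixed_field V)"
  using assms
  by (intro subfield_qbarI) (auto simp: fixed_field_def Aut_iff subset_iff field_autD)

lemma fixed_field_eq_adjoin:
  assumes E: "subfield_qbar E" and "\<psi> \<in> E" shows "fixed_field (fixator Aut {\<psi>}) \<subseteq> E"
proof
  fix x assume "x \<in> fixed_field (fixator Aut {\<psi>})"
  then have "\<And>\<sigma>. \<sigma> \<in> Aut \<Longrightarrow> \<sigma> \<psi> = \<psi> \<Longrightarrow> \<sigma> x = x" by (auto simp: fixed_field_def fixator_def)
  then obtain p where "rat_poly p" "poly p \<psi> = x" using fixed_imp_rat_poly by metis
  then show "x \<in> E" using subfield_qbarD(8)[OF E] assms(2) by metis
qed

lemma subfield_Rats: "subfield_qbar \<rat>"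
  by (intro subfield_qbarI) auto

interpretation R: ring "qbar_ring UNIV" by (rule ring_qbar_ring)

lemma mem_Span_Cons: "x \<in> R.Span F (u # us) \<longleftrightarrow> (\<exists>k\<in>F. \<exists>v\<in>R.Span F us. x = k * u + v)"
  using R.line_extension_mem_iff[of x F u "R.Span F us"] by simp

lemma Span_Nil: "R.Span F [] = {0}"
  by simp

lemma set_subset_Span:
  assumes F: "subfield_qbar F" shows "0 \<in> R.Span F us \<and> set us \<subseteq> R.Span F us"
proof (induction us)
  case (Cons u us)
  have "v \<in> R.Span F (u # us)" if "v \<in> R.Span F us" for v
    unfolding mem_Span_Cons using subfield_qbarD(1)[OF F] that
    by (intro bexI[of _ 0] bexI[of _ v]) simp_all
  moreover have "u \<in> R.Span F (u # us)"
    unfolding mem_Span_Cons using subfield_qbarD(2)[OF F] Cons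
    by (intro bexI[of _ 1] bexI[of _ 0]) simp_all
  ultimately show ?case using Cons by auto
qed simp

lemma fixes_Span:
  assumes "\<sigma> \<in> carrier (abs_Gal F)" "\<forall>y\<in>set us. \<sigma> y = y" "x \<in> R.Span F us"
  shows "\<sigma> x = x"
  using assms(2,3)
proof (induction us arbitrary: x)
  case Nil
  then show ?case using assms(1) field_autD(3) unfolding Span_Nil by (auto simp: carrier_abs_Gal)
next
  case (Cons u us)
  then obtain k v where "k \<in> F" "v \<in> R.Span F us" "x = k * u + v" unfolding mem_Span_Cons by blast
  moreover have "\<sigma> v = v" by (rule Cons(1)) (use Cons(2) \<open>v \<in> _\<close> in auto)
  ultimately show ?case using assms(1) Cons(2) by (simp add: carrier_abs_Gal field_autD(4,5))
qed

lemma finite_ext_generators: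
  assumes F: "subfield_qbar F" and "finite_ext F E"
  obtains Y where "finite Y" "Y \<subseteq> E" "\<And>\<sigma>. \<sigma> \<in> carrier (abs_Gal F) \<Longrightarrow> \<forall>y\<in>Y. \<sigma> y = y \<Longrightarrow> \<forall>x\<in>E. \<sigma> x = x"
proof -
  obtain n where "R.dimension n F E" using assms(2) by (auto simp: finite_ext_def R.finite_dimension_def)
  then obtain us where us: "R.Span F us = E" using R.exists_base[OF F] by blast
  show ?thesis
  proof (rule that[of "set us"])
    show "set us \<subseteq> E" using set_subset_Span[OF F] us by blast
    show "\<forall>x\<in>E. \<sigma> x = x" if "\<sigma> \<in> carrier (abs_Gal F)" "\<forall>y\<in>set us. \<sigma> y = y" for \<sigma>
      using fixes_Span[OF that] us by blast
  qed simp
qed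

definition powers :: "qbar \<Rightarrow> nat \<Rightarrow> qbar list"
  where "powers \<psi> m = map (\<lambda>i. \<psi> ^ i) (rev [0..<m])"

lemma powers_Suc: "powers \<psi> (Suc m) = \<psi> ^ m # powers \<psi> m"
  by (simp add: powers_def)

lemma length_powers: "length (powers \<psi> m) = m"
  by (simp add: powers_def)

lemma Span_powers:
  assumes F: "subfield_qbar F"
  shows "x \<in> R.Span F (powers \<psi> m) \<longleftrightarrow> (\<exists>c. (\<forall>i. c i \<in> F) \<and> x = (\<Sum>i<m. c i * \<psi> ^ i))"
proof (induction m arbitrary: x)
  case 0
  have "powers \<psi> 0 = []" by (simp add: powers_def)
  then show ?case using subfield_qbarD(1)[OF F] by auto
next
  case (Suc m)
  show ?case unfolding powers_Suc mem_Span_Cons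
  proof
    assume "\<exists>k\<in>F. \<exists>v\<in>R.Span F (powers \<psi> m). x = k * \<psi> ^ m + v"
    then obtain k v where k: "k \<in> F" "v \<in> R.Span F (powers \<psi> m)" "x = k * \<psi> ^ m + v" by blast
    moreover obtain c where "\<forall>i. c i \<in> F" "v = (\<Sum>i<m. c i * \<psi> ^ i)" using k(2) unfolding Suc by blast
    ultimately have "k \<in> F" "\<forall>i. c i \<in> F" "x = k * \<psi> ^ m + (\<Sum>i<m. c i * \<psi> ^ i)" by simp_all
    then show "\<exists>c. (\<forall>i. c i \<in> F) \<and> x = (\<Sum>i<Suc m. c i * \<psi> ^ i)"
      by (intro exI[of _ "c(m := k)"]) simp
  next
    assume "\<exists>c. (\<forall>i. c i \<in> F) \<and> x = (\<Sum>i<Suc m. c i * \<psi> ^ i)"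
    then obtain c where c: "\<forall>i. c i \<in> F" "x = c m * \<psi> ^ m + (\<Sum>i<m. c i * \<psi> ^ i)" by auto
    moreover have "(\<Sum>i<m. c i * \<psi> ^ i) \<in> R.Span F (powers \<psi> m)" unfolding Suc using c(1) by blast
    ultimately show "\<exists>k\<in>F. \<exists>v\<in>R.Span F (powers \<psi> m). x = k * \<psi> ^ m + v" by blast
  qed
qed

lemma poly_eq_sum_lessThan:
  fixes x :: qbar
  assumes "Polynomial.degree p < n" shows "poly p x = (\<Sum>i<n. poly.coeff p i * x ^ i)"
  unfolding poly_altdef using assms
  by (intro sum.mono_neutral_left) (auto simp: coeff_eq_0)

text \<open>The fixed field of the stabilizer of \<open>\<psi>\<close> is \<open>\<rat>(\<psi>)\<close>, which is spanned by powers of \<open>\<psi>\<close>.\<close>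

lemma finite_ext_fixed_field:
  assumes F: "subfield_qbar F" and FE: "F \<subseteq> fixed_field (fixator Aut {\<psi>})"
  shows "finite_ext F (fixed_field (fixator Aut {\<psi>}))"
proof -
  let ?E = "fixed_field (fixator Aut {\<psi>})" and ?n = "card (orbit_of Aut \<psi>)"
  have E: "subfield_qbar ?E" by (rule subfield_fixed_field) (auto simp: fixator_def)
  have \<psi>: "\<psi> ^ i \<in> ?E" for i
  proof (induction i)
    case (Suc i)
    have "\<psi> \<in> ?E" by (auto simp: fixed_field_def fixator_def)
    then show ?case using Suc subfield_qbarD(4)[OF E] by simp
  qed (simp add: subfield_qbarD(2)[OF E])
  have "R.Span F (powers \<psi> ?n) = ?E"
  proof (intro equalityI subsetI)
    fix x assume "x \<in> R.Span F (powers \<psi> ?n)"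
    then obtain c where c: "\<forall>i. c i \<in> F" "x = (\<Sum>i<?n. c i * \<psi> ^ i)" unfolding Span_powers[OF F] by blast
    have "(\<Sum>i<m. c i * \<psi> ^ i) \<in> ?E" for m
      using c(1) FE by (induction m) (auto intro!: subfield_qbarD[OF E] \<psi>)
    then show "x \<in> ?E" using c(2) by simp
  next
    fix x assume "x \<in> ?E"
    then have "\<And>\<sigma>. \<sigma> \<in> Aut \<Longrightarrow> \<sigma> \<psi> = \<psi> \<Longrightarrow> \<sigma> x = x" by (auto simp: fixed_field_def fixator_def)
    then obtain p where p: "rat_poly p" "Polynomial.degree p < ?n" "poly p \<psi> = x"
      using fixed_imp_rat_poly by metis
    then show "x \<in> R.Span F (powers \<psi> ?n)" unfolding Span_powers[OF F]
      using poly_eq_sum_lessThan[OF p(2), of \<psi>] subfield_qbarD(7)[OF F]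
      by (intro exI[of _ "poly.coeff p"]) (auto simp: rat_poly_def)
  qed
  moreover have "R.finite_dimension F (R.Span F (powers \<psi> ?n))"
    by (rule R.Span_finite_dimension[OF F]) simp
  ultimately show ?thesis by (simp add: finite_ext_def)
qed

text \<open>A rational relation between the powers of \<open>\<theta>\<close> below the number \<open>n\<close> of conjugates would be a rational
polynomial of degree less than \<open>n\<close> with \<open>n\<close> roots.\<close>

lemma orbit_le_degree:
  assumes K: "number_field K" and "\<theta> \<in> K"
  shows "card (orbit_of Aut \<theta>) \<le> field_degree \<rat> K"
proof -
  let ?n = "card (orbit_of Aut \<theta>)"
  have sK: "subfield_qbar K" using K by (simp add: number_field_def)
  have "R.independent \<rat> (powers \<theta> m)" if "m \<le> ?n" for m
    using that
  proof (induction m)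
    case (Suc m)
    have "\<theta> ^ m \<notin> R.Span \<rat> (powers \<theta> m)"
    proof
      assume "\<theta> ^ m \<in> R.Span \<rat> (powers \<theta> m)"
      then obtain c where c: "\<forall>i. c i \<in> \<rat>" "\<theta> ^ m = (\<Sum>i<m. c i * \<theta> ^ i)"
        unfolding Span_powers[OF subfield_Rats] by blast
      let ?q = "\<Sum>i<m. Polynomial.monom (c i) i"
      let ?p = "Polynomial.monom 1 m - ?q"
      have "poly.coeff ?q i = (if i < m then c i else 0)" for i
        by (simp add: coeff_sum)
      then have co: "poly.coeff ?p i = (if i = m then 1 else if i < m then - c i else 0)" for i by simp
      have rp: "rat_poly ?p" unfolding rat_poly_def co using c(1) by auto
      have deg: "Polynomial.degree ?p \<le> m" 
      proof (rule degree_le, intro allI impI)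
        fix i assume "m < i" then show "poly.coeff ?p i = 0" unfolding co by simp
      qed
      have z: "poly ?p \<theta> = 0" using c(2) by (simp add: poly_sum poly_monom)
      have "poly ?p y = 0" if y: "y \<in> orbit_of Aut \<theta>" for y
      proof -
        obtain \<sigma> where s: "field_aut \<sigma>" "y = \<sigma> \<theta>" using y by (auto simp: orbit_of_def Aut_iff)
        show ?thesis unfolding s(2) field_aut_rat_poly[OF s(1) rp, symmetric] z by (rule field_autD(3)[OF s(1)])
      qed
      then have "?p = 0"
        using deg Suc(2) by (intro poly_eqI_degree[of "orbit_of Aut \<theta>"]) auto
      then show False using co[of m] by (metis coeff_0 zero_neq_one)
    qed
    then show ?case unfolding powers_Suc using Suc by (intro R.li_Cons) auto
  qed (simp add: powers_def)
  then have "R.independent \<rat> (powers \<theta> ?n)" by simp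
  moreover have "set (powers \<theta> ?n) \<subseteq> K"
  proof -
    have "\<theta> ^ i \<in> K" for i by (induction i) (auto intro: subfield_qbarD[OF sK] assms(2))
    then show ?thesis by (auto simp: powers_def)
  qed
  moreover have "R.dimension (field_degree \<rat> K) \<rat> K"
    using R.finite_dimensionE[OF subfield_Rats, of K] K
    by (simp add: number_field_def finite_ext_def field_degree_def over_def)
  ultimately show ?thesis
    using R.independent_length_le_dimension[OF subfield_Rats] length_powers by metis
qed

text \<open>This contains the Galois correspondence for number fields: \<open>K\<close> is the fixed field of \<open>Gal(K)\<close>.\<close>

lemma number_field_primitive_element:
  assumes K: "number_field K"
  obtains \<theta> where "\<theta> \<in> K" "carrier (abs_Gal K) = fixator Aut {\<theta>}" "fixed_field (carrier (abs_Gal K)) = K"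
proof -
  have sK: "subfield_qbar K" and "finite_ext \<rat> K" using K by (auto simp: number_field_def)
  then obtain Y where Y: "finite Y" "Y \<subseteq> K"
      "\<And>\<sigma>. \<sigma> \<in> Aut \<Longrightarrow> \<forall>y\<in>Y. \<sigma> y = y \<Longrightarrow> \<forall>x\<in>K. \<sigma> x = x"
    using finite_ext_generators[OF subfield_Rats] by metis
  obtain \<theta> where \<theta>: "\<And>E. subfield_qbar E \<Longrightarrow> Y \<subseteq> E \<Longrightarrow> \<theta> \<in> E" "fixator Aut {\<theta>} = fixator Aut Y"
    using ex_primitive_element[OF Y(1)] by metis
  have \<theta>K: "\<theta> \<in> K" by (rule \<theta>(1)[OF sK Y(2)])
  have "fixator Aut K = fixator Aut Y" using Y(2,3) by (auto simp: fixator_def)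
  then have eq: "carrier (abs_Gal K) = fixator Aut {\<theta>}" using abs_Gal_fixator[of K] \<theta>(2) by simp
  moreover have "K \<subseteq> fixed_field (carrier (abs_Gal K))" by (auto simp: fixed_field_def carrier_abs_Gal)
  ultimately have "fixed_field (carrier (abs_Gal K)) = K" using fixed_field_eq_adjoin[OF sK \<theta>K] by simp
  then show ?thesis using that \<theta>K eq by blast
qed

section \<open>The Krull topology is the topology of pointwise convergence\<close>

lemma krull_neighbourhood:
  assumes F: "subfield_qbar F" and V: "openin (krull_topology F) V" and s: "\<sigma> \<in> V"
  shows "V \<subseteq> carrier (abs_Gal F) \<and>
    (\<exists>Y. finite Y \<and> {\<tau> \<in> carrier (abs_Gal F). \<forall>x\<in>Y. \<tau> x = \<sigma> x} \<subseteq> V)"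
proof -
  interpret F: perm_group "abs_Gal F" by (rule perm_group_abs_Gal)
  let ?S = "{\<sigma> <#\<^bsub>abs_Gal F\<^esub> carrier (abs_Gal E) | \<sigma> E.
       \<sigma> \<in> carrier (abs_Gal F) \<and> subfield_qbar E \<and> F \<subseteq> E \<and> finite_ext F E}"
  let ?N = "\<lambda>\<sigma> Y. {\<tau> \<in> carrier (abs_Gal F). \<forall>x\<in>Y. \<tau> x = \<sigma> x}"
  have "generate_topology_on ?S V"
    using V by (simp add: krull_topology_def openin_topology_generated_by_iff)
  then have "V \<subseteq> carrier (abs_Gal F) \<and> (\<forall>\<sigma>\<in>V. \<exists>Y. finite Y \<and> ?N \<sigma> Y \<subseteq> V)"
  proof induction
    case (Int V W)
    show ?case
    proof (intro conjI ballI)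
      fix \<sigma> assume "\<sigma> \<in> V \<inter> W"
      then obtain Y Z where "finite Y" "?N \<sigma> Y \<subseteq> V" "finite Z" "?N \<sigma> Z \<subseteq> W" using Int by blast
      then show "\<exists>Y. finite Y \<and> ?N \<sigma> Y \<subseteq> V \<inter> W" by (intro exI[of _ "Y \<union> Z"]) auto
    qed (use Int in blast)
  next
    case (UN \<K>)
    show ?case
    proof (intro conjI ballI)
      fix \<sigma> assume "\<sigma> \<in> \<Union>\<K>"
      then obtain V where "V \<in> \<K>" "\<sigma> \<in> V" by blast
      have "\<forall>\<sigma>\<in>V. \<exists>Y. finite Y \<and> ?N \<sigma> Y \<subseteq> V" using UN.IH[OF \<open>V \<in> \<K>\<close>] by (rule conjunct2)
      then obtain Y where "finite Y" "?N \<sigma> Y \<subseteq> V" using \<open>\<sigma> \<in> V\<close> by blast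
      then show "\<exists>Y. finite Y \<and> ?N \<sigma> Y \<subseteq> \<Union>\<K>" using \<open>V \<in> \<K>\<close> by blast
    qed (use UN.IH in blast)
  next
    case (Basis B)
    then obtain \<rho> E where B: "B = \<rho> <#\<^bsub>abs_Gal F\<^esub> carrier (abs_Gal E)" and r: "\<rho> \<in> carrier (abs_Gal F)"
        and E: "subfield_qbar E" "F \<subseteq> E" "finite_ext F E" by blast
    have EF: "carrier (abs_Gal E) \<subseteq> carrier (abs_Gal F)" using E(2) by (auto simp: carrier_abs_Gal)
    have Beq: "B = (\<lambda>\<tau>. \<rho> \<circ> \<tau>) ` carrier (abs_Gal E)"
      unfolding B l_coset_def UNION_singleton_eq_range
      using EF by (intro image_cong refl F.mult_eq[OF r]) blast
    obtain Y where Y: "finite Y" "Y \<subseteq> E"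
        "\<And>\<sigma>. \<sigma> \<in> carrier (abs_Gal F) \<Longrightarrow> \<forall>y\<in>Y. \<sigma> y = y \<Longrightarrow> \<forall>x\<in>E. \<sigma> x = x"
      using finite_ext_generators[OF F E(3)] by metis
    have "?N \<sigma> Y \<subseteq> B" if "\<sigma> \<in> B" for \<sigma>
    proof
      fix \<tau> assume t: "\<tau> \<in> ?N \<sigma> Y"
      obtain \<epsilon> where e: "\<epsilon> \<in> carrier (abs_Gal E)" "\<sigma> = \<rho> \<circ> \<epsilon>" using \<open>\<sigma> \<in> B\<close> Beq by blast
      let ?\<delta> = "inv\<^bsub>abs_Gal F\<^esub> \<rho> \<circ> \<tau>"
      have d: "?\<delta> \<in> carrier (abs_Gal F)"
        by (rule F.subgroup_comp[OF F.subgroup_self]) (use r t in auto)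
      have "?\<delta> y = y" if "y \<in> Y" for y
        using t e r that Y(2) by (auto simp: carrier_abs_Gal[of E] F.inv_apply_eq_iff)
      then have "\<forall>x\<in>E. ?\<delta> x = x" using Y(3)[OF d] by blast
      then have "?\<delta> \<in> carrier (abs_Gal E)" using d by (auto simp: carrier_abs_Gal)
      moreover have "\<tau> = \<rho> \<circ> ?\<delta>" using r by (auto simp: fun_eq_iff)
      ultimately show "\<tau> \<in> B" unfolding Beq by blast
    qed
    moreover have "B \<subseteq> carrier (abs_Gal F)"
      unfolding Beq using F.subgroup_comp[OF F.subgroup_self r] EF by blast
    ultimately show ?case using Y(1) by blast
  qed simp
  then show ?thesis using s by blast
qed

text \<open>For the converse of the previous lemma, a finite set \<open>Y\<close> has to be contained in a finite extension
\<open>E\<close> of \<open>F\<close>; it is generated by a primitive element for \<open>Y\<close> together with one for \<open>F\<close>.\<close>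

lemma openin_krull_iff:
  assumes F: "number_field F"
  shows "openin (krull_topology F) V \<longleftrightarrow> V \<subseteq> carrier (abs_Gal F) \<and>
    (\<forall>\<sigma>\<in>V. \<exists>Y. finite Y \<and> {\<tau> \<in> carrier (abs_Gal F). \<forall>x\<in>Y. \<tau> x = \<sigma> x} \<subseteq> V)"
    (is "_ \<longleftrightarrow> ?R")
proof
  have sF: "subfield_qbar F" using F by (simp add: number_field_def)
  interpret F: perm_group "abs_Gal F" by (rule perm_group_abs_Gal)
  show ?R if "openin (krull_topology F) V"
    using krull_neighbourhood[OF sF that] by (cases "V = {}") blast+
  assume R: ?R
  obtain \<theta> where \<theta>: "\<theta> \<in> F" "carrier (abs_Gal F) = fixator Aut {\<theta>}" "fixed_field (carrier (abs_Gal F)) = F"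
    using number_field_primitive_element[OF F] by metis
  show "openin (krull_topology F) V"
  proof (subst openin_subopen, intro ballI)
    fix \<sigma> assume s: "\<sigma> \<in> V"
    then have sF': "\<sigma> \<in> carrier (abs_Gal F)" using R by blast
    obtain Y where Y: "finite Y" "{\<tau> \<in> carrier (abs_Gal F). \<forall>x\<in>Y. \<tau> x = \<sigma> x} \<subseteq> V" using R s by blast
    obtain \<psi> where \<psi>: "fixator Aut {\<psi>} = fixator Aut (insert \<theta> Y)"
      using ex_primitive_element[of "insert \<theta> Y"] Y(1) by (metis finite_insert)
    define E where "E = fixed_field (fixator Aut {\<psi>})"
    have FE: "F \<subseteq> E" using \<theta>(2,3) \<psi> by (auto simp: E_def fixed_field_def fixator_def)
    have sE: "subfield_qbar E" unfolding E_def by (rule subfield_fixed_field) (auto simp: fixator_def)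
    have GE: "carrier (abs_Gal E) = fixator Aut {\<psi>}"
      by (subst abs_Gal_fixator) (auto simp: E_def fixed_field_def fixator_def)
    have fin: "finite_ext F E" unfolding E_def by (rule finite_ext_fixed_field[OF sF FE[unfolded E_def]])
    define B where "B = \<sigma> <#\<^bsub>abs_Gal F\<^esub> carrier (abs_Gal E)"
    have "openin (krull_topology F) B"
      unfolding krull_topology_def B_def by (rule topology_generated_by_Basis) (use sF' sE FE fin in blast)
    moreover have EF: "carrier (abs_Gal E) \<subseteq> carrier (abs_Gal F)" using FE by (auto simp: carrier_abs_Gal)
    then have Beq: "B = (\<lambda>\<tau>. \<sigma> \<circ> \<tau>) ` carrier (abs_Gal E)"
      unfolding B_def l_coset_def UNION_singleton_eq_range
      by (intro image_cong refl F.mult_eq[OF sF']) blast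
    have "\<sigma> \<in> B" unfolding Beq
      by (rule image_eqI[of _ _ id]) (auto simp: carrier_abs_Gal field_aut_def)
    moreover have "B \<subseteq> V"
    proof
      fix \<tau> assume "\<tau> \<in> B"
      then obtain \<epsilon> where e: "\<epsilon> \<in> carrier (abs_Gal E)" "\<tau> = \<sigma> \<circ> \<epsilon>" unfolding Beq by blast
      then have "\<epsilon> x = x" if "x \<in> Y" for x using GE \<psi> that by (auto simp: fixator_def)
      moreover have "\<tau> \<in> carrier (abs_Gal F)"
        unfolding e(2) by (rule F.subgroup_comp[OF F.subgroup_self sF']) (use e EF in blast)
      ultimately show "\<tau> \<in> V" using Y(2) e by auto
    qed
    ultimately show "\<exists>B. openin (krull_topology F) B \<and> \<sigma> \<in> B \<and> B \<subseteq> V" by blast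
  qed
qed

lemma profinite_abs_Gal:
  assumes F: "number_field F"
  shows "profinite_perm_group (abs_Gal F) (krull_topology F)"
proof -
  interpret F: perm_group "abs_Gal F" by (rule perm_group_abs_Gal)
  have FA: "carrier (abs_Gal F) \<subseteq> Aut" by (auto simp: carrier_abs_Gal[of F] Aut_iff)
  have fin: "finite (orbit_of (carrier (abs_Gal F)) x)" for x
    using FA by (intro finite_subset[OF _ finite_orbit_Aut[of x]]) (auto simp: orbit_of_def)
  have "\<sigma> \<in> carrier (abs_Gal F)"
    if lim: "\<And>Y. finite Y \<Longrightarrow> \<exists>\<tau>\<in>carrier (abs_Gal F). \<forall>x\<in>Y. \<tau> x = \<sigma> x" for \<sigma>
  proof -
    have hom: "\<sigma> (x + y) = \<sigma> x + \<sigma> y \<and> \<sigma> (x * y) = \<sigma> x * \<sigma> y \<and> (\<sigma> x = \<sigma> y \<longrightarrow> x = y) \<and> \<sigma> 1 = 1" for x y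
    proof -
      have "\<exists>\<tau>\<in>carrier (abs_Gal F). \<forall>z\<in>{x, y, x + y, x * y, 1}. \<tau> z = \<sigma> z" by (rule lim) simp
      then obtain \<tau> where t: "\<tau> \<in> carrier (abs_Gal F)" "\<tau> x = \<sigma> x" "\<tau> y = \<sigma> y" "\<tau> (x + y) = \<sigma> (x + y)"
          "\<tau> (x * y) = \<sigma> (x * y)" "\<tau> 1 = \<sigma> 1" by auto
      then have ta: "field_aut \<tau>" by (auto simp: carrier_abs_Gal)
      show ?thesis using field_autD(2,4,5)[OF ta] t F.apply_eq_iff[OF t(1), of x y] by metis
    qed
    have "\<exists>x. \<sigma> x = y" for y
    proof -
      let ?O = "orbit_of (carrier (abs_Gal F)) y"
      obtain \<tau> where t: "\<tau> \<in> carrier (abs_Gal F)" "\<forall>x\<in>?O. \<tau> x = \<sigma> x" using lim[OF fin] by metis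
      have i: "inv\<^bsub>abs_Gal F\<^esub> \<tau> \<in> carrier (abs_Gal F)" using t(1) by simp
      then have "(inv\<^bsub>abs_Gal F\<^esub> \<tau>) y \<in> ?O" unfolding orbit_of_def by blast
      then have "\<sigma> ((inv\<^bsub>abs_Gal F\<^esub> \<tau>) y) = y" using t by (metis F.apply_inv)
      then show ?thesis ..
    qed
    then have "surj \<sigma>" unfolding surj_def by metis
    moreover have "inj \<sigma>" using hom by (blast intro: injI)
    ultimately have "bij \<sigma>" by (simp add: bij_def)
    moreover have "\<sigma> 1 = 1" "\<forall>x y. \<sigma> (x + y) = \<sigma> x + \<sigma> y" "\<forall>x y. \<sigma> (x * y) = \<sigma> x * \<sigma> y"
      using hom by blast+
    moreover have "\<sigma> x = x" if "x \<in> F" for x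
      using lim[of "{x}"] that by (auto simp: carrier_abs_Gal)
    ultimately show ?thesis by (simp add: carrier_abs_Gal field_aut_def)
  qed
  note cl = this
  show ?thesis
  proof (intro profinite_perm_group.intro[OF perm_group_abs_Gal] profinite_perm_group_axioms.intro)
    show "\<sigma> \<in> carrier (abs_Gal F)"
      if "\<And>Y. finite Y \<Longrightarrow> \<exists>\<tau>\<in>carrier (abs_Gal F). \<forall>x\<in>Y. \<tau> x = \<sigma> x" for \<sigma>
      by (rule cl[OF that])
  qed (use fin countable_qbar openin_krull_iff[OF F] in blast)+
qed

section \<open>Galois closures\<close>

lemma carrier_Gal: "\<sigma> \<in> carrier (Gal E F) \<longleftrightarrow> \<sigma> \<in> extensional E \<and> bij_betw \<sigma> E E \<and>
    (\<forall>x\<in>E. \<forall>y\<in>E. \<sigma> (x + y) = \<sigma> x + \<sigma> y \<and> \<sigma> (x * y) = \<sigma> x * \<sigma> y) \<and> \<sigma> 1 = 1 \<and> (\<forall>x\<in>F. \<sigma> x = x)"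
proof -
  have "\<sigma> x \<in> E" if "bij_betw \<sigma> E E" "x \<in> E" for x using that by (auto simp: bij_betw_def)
  then show ?thesis by (auto simp: Gal_def Bij_def ring_hom_def)
qed

lemma restrict_in_Gal:
  assumes E: "subfield_qbar E" and s: "\<sigma> \<in> Aut" "\<sigma> ` E = E"
  shows "restrict \<sigma> E \<in> carrier (Gal E \<rat>)"
proof -
  have f: "field_aut \<sigma>" using s(1) Aut_iff by blast
  have "inj_on \<sigma> E" using f by (metis field_autD(1) bij_is_inj inj_on_subset subset_UNIV)
  then have "bij_betw (restrict \<sigma> E) E E" using s(2) by (simp add: bij_betw_def inj_on_restrict_eq)
  then show ?thesis
    unfolding carrier_Gal
    using subfield_qbarD[OF E] field_autD(2,4,5)[OF f] field_aut_rat[OF f]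
    by (auto simp: subset_iff)
qed

text \<open>The graph of \<open>\<tau>\<close> is a partial homomorphism.\<close>

lemma Gal_extends:
  assumes E: "subfield_qbar E" and t: "\<tau> \<in> carrier (Gal E \<rat>)"
  obtains \<sigma> where "\<sigma> \<in> Aut" "\<sigma> ` E = E" "restrict \<sigma> E = \<tau>"
proof -
  have b: "bij_betw \<tau> E E" and ext: "\<tau> \<in> extensional E"
    and hom: "\<And>x y. x \<in> E \<Longrightarrow> y \<in> E \<Longrightarrow> \<tau> (x + y) = \<tau> x + \<tau> y \<and> \<tau> (x * y) = \<tau> x * \<tau> y"
    and rat: "\<And>x. x \<in> \<rat> \<Longrightarrow> \<tau> x = x"
    using t unfolding carrier_Gal by auto
  have "partial_hom ((\<lambda>x. (x, \<tau> x)) ` E)"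
    unfolding partial_hom_def
  proof (intro conjI ballI allI impI)
    show "(r, r) \<in> (\<lambda>x. (x, \<tau> x)) ` E" if "r \<in> \<rat>" for r
      using rat[OF that] subfield_qbarD(7)[OF E] that by (intro image_eqI[of _ _ r]) auto
  next
    fix a b c d assume "(a, b) \<in> (\<lambda>x. (x, \<tau> x)) ` E" "(c, d) \<in> (\<lambda>x. (x, \<tau> x)) ` E"
    then show "(a + c, b + d) \<in> (\<lambda>x. (x, \<tau> x)) ` E" "(a * c, b * d) \<in> (\<lambda>x. (x, \<tau> x)) ` E"
      using hom subfield_qbarD(3,4)[OF E] by (auto intro!: image_eqI)
  next
    show "b = 0" if "(0, b) \<in> (\<lambda>x. (x, \<tau> x)) ` E" for b using that rat[of 0] by auto
  qed
  then obtain \<sigma> where s: "field_aut \<sigma>" "\<And>a b. (a, b) \<in> (\<lambda>x. (x, \<tau> x)) ` E \<Longrightarrow> \<sigma> a = b"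
    using partial_hom_extend by blast
  have eq: "\<sigma> x = \<tau> x" if "x \<in> E" for x using s(2) that by blast
  then have "restrict \<sigma> E = \<tau>" using ext by (auto simp: restrict_def extensional_def fun_eq_iff)
  moreover have "\<sigma> ` E = E" using b eq by (auto simp: bij_betw_def)
  ultimately show ?thesis using that s(1) Aut_iff by blast
qed

lemma coeff_prod_linear_in_subfield:
  assumes E: "subfield_qbar E" and "S \<subseteq> E"
  shows "poly.coeff (\<Prod>y\<in>S. [:-y, 1:]) i \<in> E"
  using assms(2)
proof (induction S arbitrary: i rule: infinite_finite_induct)
  case (insert y S)
  let ?q = "\<Prod>y\<in>S. [:-y, 1:]"
  have "poly.coeff ([:-y, 1:] * ?q) i = - y * poly.coeff ?q i + poly.coeff (pCons 0 ?q) i"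
    by simp
  moreover have *: "poly.coeff ?q j \<in> E" "y \<in> E" for j using insert by auto
  have "- y * poly.coeff ?q i + poly.coeff (pCons 0 ?q) i \<in> E"
  proof (intro subfield_qbarD(3)[OF E])
    show "- y * poly.coeff ?q i \<in> E" by (intro subfield_qbarD(4,5)[OF E] *)
    show "poly.coeff (pCons 0 ?q) i \<in> E"
      using subfield_qbarD(1)[OF E] *(1) by (cases i) simp_all
  qed
  ultimately show ?case using insert(1,2) by simp
qed (use subfield_qbarD(1,2)[OF E] in \<open>auto simp: coeff_1\<close>)

text \<open>Galois extensions are normal. The automorphisms of \<open>E\<close> are the restrictions of the group \<open>V\<close> of
automorphisms that map \<open>E\<close> onto itself. The polynomial \<open>f\<close> whose roots are the finitely many images
of \<open>x\<close> under \<open>V\<close> is invariant under \<open>V\<close> and has coefficients in \<open>E\<close>, so it is rational, since \<open>E\<close> is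
Galois. Hence all conjugates of \<open>x\<close> are roots of \<open>f\<close>, and so are images of \<open>x\<close> under \<open>V\<close>.\<close>

lemma galois_contains_conjugates:
  assumes E: "subfield_qbar E" and gal: "is_galois E \<rat>" and x: "x \<in> E"
  shows "orbit_of Aut x \<subseteq> E"
proof -
  define V where "V = {\<sigma> \<in> Aut. \<sigma> ` E = E}"
  have V: "subgroup V (abs_Gal \<rat>)"
  proof (rule A.subgroupI_perm)
    show "id \<in> V" using A.subgroup_id[OF A.subgroup_self] by (simp add: V_def)
    show "\<sigma> \<circ> \<tau> \<in> V" if "\<sigma> \<in> V" "\<tau> \<in> V" for \<sigma> \<tau>
    proof -
      have "(\<sigma> \<circ> \<tau>) ` E = \<sigma> ` \<tau> ` E" by (rule image_comp[symmetric])
      then show ?thesis using that A.subgroup_comp[OF A.subgroup_self, of \<sigma> \<tau>] by (simp add: V_def)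
    qed
    show "inv\<^bsub>abs_Gal \<rat>\<^esub> \<sigma> \<in> V" if "\<sigma> \<in> V" for \<sigma>
    proof -
      have s: "\<sigma> \<in> Aut" "\<sigma> ` E = E" using that by (auto simp: V_def)
      have "(inv\<^bsub>abs_Gal \<rat>\<^esub> \<sigma>) ` \<sigma> ` E = E" using s(1) by (auto simp: image_image)
      then show ?thesis using s by (auto simp: V_def)
    qed
  qed (auto simp: V_def)
  have VA: "V \<subseteq> Aut" by (auto simp: V_def)
  have rational: "y \<in> \<rat>" if y: "y \<in> E" "\<And>\<sigma>. \<sigma> \<in> V \<Longrightarrow> \<sigma> y = y" for y
  proof -
    have "\<tau> y = y" if t: "\<tau> \<in> carrier (Gal E \<rat>)" for \<tau>
    proof -
      obtain \<sigma> where "\<sigma> \<in> Aut" "\<sigma> ` E = E" "restrict \<sigma> E = \<tau>" by (rule Gal_extends[OF E t])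
      then show ?thesis using y by (auto simp: V_def)
    qed
    then show ?thesis using gal y(1) by (auto simp: is_galois_def)
  qed
  let ?O = "orbit_of V x"
  let ?f = "\<Prod>y\<in>?O. [:-y, 1:]"
  have finO: "finite ?O" using VA by (intro finite_subset[OF _ finite_orbit_Aut[of x]]) (auto simp: orbit_of_def)
  have OE: "?O \<subseteq> E" using x by (auto simp: orbit_of_def V_def)
  have degf: "Polynomial.degree ?f = card ?O" by (subst degree_prod_sum_eq) auto
  have lead: "poly.coeff ?f (card ?O) = 1"
    using lead_coeff_prod[of "\<lambda>y. [:-y, 1:]" ?O] degf by simp
  have root: "poly ?f y = 0 \<longleftrightarrow> y \<in> ?O" for y using finO by (auto simp: poly_prod)
  have "map_poly \<sigma> ?f = ?f" if s: "\<sigma> \<in> V" for \<sigma>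
  proof (rule poly_eqI_degree_lead_coeff[of _ "card ?O" _ ?O])
    have f: "field_aut \<sigma>" using s VA Aut_iff by blast
    have co: "poly.coeff (map_poly \<sigma> ?f) i = \<sigma> (poly.coeff ?f i)" for i
      by (rule coeff_map_poly) (rule field_autD(3)[OF f])
    show "poly.coeff (map_poly \<sigma> ?f) (card ?O) = poly.coeff ?f (card ?O)"
      unfolding co lead by (rule field_autD(2)[OF f])
    show "Polynomial.degree (map_poly \<sigma> ?f) \<le> card ?O"
    proof (rule degree_le, intro allI impI)
      fix i assume "card ?O < i"
      then have "poly.coeff ?f i = 0" by (intro coeff_eq_0) (simp only: degf)
      then show "poly.coeff (map_poly \<sigma> ?f) i = 0" unfolding co by (simp only: field_autD(3)[OF f])
    qed
    fix y assume y: "y \<in> ?O"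
    let ?z = "(inv\<^bsub>abs_Gal \<rat>\<^esub> \<sigma>) y"
    have sA: "\<sigma> \<in> Aut" using s VA by blast
    have z: "?z \<in> ?O"
      using A.orbit_invariant[OF V, of x] y subgroup.m_inv_closed[OF V s] by (auto simp: invariant_def)
    have "\<sigma> (poly ?f ?z) = poly (map_poly \<sigma> ?f) (\<sigma> ?z)" by (rule field_aut_poly[OF f])
    then have "poly (map_poly \<sigma> ?f) y = 0"
      using iffD2[OF root z] field_autD(3)[OF f] A.apply_inv[OF sA] by simp
    then show "poly (map_poly \<sigma> ?f) y = poly ?f y" using iffD2[OF root y] by simp
  qed (simp_all add: degf)
  note f_fixed = this
  have "\<sigma> (poly.coeff ?f i) = poly.coeff ?f i" if s: "\<sigma> \<in> V" for \<sigma> i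
  proof -
    have "field_aut \<sigma>" using s VA Aut_iff by blast
    from coeff_map_poly[of \<sigma> ?f i, OF field_autD(3)[OF this]] show ?thesis unfolding f_fixed[OF s] ..
  qed
  then have rf: "rat_poly ?f"
    unfolding rat_poly_def by (blast intro: rational coeff_prod_linear_in_subfield[OF E OE])
  have "\<sigma> x \<in> ?O" if "\<sigma> \<in> Aut" for \<sigma>
  proof -
    have f: "field_aut \<sigma>" using that Aut_iff by blast
    have "poly ?f (\<sigma> x) = \<sigma> (poly ?f x)" by (rule field_aut_rat_poly[OF f rf, symmetric])
    also have "poly ?f x = 0" by (rule iffD2[OF root A.orbit_self[OF V]])
    finally have "poly ?f (\<sigma> x) = 0" using field_autD(3)[OF f] by simp
    then show ?thesis by (rule iffD1[OF root])
  qed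
  then show ?thesis using OE unfolding orbit_of_def[of Aut] by blast
qed

text \<open>The Galois closure is the field \<open>N\<close> generated by the conjugates of \<open>\<theta>\<close>, and the automorphisms of \<open>N\<close>
are the restrictions of those of the algebraic closure; they correspond to the permutations induced
on the set of conjugates, because the same automorphisms act trivially on that set and on \<open>N\<close>.\<close>

lemma order_Gal_galois_closure:
  assumes \<theta>: "\<theta> \<in> K" and K: "fixed_field (fixator Aut {\<theta>}) = K"
  shows "Coset.order (Gal (galois_closure K) \<rat>) = induced_order Aut (orbit_of Aut \<theta>)"
proof -
  let ?\<Omega> = "orbit_of Aut \<theta>"
  define N where "N = fixed_field (fixator Aut ?\<Omega>)"
  have inv\<Omega>: "invariant Aut ?\<Omega>" by (rule A.orbit_invariant[OF A.subgroup_self])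
  have sN: "subfield_qbar N" unfolding N_def by (rule subfield_fixed_field) (auto simp: fixator_def)
  have \<Omega>N: "?\<Omega> \<subseteq> N" by (auto simp: N_def fixed_field_def fixator_def)
  have fixN: "fixator Aut N = fixator Aut ?\<Omega>"
    using \<Omega>N by (auto simp: fixator_def N_def fixed_field_def)
  have "invariant Aut N" unfolding invariant_def
  proof (intro ballI)
    fix \<sigma> x assume s: "\<sigma> \<in> Aut" and x: "x \<in> N"
    have "\<tau> (\<sigma> x) = \<sigma> x" if t: "\<tau> \<in> fixator Aut ?\<Omega>" for \<tau>
    proof -
      let ?\<rho> = "inv\<^bsub>abs_Gal \<rat>\<^esub> \<sigma> \<circ> (\<tau> \<circ> \<sigma>)"
      have tA: "\<tau> \<in> Aut" using t by (auto simp: fixator_def)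
      have "?\<rho> \<in> Aut"
        by (intro A.subgroup_comp[OF A.subgroup_self] s tA) (use s in simp)
      moreover have "?\<rho> y = y" if "y \<in> ?\<Omega>" for y
        using t s inv\<Omega> that by (auto simp: fixator_def invariant_def)
      ultimately have "?\<rho> \<in> fixator Aut ?\<Omega>" by (simp add: fixator_def)
      then have "?\<rho> x = x" using x unfolding N_def fixed_field_def by blast
      then show ?thesis using s by (simp add: A.inv_apply_eq_iff)
    qed
    then show "\<sigma> x \<in> N" by (simp add: N_def fixed_field_def)
  qed
  then have im: "\<sigma> ` N = N" if "\<sigma> \<in> Aut" for \<sigma> by (rule A.invariant_image_eq[OF A.subgroup_self _ that])
  have carN: "carrier (Gal N \<rat>) = (\<lambda>\<sigma>. restrict \<sigma> N) ` Aut"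
  proof
    show "carrier (Gal N \<rat>) \<subseteq> (\<lambda>\<sigma>. restrict \<sigma> N) ` Aut"
    proof
      fix \<tau> assume "\<tau> \<in> carrier (Gal N \<rat>)"
      then obtain \<sigma> where "\<sigma> \<in> Aut" "\<sigma> ` N = N" "restrict \<sigma> N = \<tau>" by (rule Gal_extends[OF sN])
      then show "\<tau> \<in> (\<lambda>\<sigma>. restrict \<sigma> N) ` Aut" by blast
    qed
    show "(\<lambda>\<sigma>. restrict \<sigma> N) ` Aut \<subseteq> carrier (Gal N \<rat>)"
      using restrict_in_Gal[OF sN] im by blast
  qed
  have "x \<in> \<rat>" if "x \<in> N" "\<forall>\<tau>\<in>carrier (Gal N \<rat>). \<tau> x = x" for x
    using that unfolding carN by (intro rat_if_fixed) auto
  moreover have "\<rat> \<subseteq> N" by (rule subfield_qbarD(7)[OF sN])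
  ultimately have galN: "is_galois N \<rat>" unfolding is_galois_def by (auto simp: carrier_Gal)
  have KN: "K \<subseteq> N"
    unfolding K[symmetric] N_def using A.orbit_self[OF A.subgroup_self, of \<theta>]
    by (auto simp: fixed_field_def fixator_def)
  have "N \<subseteq> E" if E: "subfield_qbar E" "is_galois E \<rat>" "K \<subseteq> E" for E
  proof -
    have "?\<Omega> \<subseteq> E" using galois_contains_conjugates[OF E(1,2)] E(3) \<theta> by blast
    moreover obtain \<psi> where "\<And>E. subfield_qbar E \<Longrightarrow> ?\<Omega> \<subseteq> E \<Longrightarrow> \<psi> \<in> E"
        "fixator Aut {\<psi>} = fixator Aut ?\<Omega>"
      using ex_primitive_element[OF finite_orbit_Aut] by metis
    ultimately show ?thesis unfolding N_def using fixed_field_eq_adjoin[OF E(1)] E(1) by metis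
  qed
  then have "galois_closure K = N" unfolding galois_closure_def using sN galN KN by blast
  then have "Coset.order (Gal (galois_closure K) \<rat>) = induced_order Aut N"
    by (simp add: Coset.order_def carN induced_order_def)
  also have "\<dots> = induced_order Aut ?\<Omega>"
    unfolding A.rel_index_fixator(1)[OF A.subgroup_self, symmetric] fixN ..
  finally show ?thesis .
qed

section \<open>Sylow-conjugate number fields\<close>

text \<open>The existence of Sylow subgroups turns the hypothesis, which speaks of all pairs of them, into a
statement about one pair.\<close>

lemma sylow_conjugate_subgroups:
  assumes K: "number_field K" and L: "number_field L" and syl: "sylow_conjugate K L"
    and p: "Factorial_Ring.prime p"
  obtains P Q g where "pro_sylow p (abs_Gal K) (krull_topology K) P"
    "pro_sylow p (abs_Gal L) (krull_topology L) Q" "g \<in> Aut"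
    "Q = (\<lambda>\<sigma>. g \<circ> \<sigma> \<circ> inv\<^bsub>abs_Gal \<rat>\<^esub> g) ` P"
proof -
  interpret K: profinite_perm_group "abs_Gal K" "krull_topology K" by (rule profinite_abs_Gal[OF K])
  interpret L: profinite_perm_group "abs_Gal L" "krull_topology L" by (rule profinite_abs_Gal[OF L])
  obtain P where P: "pro_sylow p (abs_Gal K) (krull_topology K) P" by (rule K.pro_sylow_exists[OF p])
  obtain Q where Q: "pro_sylow p (abs_Gal L) (krull_topology L) Q" by (rule L.pro_sylow_exists[OF p])
  have "conjugate_in (abs_Gal \<rat>) P Q" using syl p P Q by (auto simp: sylow_conjugate_def)
  then obtain g where g: "g \<in> Aut" "Q = g <#\<^bsub>abs_Gal \<rat>\<^esub> (P #>\<^bsub>abs_Gal \<rat>\<^esub> inv\<^bsub>abs_Gal \<rat>\<^esub> g)"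
    by (auto simp: conjugate_in_def)
  have PA: "\<sigma> \<in> Aut" if "\<sigma> \<in> P" for \<sigma>
  proof -
    have "\<sigma> \<in> carrier (abs_Gal K)" using P that by (auto simp: pro_sylow_def dest: subgroup.mem_carrier)
    then show ?thesis by (simp add: carrier_abs_Gal[of K] Aut_iff)
  qed
  have c: "g \<otimes>\<^bsub>abs_Gal \<rat>\<^esub> (\<sigma> \<otimes>\<^bsub>abs_Gal \<rat>\<^esub> inv\<^bsub>abs_Gal \<rat>\<^esub> g) = g \<circ> \<sigma> \<circ> inv\<^bsub>abs_Gal \<rat>\<^esub> g"
    if "\<sigma> \<in> P" for \<sigma>
  proof -
    have i: "inv\<^bsub>abs_Gal \<rat>\<^esub> g \<in> Aut" using g(1) by simp
    show ?thesis
      using A.mult_eq[OF PA[OF that] i] A.mult_eq[OF g(1) A.m_closed[OF PA[OF that] i]]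
      by (simp add: comp_assoc)
  qed
  have "Q = (\<lambda>\<sigma>. g \<circ> \<sigma> \<circ> inv\<^bsub>abs_Gal \<rat>\<^esub> g) ` P"
    unfolding g(2) l_coset_def r_coset_def using c by (auto simp: image_iff)
  then show ?thesis using that P Q g(1) by blast
qed

text \<open>For every prime \<open>p\<close>, the \<open>p\<close>-part of either order is the order of the group induced by a Sylow
subgroup, and conjugate subgroups induce groups of the same order.\<close>

lemma sylow_conjugate_induced_order:
  assumes K: "number_field K" and L: "number_field L" and syl: "sylow_conjugate K L"
    and Y: "finite Y" "invariant Aut Y"
  shows "induced_order (carrier (abs_Gal K)) Y = induced_order (carrier (abs_Gal L)) Y"
proof -
  interpret K: profinite_perm_group "abs_Gal K" "krull_topology K" by (rule profinite_abs_Gal[OF K])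
  interpret L: profinite_perm_group "abs_Gal L" "krull_topology L" by (rule profinite_abs_Gal[OF L])
  have inv: "invariant (carrier (abs_Gal E)) Y" for E
    using Y(2) by (auto simp: invariant_def carrier_abs_Gal[of E] Aut_iff)
  have pos: "induced_order (carrier (abs_Gal E)) Y > 0" if "number_field E" for E
  proof -
    interpret E: profinite_perm_group "abs_Gal E" "krull_topology E" by (rule profinite_abs_Gal[OF that])
    show ?thesis using E.finite_restrictions[OF Y(1) order.refl] E.subgroup_id[OF E.subgroup_self]
      by (auto simp: induced_order_def card_gt_0_iff)
  qed
  have "multiplicity p (induced_order (carrier (abs_Gal K)) Y) =
    multiplicity p (induced_order (carrier (abs_Gal L)) Y)" if p: "Factorial_Ring.prime p" for p :: nat
  proof -
    obtain P Q g where P: "pro_sylow p (abs_Gal K) (krull_topology K) P"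
      and Q: "pro_sylow p (abs_Gal L) (krull_topology L) Q" and g: "g \<in> Aut"
      and conj: "Q = (\<lambda>\<sigma>. g \<circ> \<sigma> \<circ> inv\<^bsub>abs_Gal \<rat>\<^esub> g) ` P"
      using sylow_conjugate_subgroups[OF K L syl p] by metis
    obtain k m where km: "induced_order P Y = p ^ k" "induced_order (carrier (abs_Gal K)) Y = m * p ^ k" "\<not> p dvd m"
      by (rule K.pro_sylow_induced_order[OF p P Y(1) inv])
    obtain l n where ln: "induced_order Q Y = p ^ l" "induced_order (carrier (abs_Gal L)) Y = n * p ^ l" "\<not> p dvd n"
      by (rule L.pro_sylow_induced_order[OF p Q Y(1) inv])
    have gY: "g y \<in> Y" "(inv\<^bsub>abs_Gal \<rat>\<^esub> g) y \<in> Y" if "y \<in> Y" for y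
      using Y(2) g that by (auto simp: invariant_def)
    have "induced_order Q Y = induced_order P Y"
      unfolding conj induced_order_def image_image
    proof (rule card_image_eq_if_same_kernel(2), unfold restrict_eq_iff)
      fix \<sigma> \<tau> :: "qbar \<Rightarrow> qbar"
      have "(\<forall>y\<in>Y. g (\<sigma> ((inv\<^bsub>abs_Gal \<rat>\<^esub> g) y)) = g (\<tau> ((inv\<^bsub>abs_Gal \<rat>\<^esub> g) y))) \<longleftrightarrow>
          (\<forall>y\<in>Y. \<sigma> ((inv\<^bsub>abs_Gal \<rat>\<^esub> g) y) = \<tau> ((inv\<^bsub>abs_Gal \<rat>\<^esub> g) y))"
        using A.apply_eq_iff[OF g] by simp
      also have "\<dots> \<longleftrightarrow> (\<forall>y\<in>Y. \<sigma> y = \<tau> y)"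
        using gY A.inv_apply[OF g] by metis
      finally show "(\<forall>y\<in>Y. (g \<circ> \<sigma> \<circ> inv\<^bsub>abs_Gal \<rat>\<^esub> g) y = (g \<circ> \<tau> \<circ> inv\<^bsub>abs_Gal \<rat>\<^esub> g) y) \<longleftrightarrow>
          (\<forall>y\<in>Y. \<sigma> y = \<tau> y)" by simp
    qed
    then have pow: "p ^ k = p ^ l" using km ln by simp
    have mult: "multiplicity p (a * p ^ j) = j" if "\<not> p dvd a" for a j
    proof -
      have "a \<noteq> 0" "p \<noteq> 0" using that prime_gt_0_nat[OF p] by (metis dvd_0_right, simp)
      then have "multiplicity p (a * p ^ j) = multiplicity p a + multiplicity p (p ^ j)"
        by (intro prime_elem_multiplicity_mult_distrib prime_imp_prime_elem p) auto
      then show ?thesis using that p by (simp add: not_dvd_imp_multiplicity_0 multiplicity_same_power)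
    qed
    have "k = l" using pow prime_gt_1_nat[OF p] by (simp add: power_inject_exp)
    then show ?thesis using mult[OF km(3)] mult[OF ln(3)] km(2) ln(2) by simp
  qed
  then show ?thesis by (rule multiplicity_eq_nat[OF pos[OF K] pos[OF L]])
qed

lemma isomorphic_if_equal_stabilizer:
  assumes g: "g \<in> Aut" and K: "fixed_field (fixator Aut {\<theta>}) = K" and L: "fixed_field (fixator Aut {g \<theta>}) = L"
  shows "qbar_ring K \<simeq> qbar_ring L"
proof -
  have f: "field_aut g" using g Aut_iff by blast
  have sub: "h x \<in> fixed_field (fixator Aut {h z})"
    if h: "h \<in> Aut" and x: "x \<in> fixed_field (fixator Aut {z})" for h x z
  proof -
    have "\<sigma> (h x) = h x" if s: "\<sigma> \<in> Aut" "\<sigma> (h z) = h z" for \<sigma>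
    proof -
      let ?\<rho> = "inv\<^bsub>abs_Gal \<rat>\<^esub> h \<circ> (\<sigma> \<circ> h)"
      have "?\<rho> \<in> Aut" by (intro A.subgroup_comp[OF A.subgroup_self] s h) (use h in simp)
      moreover have "?\<rho> z = z" using s h by simp
      ultimately have "?\<rho> \<in> fixator Aut {z}" by (simp add: fixator_def)
      then have "?\<rho> x = x" using x unfolding fixed_field_def by blast
      then show ?thesis using h by (simp add: A.inv_apply_eq_iff)
    qed
    then show ?thesis by (simp add: fixed_field_def fixator_def)
  qed
  have "g ` K = L"
  proof
    show "g ` K \<subseteq> L" unfolding K[symmetric] L[symmetric] using sub[OF g] by blast
    show "L \<subseteq> g ` K"
    proof
      fix x assume "x \<in> L"
      then have "(inv\<^bsub>abs_Gal \<rat>\<^esub> g) x \<in> K"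
        using sub[of "inv\<^bsub>abs_Gal \<rat>\<^esub> g" x "g \<theta>"] g K L by simp
      then show "x \<in> g ` K" using g by (intro image_eqI[of _ _ "(inv\<^bsub>abs_Gal \<rat>\<^esub> g) x"]) auto
    qed
  qed
  moreover have "inj_on g K" using A.apply_eq_iff[OF g] by (auto intro: inj_onI)
  ultimately have "g \<in> ring_iso (qbar_ring K) (qbar_ring L)"
    using field_autD(2,4,5)[OF f] by (auto simp: ring_iso_def ring_hom_def bij_betw_def)
  then show ?thesis by (auto simp: is_ring_iso_def)
qed

theorem proposition3p6:
  fixes K L M :: "qbar set"
  assumes "number_field K" and "number_field L"
    and "sylow_conjugate K L"
    and "M = galois_closure K"
    and "field_degree \<rat> K \<le> 6 \<or> Coset.order (Gal M \<rat>) < 48"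
  shows "qbar_ring K \<simeq> qbar_ring L"
proof -
  note K = assms(1) and L = assms(2) and syl = assms(3)
  let ?H = "carrier (abs_Gal K)" and ?B = "carrier (abs_Gal L)"
  obtain \<theta> where \<theta>: "\<theta> \<in> K" "?H = fixator Aut {\<theta>}" "fixed_field ?H = K"
    using number_field_primitive_element[OF K] by metis
  obtain \<phi> where \<phi>: "\<phi> \<in> L" "?B = fixator Aut {\<phi>}" "fixed_field ?B = L"
    using number_field_primitive_element[OF L] by metis
  interpret L: profinite_perm_group "abs_Gal L" "krull_topology L" by (rule profinite_abs_Gal[OF L])
  define \<Omega> where "\<Omega> = orbit_of Aut \<theta>"
  have fin: "finite \<Omega>" unfolding \<Omega>_def by (rule finite_orbit_Aut)
  have inv: "invariant Aut \<Omega>" unfolding \<Omega>_def by (rule A.orbit_invariant[OF A.subgroup_self])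
  have H: "subgroup ?H (abs_Gal \<rat>)" and B: "subgroup ?B (abs_Gal \<rat>)" by (rule subgroup_abs_Gal)+
  have HA: "?H \<subseteq> Aut" and BA: "?B \<subseteq> Aut" using subgroup.subset[OF H] subgroup.subset[OF B] by auto
  have restr: "finite ((\<lambda>\<sigma>. restrict \<sigma> Y) ` Aut)" if "finite Y" for Y
  proof (rule finite_subset)
    show "(\<lambda>\<sigma>. restrict \<sigma> Y) ` Aut \<subseteq> (\<Pi>\<^sub>E x\<in>Y. orbit_of Aut x)" by (auto simp: orbit_of_def)
    show "finite (\<Pi>\<^sub>E x\<in>Y. orbit_of Aut x)" by (intro finite_PiE that finite_orbit_Aut)
  qed
  have index_H: "rel_index (abs_Gal \<rat>) Aut ?H = card \<Omega>"
    unfolding \<theta>(2) \<Omega>_def by (rule A.orbit_stabilizer[OF A.subgroup_self])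
  \<comment> \<open>\<open>[L:\<rat>] = [K:\<rat>]\<close>, seen on a finite set on which both \<open>Gal(K)\<close> and \<open>Gal(L)\<close> are visible\<close>
  have index_B: "rel_index (abs_Gal \<rat>) Aut ?B = card \<Omega>"
  proof -
    let ?Y = "\<Omega> \<union> orbit_of Aut \<phi>"
    have Y: "finite ?Y" "invariant Aut ?Y"
      using fin finite_orbit_Aut inv A.orbit_invariant[OF A.subgroup_self, of \<phi>] by (auto simp: invariant_def)
    have "fixator Aut ?Y \<subseteq> fixator Aut {\<theta>}" "fixator Aut ?Y \<subseteq> fixator Aut {\<phi>}"
      using A.orbit_self[OF A.subgroup_self] by (auto simp: fixator_def \<Omega>_def)
    then have "induced_order Aut ?Y = rel_index (abs_Gal \<rat>) Aut ?H * induced_order ?H ?Y"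
      "induced_order Aut ?Y = rel_index (abs_Gal \<rat>) Aut ?B * induced_order ?B ?Y"
      using A.induced_order_mult[OF H A.subgroup_self HA _ restr[OF Y(1)]]
        A.induced_order_mult[OF B A.subgroup_self BA _ restr[OF Y(1)]] \<theta>(2) \<phi>(2) by simp_all
    moreover have "induced_order ?H ?Y = induced_order ?B ?Y"
      by (rule sylow_conjugate_induced_order[OF K L syl Y])
    moreover have "induced_order Aut ?Y > 0"
      using restr[OF Y(1)] A.subgroup_id[OF A.subgroup_self] by (auto simp: induced_order_def card_gt_0_iff)
    ultimately show ?thesis using index_H by auto
  qed
  have order: "induced_order Aut \<Omega> = card \<Omega> * induced_order ?B \<Omega>"
  proof -
    have "fixator Aut \<Omega> \<subseteq> ?H"
      unfolding \<theta>(2) \<Omega>_def using A.orbit_self[OF A.subgroup_self] by (auto simp: fixator_def)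
    then show ?thesis
      using A.induced_order_mult[OF H A.subgroup_self HA _ restr[OF fin]] index_H
        sylow_conjugate_induced_order[OF K L syl fin inv] by simp
  qed
  \<comment> \<open>the conjugate \<open>Q\<close> of \<open>P\<close> fixes \<open>g \<theta>\<close>, so the orbit of \<open>g \<theta>\<close> has size prime to \<open>p\<close>\<close>
  have coprime: "\<exists>y\<in>\<Omega>. \<not> p dvd card (orbit_of ?B y)" if p: "Factorial_Ring.prime p" for p :: nat
  proof -
    obtain P Q g where P: "pro_sylow p (abs_Gal K) (krull_topology K) P"
      and Q: "pro_sylow p (abs_Gal L) (krull_topology L) Q" and g: "g \<in> Aut"
      and conj: "Q = (\<lambda>\<sigma>. g \<circ> \<sigma> \<circ> inv\<^bsub>abs_Gal \<rat>\<^esub> g) ` P"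
      using sylow_conjugate_subgroups[OF K L syl p] by metis
    have "\<sigma> \<theta> = \<theta>" if "\<sigma> \<in> P" for \<sigma>
    proof -
      have "\<sigma> \<in> ?H" using P that by (auto simp: pro_sylow_def dest: subgroup.mem_carrier)
      then show ?thesis unfolding \<theta>(2) by (simp add: fixator_def)
    qed
    then have "\<sigma> (g \<theta>) = g \<theta>" if "\<sigma> \<in> Q" for \<sigma> using that g unfolding conj by auto
    then have "\<not> p dvd card (orbit_of ?B (g \<theta>))" by (rule L.pro_sylow_orbit[OF Q])
    moreover have "g \<theta> \<in> \<Omega>" using g by (auto simp: \<Omega>_def orbit_of_def)
    ultimately show ?thesis by blast
  qed
  have small: "card \<Omega> \<le> 6 \<or> induced_order Aut \<Omega> < 48"
    using assms(4,5) orbit_le_degree[OF K \<theta>(1)] order_Gal_galois_closure[OF \<theta>(1)] \<theta>(2,3)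
    by (auto simp: \<Omega>_def)
  obtain y where y: "y \<in> \<Omega>" "\<forall>\<sigma>\<in>?B. \<sigma> y = y"
    using A.ex_fixed_point_if_orbits_coprime[OF \<Omega>_def fin B index_B order coprime small] by blast
  then obtain g where g: "g \<in> Aut" "y = g \<theta>" by (auto simp: \<Omega>_def orbit_of_def)
  have F: "subgroup (fixator Aut {y}) (abs_Gal \<rat>)" by (rule A.fixator_subgroup[OF A.subgroup_self])
  \<comment> \<open>the stabilizer of the fixed point \<open>y = g \<theta>\<close> contains \<open>Gal(L)\<close> and has the same index\<close>
  have BF: "?B \<subseteq> fixator Aut {y}" using y(2) BA by (auto simp: fixator_def)
  have pos: "card \<Omega> > 0"
    using fin A.orbit_self[OF A.subgroup_self, of \<theta>] by (auto simp: card_gt_0_iff \<Omega>_def)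
  then have "finite (rcosets\<^bsub>abs_Gal \<rat>\<lparr>carrier := Aut\<rparr>\<^esub> ?B)"
    using index_B unfolding rel_index_def by (metis card_ge_0_finite)
  then have "rel_index (abs_Gal \<rat>) Aut ?B = rel_index (abs_Gal \<rat>) Aut (fixator Aut {y}) * rel_index (abs_Gal \<rat>) (fixator Aut {y}) ?B"
    by (intro A.rel_index_mult[OF B F A.subgroup_self BF]) (auto simp: fixator_def)
  moreover have "rel_index (abs_Gal \<rat>) Aut (fixator Aut {y}) = card \<Omega>"
    using A.orbit_stabilizer[OF A.subgroup_self, of y] A.orbit_eq[OF A.subgroup_self, of y \<theta>] y(1)
    by (simp add: \<Omega>_def)
  ultimately have "rel_index (abs_Gal \<rat>) (fixator Aut {y}) ?B = 1" using index_B pos by simp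
  then have "?B = fixator Aut {y}" by (rule A.subgroup_eq_if_rel_index_1[OF B F BF])
  then show ?thesis using isomorphic_if_equal_stabilizer[OF g(1)] \<theta>(2,3) \<phi>(3) g(2) by metis
qed

end
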